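(* For every essential arrangement $\mathcal A$ of $d$ lines in $\mathbb P^2_k$, $\mathrm{reg}(\mathcal D)\le d-2$. This bound is tight for generic arrangements, i.e. $\mathrm{reg}(\mathcal D)=d-2$ when $\mathcal A$ is generic.
   Context: $k$ is a field of characteristic $0$, $R=k[x_0,x_1,x_2]$. An arrangement $\mathcal A$ of $d$ lines in $\mathbb P^2_k$ is a set of $d$ distinct lines, with defining polynomial $Q\in R_d$ the product of the $d$ linear forms; it is essential if the lines do not all pass through one point, and generic if no three of the lines pass through a common point. $D_0=\{\theta=\sum f_i\,\partial/\partial x_i\in\mathrm{Der}_k(R):\theta(Q)=0\}$ is the module of syzygies on the partial derivatives of $Q$, graded by $\deg\theta=\deg f_i$, and $\mathcal D$ is the associated sheaf on $\mathbb P^2$ (a rank two vector bundle). A coherent sheaf $\mathcal F$ on $\mathbb P^n$ is $m$-regular if $H^i(\mathcal F(m-i))=0$ for all $i\ge1$; $\mathrm{reg}(\mathcal F)$ is the least $m$ such that $\mathcal F$ is $m$-regular. *)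

theory Defs
  imports
    "HOL-Analysis.Finite_Cartesian_Product"
    "HOL-Library.Poly_Mapping"
    "HOL-Library.Numeral_Type"
    "HOL-Computational_Algebra.Fraction_Field"
begin

section \<open>The graded ring in three variables\<close>

text \<open>
  The index type \<open>3\<close> has exactly the elements 0, 1, 2, so \<open>'k poly3\<close> is
  k[x0, x1, x2]: finitely supported functions from exponent vectors to k, with convolution
  product.
\<close>

type_synonym 'k poly3 = "(3 \<Rightarrow>\<^sub>0 nat) \<Rightarrow>\<^sub>0 'k"

definition X :: "3 \<Rightarrow> 'k::field_char_0 poly3" where
  "X i = Poly_Mapping.single (Poly_Mapping.single i 1) 1"

definition linear_form :: "'k::field_char_0 ^ 3 \<Rightarrow> 'k poly3" where
  "linear_form a = (\<Sum>i\<in>UNIV. Poly_Mapping.single 0 (a $ i) * X i)"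

text \<open>The zero polynomial is homogeneous of every degree.\<close>

definition homogeneous :: "nat \<Rightarrow> 'k::field_char_0 poly3 \<Rightarrow> bool" where
  "homogeneous n p \<longleftrightarrow>
     (\<forall>\<mu>\<in>Poly_Mapping.keys p. (\<Sum>i\<in>UNIV. Poly_Mapping.lookup \<mu> i) = n)"

text \<open>
  In the following formula the subtraction of exponents truncates only when the exponent of
  the variable is 0, and then the coefficient vanishes.
\<close>

definition partial_deriv :: "3 \<Rightarrow> 'k::field_char_0 poly3 \<Rightarrow> 'k poly3" where
  "partial_deriv i p =
     (\<Sum>\<mu>\<in>Poly_Mapping.keys p.
        Poly_Mapping.single (\<mu> - Poly_Mapping.single i 1)
          (of_nat (Poly_Mapping.lookup \<mu> i) * Poly_Mapping.lookup p \<mu>))"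


section \<open>Line arrangements\<close>

text \<open>
  A point of the projective plane is given by a nonzero vector of homogeneous coordinates, and
  a line by the plane in \<open>k\<^sup>3\<close> on which a nonzero linear form vanishes.  Two distinct lines
  meet in a k-rational point, so k-points suffice for the incidence conditions below, also
  when k is not algebraically closed.
\<close>

definition proj_line :: "'k::field_char_0 ^ 3 \<Rightarrow> ('k ^ 3) set" where
  "proj_line a = {p. (\<Sum>i\<in>UNIV. a $ i * p $ i) = 0}"

definition line_arrangement :: "('k::field_char_0 ^ 3) set set \<Rightarrow> bool" where
  "line_arrangement A \<longleftrightarrow> finite A \<and> (\<forall>L\<in>A. \<exists>a. a \<noteq> 0 \<and> L = proj_line a)"

definition concurrent :: "('k::field_char_0 ^ 3) set set \<Rightarrow> bool" where
  "concurrent B \<longleftrightarrow> (\<exists>p. p \<noteq> 0 \<and> (\<forall>L\<in>B. p \<in> L))"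

definition essential :: "('k::field_char_0 ^ 3) set set \<Rightarrow> bool" where
  "essential A \<longleftrightarrow> \<not> concurrent A"

definition generic :: "('k::field_char_0 ^ 3) set set \<Rightarrow> bool" where
  "generic A \<longleftrightarrow> (\<forall>B\<subseteq>A. card B = 3 \<longrightarrow> \<not> concurrent B)"

text \<open>The defining polynomial is determined only up to a nonzero scalar; hence a predicate.\<close>

definition defining_polynomial :: "('k::field_char_0 ^ 3) set set \<Rightarrow> 'k poly3 \<Rightarrow> bool" where
  "defining_polynomial A Q \<longleftrightarrow>
     (\<exists>\<alpha>. (\<forall>L\<in>A. \<alpha> L \<noteq> 0 \<and> L = proj_line (\<alpha> L)) \<and>
          Q = (\<Prod>L\<in>A. linear_form (\<alpha> L)))"


section \<open>Derivations killing the defining polynomial\<close>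

text \<open>
  The k-derivation \<open>\<Sum>i. f\<^sub>i \<partial>/\<partial>x\<^sub>i\<close> is represented by its coefficient vector.
\<close>

definition derivation :: "'k::field_char_0 poly3 ^ 3 \<Rightarrow> 'k poly3 \<Rightarrow> 'k poly3" where
  "derivation \<theta> p = (\<Sum>i\<in>UNIV. \<theta> $ i * partial_deriv i p)"

definition D0 :: "'k::field_char_0 poly3 \<Rightarrow> ('k poly3 ^ 3) set" where
  "D0 Q = {\<theta>. derivation \<theta> Q = 0}"


section \<open>The associated sheaf and its cohomology\<close>

text \<open>
  Let M be a graded submodule of the free module \<open>R\<^sup>r\<close>, and f a nonzero homogeneous element of
  positive degree.  The sections of \<open>M~(m)\<close> over the basic open set \<open>D\<^sub>+(f)\<close> are the degree m
  part of the localization \<open>M\<^sub>f\<close>.  As M is torsion free, \<open>M\<^sub>f\<close> is the set of fractions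
  \<open>g / f\<^sup>N\<close> with g in M, inside \<open>Frac(R)\<^sup>r\<close>; its degree m part consists of those with g
  homogeneous of degree \<open>m + N deg f\<close>, and restriction to a smaller basic open set is inclusion.
\<close>

definition sheaf_sections ::
    "('k::field_char_0 poly3 ^ 'r) set \<Rightarrow> int \<Rightarrow> 'k poly3 \<Rightarrow> ('k poly3 fract ^ 'r) set" where
  "sheaf_sections M m f =
     {(\<chi> j. Fract (g $ j) (f ^ N)) | g N e n.
        g \<in> M \<and> homogeneous e f \<and> (\<forall>j. homogeneous n (g $ j)) \<and> int n = m + int (N * e)}"

text \<open>
  Cohomology of \<open>M~(m)\<close> is Cech cohomology for the standard affine cover
  \<open>D\<^sub>+(x\<^sub>0), D\<^sub>+(x\<^sub>1), D\<^sub>+(x\<^sub>2)\<close> of the projective plane; as \<open>M~(m)\<close> is quasi-coherent and the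
  plane is separated, this is its sheaf cohomology.  A p-cochain has one component for each
  set I of p+1 indices, a section over \<open>D\<^sub>+(\<Prod>i\<in>I. x\<^sub>i)\<close>; it is extended by 0 to all other I.
\<close>

definition cech_cochains ::
    "('k::field_char_0 poly3 ^ 'r) set \<Rightarrow> int \<Rightarrow> nat \<Rightarrow> (3 set \<Rightarrow> 'k poly3 fract ^ 'r) set" where
  "cech_cochains M m p =
     {c. \<forall>I. if card I = p + 1 then c I \<in> sheaf_sections M m (\<Prod>i\<in>I. X i) else c I = 0}"

text \<open>The sign exponent is the position of j in the increasing enumeration of J, from 0.\<close>

definition cech_diff ::
    "(3 set \<Rightarrow> 'k::field_char_0 poly3 fract ^ 'r) \<Rightarrow> 3 set \<Rightarrow> 'k poly3 fract ^ 'r" where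
  "cech_diff c J = (\<Sum>j\<in>J. (- 1) ^ card {i\<in>J. i < j} *s c (J - {j}))"

definition cech_cocycles ::
    "('k::field_char_0 poly3 ^ 'r) set \<Rightarrow> int \<Rightarrow> nat \<Rightarrow> (3 set \<Rightarrow> 'k poly3 fract ^ 'r) set" where
  "cech_cocycles M m p = {c \<in> cech_cochains M m p. cech_diff c = (\<lambda>J. 0)}"

definition cech_coboundaries ::
    "('k::field_char_0 poly3 ^ 'r) set \<Rightarrow> int \<Rightarrow> nat \<Rightarrow> (3 set \<Rightarrow> 'k poly3 fract ^ 'r) set" where
  "cech_coboundaries M m p =
     (if p = 0 then {\<lambda>J. 0} else cech_diff ` cech_cochains M m (p - 1))"

definition cohomology_vanishes ::
    "('k::field_char_0 poly3 ^ 'r) set \<Rightarrow> int \<Rightarrow> nat \<Rightarrow> bool" where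
  "cohomology_vanishes M m p \<longleftrightarrow> cech_cocycles M m p = cech_coboundaries M m p"


section \<open>Castelnuovo-Mumford regularity\<close>

text \<open>A property of the sheaf \<open>M~\<close>, not of the module M.\<close>

definition sheaf_regular :: "int \<Rightarrow> ('k::field_char_0 poly3 ^ 'r) set \<Rightarrow> bool" where
  "sheaf_regular m M \<longleftrightarrow> (\<forall>i\<ge>1. cohomology_vanishes M (m - int i) i)"

definition sheaf_reg :: "('k::field_char_0 poly3 ^ 'r) set \<Rightarrow> int" where
  "sheaf_reg M = (LEAST m. sheaf_regular m M)"

end

theory Submission
  imports Defs "HOL-Computational_Algebra.Polynomial"
begin

text \<open>
  Let S be the set of equations of the lines and let \<open>Der(-log S)\<close> consist of the derivations tangent to
  every line, so that \<open>Der(-log S) = D\<^sub>0 \<oplus> R E\<close> with E the Euler derivation; this retraction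
  reduces vanishing for \<open>D\<^sub>0\<close> to vanishing for \<open>Der(-log S)\<close>.

  The first cohomology in degrees at least \<open>card S - 3\<close> vanishes by induction on the lines.  For S empty it is
  the exactness of a Koszul complex.  When a line b is added, a cocycle for \<open>Der(-log (S \<union> {b}))\<close> is a
  coboundary for \<open>Der(-log S)\<close>, and the obstruction is a form s on the line \<open>b = 0\<close> vanishing to order
  \<open>e - 1\<close> at every point lying on e lines of S; such an s is the restriction of \<open>b\<cdot>\<theta>\<close> for some
  \<open>\<theta>\<close> in \<open>Der(-log S)\<close> of the right degree.  The second cohomology in degrees at least \<open>card S - 4\<close>
  vanishes because adding b changes the sheaf by one supported on a line, starting from three independent lines,
  where the sheaf is \<open>O(-1)\<^sup>3\<close>.

  For the lower bounds, \<open>\<theta> \<mapsto> s\<cdot>\<theta> / s - r\<cdot>\<theta> / r\<close> maps \<open>D\<^sub>0\<close> to \<open>R(-1)\<close> and detects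
  a class in the second cohomology in all degrees at most -2.  If S is generic and \<open>0 \<le> m \<le> card S - 4\<close>,
  then \<open>x\<^sub>i\<^sup>m Q / a\<close> lies locally but not globally in the Jacobian ideal: if it were \<open>h(Q)\<close>, then
  \<open>h(p)\<close> would be proportional to p at too many points of another line.
\<close>

section \<open>Polynomials in three variables\<close>

text \<open>Cohomology is computed by polynomial identities after clearing denominators. A first
  cohomology class in degree m is a family g j k of degree e + N over (x_j x_k)^N with m = e - N; a
  second cohomology class is a \<theta> of degree n over (x_0 x_1 x_2)^N with m = n - 3N. The
  numerical hypotheses on e, n, N are bounds on m in this sense. The induction runs on Der(-log S)
  because its conditions are imposed line by line: a new line adds one condition, whereas Q changes
  as a whole. The constant in the bound for the first cohomology comes from the derivation used at a
  new point: its coefficient contains the equations of all lines but two, and this product has to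
  fit into the available degree. Regularity is refuted separately for every m below d - 2 in the
  generic case: the second cohomology disposes of m <= 0 and the first of 1 <= m <= d - 3. The case
  m <= 0 also serves the upper bound, since a least integer exists only in a set bounded
  below.\<close>

lemma UNIV_index: "(UNIV :: 3 set) = {0, 1, 2}"
proof -
  have "card {0, 1, 2 :: 3} = CARD(3)" by simp
  then show ?thesis
    by (metis card_subset_eq finite_code subset_UNIV)
qed

lemma sum_index: "(\<Sum>i\<in>(UNIV :: 3 set). f i) = f 0 + f 1 + (f 2 :: 'a::comm_monoid_add)"
  unfolding UNIV_index by (simp add: add.assoc)

lemma prod_index: "(\<Prod>i\<in>(UNIV :: 3 set). f i) = f 0 * f 1 * (f 2 :: 'a::comm_monoid_mult)"
  unfolding UNIV_index by (simp add: mult.assoc)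

lemma all_index: "(\<forall>i::3. P i) \<longleftrightarrow> P 0 \<and> P 1 \<and> P 2"
proof -
  have "(\<forall>i::3. P i) \<longleftrightarrow> (\<forall>i\<in>{0,1,2}. P i)" unfolding UNIV_index[symmetric] by simp
  then show ?thesis by simp
qed

abbreviation const :: "'k::field_char_0 \<Rightarrow> 'k poly3" where
  "const c \<equiv> Poly_Mapping.single 0 c"

definition mdeg :: "(3 \<Rightarrow>\<^sub>0 nat) \<Rightarrow> nat" where
  "mdeg \<mu> = (\<Sum>i\<in>UNIV. Poly_Mapping.lookup \<mu> i)"

lemma mdeg_add: "mdeg (\<mu> + \<nu>) = mdeg \<mu> + mdeg \<nu>"
  by (simp add: mdeg_def lookup_add sum.distrib)

lemma mdeg_zero [simp]: "mdeg 0 = 0"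
  by (simp add: mdeg_def)

lemma mdeg_single [simp]: "mdeg (Poly_Mapping.single i n) = n"
  by (simp add: mdeg_def lookup_single when_def)

lemma homogeneous_iff: "homogeneous n p \<longleftrightarrow> (\<forall>\<mu>\<in>Poly_Mapping.keys p. mdeg \<mu> = n)"
  by (simp add: homogeneous_def mdeg_def)

lemma monomial_expansion:
  "(p :: 'a \<Rightarrow>\<^sub>0 'b::comm_monoid_add) = (\<Sum>\<mu>\<in>Poly_Mapping.keys p. Poly_Mapping.single \<mu> (Poly_Mapping.lookup p \<mu>))"
proof (rule poly_mapping_eqI)
  fix \<nu>
  have "Poly_Mapping.lookup (\<Sum>\<mu>\<in>Poly_Mapping.keys p. Poly_Mapping.single \<mu> (Poly_Mapping.lookup p \<mu>)) \<nu>
      = (\<Sum>\<mu>\<in>Poly_Mapping.keys p. if \<mu> = \<nu> then Poly_Mapping.lookup p \<mu> else 0)"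
    unfolding lookup_sum by (rule sum.cong) (auto simp: lookup_single when_def)
  also have "\<dots> = Poly_Mapping.lookup p \<nu>"
    by (simp add: in_keys_iff)
  finally show "Poly_Mapping.lookup p \<nu> =
    Poly_Mapping.lookup (\<Sum>\<mu>\<in>Poly_Mapping.keys p. Poly_Mapping.single \<mu> (Poly_Mapping.lookup p \<mu>)) \<nu>" ..
qed

lemma monomial_induct [case_names monomial add]:
  fixes p :: "'a \<Rightarrow>\<^sub>0 'b::comm_monoid_add"
  assumes "\<And>\<mu> c. P (Poly_Mapping.single \<mu> c)" "\<And>p q. P p \<Longrightarrow> P q \<Longrightarrow> P (p + q)"
  shows "P p"
proof -
  have "P 0" using assms(1)[of undefined 0] by simp
  then have "P (\<Sum>\<mu>\<in>K. Poly_Mapping.single \<mu> (c \<mu>))" for K c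
    by (induction K rule: infinite_finite_induct) (auto intro: assms)
  from this[where K = "Poly_Mapping.keys p" and c = "Poly_Mapping.lookup p"] show ?thesis
    by (simp flip: monomial_expansion)
qed

text \<open>One truncation serves two purposes: homogeneous components (\<open>hpart\<close>), and
  remainders modulo \<open>X i ^ N\<close>, where U says that the exponent of variable i is below
  N.\<close>

definition mpart :: "('a \<Rightarrow> bool) \<Rightarrow> ('a \<Rightarrow>\<^sub>0 'b) \<Rightarrow> 'a \<Rightarrow>\<^sub>0 'b::comm_monoid_add" where
  "mpart U p = (\<Sum>\<mu>\<in>{\<mu>\<in>Poly_Mapping.keys p. U \<mu>}. Poly_Mapping.single \<mu> (Poly_Mapping.lookup p \<mu>))"

lemma lookup_mpart: "Poly_Mapping.lookup (mpart U p) \<nu> = (if U \<nu> then Poly_Mapping.lookup p \<nu> else 0)"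
proof -
  have "Poly_Mapping.lookup (mpart U p) \<nu>
      = (\<Sum>\<mu>\<in>{\<mu>\<in>Poly_Mapping.keys p. U \<mu>}. if \<mu> = \<nu> then Poly_Mapping.lookup p \<mu> else 0)"
    unfolding lookup_sum mpart_def by (rule sum.cong) (auto simp: lookup_single when_def)
  also have "\<dots> = (if U \<nu> then Poly_Mapping.lookup p \<nu> else 0)"
    by (simp add: in_keys_iff)
  finally show ?thesis .
qed

lemma keys_mpart: "Poly_Mapping.keys (mpart U p) = {\<mu>\<in>Poly_Mapping.keys p. U \<mu>}"
  by (auto simp: in_keys_iff lookup_mpart split: if_splits)

lemma mpart_add: "mpart U (p + q) = mpart U p + mpart U q"
  by (rule poly_mapping_eqI) (simp add: lookup_mpart lookup_add)

lemma mpart_zero [simp]: "mpart U 0 = 0"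
  by (rule poly_mapping_eqI) (simp add: lookup_mpart)

lemma mpart_sum: "mpart U (\<Sum>i\<in>I. f i) = (\<Sum>i\<in>I. mpart U (f i))"
  by (induction I rule: infinite_finite_induct) (auto simp: mpart_add)

lemma mpart_single: "mpart U (Poly_Mapping.single \<mu> c) = (if U \<mu> then Poly_Mapping.single \<mu> c else 0)"
  by (rule poly_mapping_eqI) (auto simp: lookup_mpart lookup_single when_def)

lemma mpart_minus: "mpart U (p - q) = mpart U p - mpart U (q :: 'a \<Rightarrow>\<^sub>0 'b::ab_group_add)"
  by (rule poly_mapping_eqI) (simp add: lookup_mpart lookup_minus)

abbreviation hpart :: "nat \<Rightarrow> 'k::field_char_0 poly3 \<Rightarrow> 'k poly3" where
  "hpart n \<equiv> mpart (\<lambda>\<mu>. mdeg \<mu> = n)"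

lemma homogeneous_hpart [simp]: "homogeneous n (hpart n p)"
  by (simp add: homogeneous_iff keys_mpart)

lemma hpart_homogeneous: "homogeneous n p \<Longrightarrow> hpart n p = p"
  by (rule poly_mapping_eqI) (auto simp: lookup_mpart homogeneous_iff in_keys_iff)

lemma homogeneous_iff_hpart: "homogeneous n p \<longleftrightarrow> hpart n p = p"
  by (metis homogeneous_hpart hpart_homogeneous)

text \<open>Witnesses found without control of degrees, as from Koszul exactness, can be replaced by
  their components of the right degree because of this rule.\<close>

lemma hpart_mult:
  assumes "homogeneous a p"
  shows "hpart n (p * q) = (if a \<le> n then p * hpart (n - a) q else 0)"
proof -
  have single: "hpart n (Poly_Mapping.single \<mu> c * q) =
    (if a \<le> n then Poly_Mapping.single \<mu> c * hpart (n - a) q else 0)" if "mdeg \<mu> = a" for \<mu> c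
  proof (induction q rule: monomial_induct)
    case (monomial \<nu> d)
    then show ?case using that by (auto simp: mult_single mpart_single mdeg_add)
  next
    case (add p q)
    then show ?case by (auto simp: distrib_left mpart_add)
  qed
  have "hpart n (p * q) = (\<Sum>\<mu>\<in>Poly_Mapping.keys p.
      hpart n (Poly_Mapping.single \<mu> (Poly_Mapping.lookup p \<mu>) * q))"
    by (subst monomial_expansion[of p]) (simp add: sum_distrib_right mpart_sum)
  also have "\<dots> = (\<Sum>\<mu>\<in>Poly_Mapping.keys p. (if a \<le> n then
      Poly_Mapping.single \<mu> (Poly_Mapping.lookup p \<mu>) * hpart (n - a) q else 0))"
    using assms by (intro sum.cong refl single) (simp add: homogeneous_iff)
  also have "\<dots> = (if a \<le> n then p * hpart (n - a) q else 0)"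
    by (subst (3) monomial_expansion[of p]) (simp add: sum_distrib_right)
  finally show ?thesis .
qed

lemma homogeneous_zero [simp]: "homogeneous n 0"
  by (simp add: homogeneous_iff)

lemma homogeneous_add: "homogeneous n p \<Longrightarrow> homogeneous n q \<Longrightarrow> homogeneous n (p + q)"
  by (simp add: homogeneous_iff_hpart mpart_add)

lemma homogeneous_diff: "homogeneous n p \<Longrightarrow> homogeneous n q \<Longrightarrow> homogeneous n (p - q)"
  by (simp add: homogeneous_iff_hpart mpart_minus)

lemma homogeneous_sum: "(\<And>i. i \<in> I \<Longrightarrow> homogeneous n (f i)) \<Longrightarrow> homogeneous n (\<Sum>i\<in>I. f i)"
  by (simp add: homogeneous_iff_hpart mpart_sum)

lemma homogeneous_mult: "homogeneous a p \<Longrightarrow> homogeneous b q \<Longrightarrow> homogeneous (a + b) (p * q)"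
  using hpart_mult[of a p "a + b" q] by (simp add: homogeneous_iff_hpart)

lemma homogeneous_const [simp]: "homogeneous 0 (const c)"
  by (simp add: homogeneous_iff)

lemma homogeneous_one [simp]: "homogeneous 0 1"
  by (simp add: homogeneous_iff)

lemma homogeneous_const_mult: "homogeneous n p \<Longrightarrow> homogeneous n (const c * p)"
  using homogeneous_mult[of 0 "const c" n p] by simp

lemma homogeneous_X [simp]: "homogeneous 1 (X i)" "homogeneous (Suc 0) (X i)"
  by (simp_all add: homogeneous_iff X_def)

lemma homogeneous_power: "homogeneous a p \<Longrightarrow> homogeneous (N * a) (p ^ N)"
  by (induction N) (auto intro: homogeneous_mult)

lemma homogeneous_X_power [simp]: "homogeneous N (X i ^ N)"
  using homogeneous_power[of 1 "X i" N] by simp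

lemma homogeneous_linear_form [simp]: "homogeneous 1 (linear_form a)" "homogeneous (Suc 0) (linear_form a)"
proof -
  show "homogeneous 1 (linear_form a)"
    unfolding linear_form_def by (intro homogeneous_sum homogeneous_const_mult homogeneous_X)
  then show "homogeneous (Suc 0) (linear_form a)" by simp
qed

lemma homogeneous_prod:
  "(\<And>i. i \<in> I \<Longrightarrow> homogeneous (f i) (p i)) \<Longrightarrow> homogeneous (\<Sum>i\<in>I. f i) (\<Prod>i\<in>I. p i)"
  by (induction I rule: infinite_finite_induct) (auto intro: homogeneous_mult)

lemma homogeneous_prod_linear_form [simp]: "homogeneous (card S) (\<Prod>a\<in>S. linear_form a)"
  using homogeneous_prod[of S "\<lambda>_. 1" linear_form] by simp

lemma X_power: "X i ^ N = Poly_Mapping.single (Poly_Mapping.single i N) 1"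
proof (induction N)
  case (Suc N)
  then show ?case by (simp add: X_def mult_single flip: single_add)
qed simp

lemma X_nonzero [simp]: "X i \<noteq> (0 :: 'k::field_char_0 poly3)"
  unfolding X_def by (metis lookup_single_eq lookup_zero zero_neq_one)

lemma monomial_eq_X:
  "Poly_Mapping.single \<mu> c = const c * (\<Prod>i\<in>UNIV. X i ^ Poly_Mapping.lookup \<mu> i)"
proof -
  have "(\<Prod>i\<in>UNIV. X i ^ Poly_Mapping.lookup \<mu> i)
      = Poly_Mapping.single (\<Sum>i\<in>UNIV. Poly_Mapping.single i (Poly_Mapping.lookup \<mu> i)) (1::'a)"
    by (simp add: X_power prod_index sum_index mult_single)
  also have "(\<Sum>i\<in>UNIV. Poly_Mapping.single i (Poly_Mapping.lookup \<mu> i)) = \<mu>"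
    by (rule poly_mapping_eqI) (simp add: lookup_sum lookup_single when_def)
  finally show ?thesis by (simp add: mult_single)
qed

lemma poly3_induct [case_names const X add mult]:
  fixes p :: "'k::field_char_0 poly3"
  assumes const: "\<And>c. P (const c)" and X: "\<And>i. P (X i)"
    and add: "\<And>p q. P p \<Longrightarrow> P q \<Longrightarrow> P (p + q)" and mult: "\<And>p q. P p \<Longrightarrow> P q \<Longrightarrow> P (p * q)"
  shows "P p"
proof (induction p rule: monomial_induct)
  case (monomial \<mu> c)
  have one: "P 1" using const[of 1] by simp
  have "P (X i ^ n)" for i n
    by (induction n) (auto intro: one X mult)
  then show ?case
    by (subst monomial_eq_X, unfold prod_index, intro mult const)
qed (rule add)

section \<open>Division by powers of one variable\<close>

lemma lookup_monomial_mult: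
  "Poly_Mapping.lookup (Poly_Mapping.single \<mu> c * p) (\<mu> + \<nu>) = c * Poly_Mapping.lookup (p :: 'k::field_char_0 poly3) \<nu>"
  by (induction p rule: monomial_induct)
    (auto simp: mult_single lookup_single when_def lookup_add distrib_left)

lemma lookup_monomial_mult_zero:
  assumes "\<And>\<rho>. \<nu> \<noteq> \<mu> + \<rho>"
  shows "Poly_Mapping.lookup (Poly_Mapping.single \<mu> c * p) \<nu> = (0 :: 'k::field_char_0)"
  using assms by (induction p rule: monomial_induct)
    (auto simp: mult_single lookup_single when_def lookup_add distrib_left)

lemma lookup_X_power_mult_zero:
  "Poly_Mapping.lookup \<nu> i < N \<Longrightarrow> Poly_Mapping.lookup (X i ^ N * p) \<nu> = 0"
  unfolding X_power by (rule lookup_monomial_mult_zero) (auto simp: lookup_add)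

text \<open>The remainder is a specific truncation of p, hence additive in p and compatible with
  multiplication by the other variables; the exactness arguments below rest on this.\<close>

lemma X_power_division:
  fixes p :: "'k::field_char_0 poly3"
  shows "\<exists>q. p = X i ^ N * q + mpart (\<lambda>\<mu>. Poly_Mapping.lookup \<mu> i < N) p"
proof (induction p rule: monomial_induct)
  case (monomial \<mu> c)
  show ?case
  proof (cases "Poly_Mapping.lookup \<mu> i < N")
    case True
    then show ?thesis by (intro exI[of _ 0]) (simp add: mpart_single)
  next
    case False
    have "Poly_Mapping.single i N + (\<mu> - Poly_Mapping.single i N) = \<mu>"
      using False by (intro poly_mapping_eqI) (auto simp: lookup_add lookup_minus lookup_single when_def)
    then have "Poly_Mapping.single \<mu> c = X i ^ N * Poly_Mapping.single (\<mu> - Poly_Mapping.single i N) c"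
      by (simp add: X_power mult_single)
    then show ?thesis using False by (metis (no_types, lifting) add.right_neutral mpart_single)
  qed
next
  case (add p q)
  then obtain a b where "p = X i ^ N * a + mpart (\<lambda>\<mu>. Poly_Mapping.lookup \<mu> i < N) p"
    "q = X i ^ N * b + mpart (\<lambda>\<mu>. Poly_Mapping.lookup \<mu> i < N) q" by auto
  then have "p + q = X i ^ N * (a + b) + (mpart (\<lambda>\<mu>. Poly_Mapping.lookup \<mu> i < N) p + mpart (\<lambda>\<mu>. Poly_Mapping.lookup \<mu> i < N) q)"
    by (metis (no_types, lifting) add.assoc add.left_commute distrib_left)
  then show ?case unfolding mpart_add by blast
qed

section \<open>Evaluation and restriction to lines\<close>

definition ev :: "'k::field_char_0 poly3 \<Rightarrow> 'k ^ 3 \<Rightarrow> 'k" where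
  "ev p q = (\<Sum>\<mu>\<in>Poly_Mapping.keys p. Poly_Mapping.lookup p \<mu> * (\<Prod>i\<in>UNIV. (q $ i) ^ Poly_Mapping.lookup \<mu> i))"

lemma ev_superset:
  assumes "finite K" "Poly_Mapping.keys p \<subseteq> K"
  shows "ev p q = (\<Sum>\<mu>\<in>K. Poly_Mapping.lookup p \<mu> * (\<Prod>i\<in>UNIV. (q $ i) ^ Poly_Mapping.lookup \<mu> i))"
  unfolding ev_def using assms by (intro sum.mono_neutral_left) (auto simp: in_keys_iff)

lemma ev_zero [simp]: "ev 0 q = 0"
  by (simp add: ev_def)

lemma ev_add: "ev (p + r) q = ev p q + ev r q"
  by (simp add: ev_superset[of "Poly_Mapping.keys p \<union> Poly_Mapping.keys r"] keys_add
      lookup_add distrib_right sum.distrib)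

lemma ev_single: "ev (Poly_Mapping.single \<mu> c) q = c * (\<Prod>i\<in>UNIV. (q $ i) ^ Poly_Mapping.lookup \<mu> i)"
  by (simp add: ev_superset[of "{\<mu>}"])

lemma ev_const [simp]: "ev (const c) q = c"
  by (simp add: ev_single)

lemma ev_one [simp]: "ev 1 q = 1"
  using ev_const[of 1 q] by simp

lemma ev_X [simp]: "ev (X i) q = q $ i"
proof -
  have "(\<Prod>j\<in>UNIV. (q $ j) ^ Poly_Mapping.lookup (Poly_Mapping.single i (1::nat)) j)
     = (\<Prod>j\<in>UNIV. if j = i then q $ j else 1)"
    by (rule prod.cong) (auto simp: lookup_single when_def)
  then show ?thesis by (simp add: X_def ev_single)
qed

lemma ev_mult: "ev (p * r) q = ev p q * ev r q"
proof (induction p rule: monomial_induct)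
  case (monomial \<mu> c)
  show ?case
  proof (induction r rule: monomial_induct)
    case (monomial \<nu> d)
    then show ?case by (simp add: mult_single ev_single lookup_add power_add prod.distrib)
  qed (simp add: distrib_left ev_add)
qed (simp add: distrib_right ev_add)

lemma ev_uminus: "ev (- p) q = - ev p q"
  by (metis add.right_inverse add_eq_0_iff2 ev_add ev_zero neg_eq_iff_add_eq_0)

lemma ev_diff: "ev (p - r) q = ev p q - ev r q"
  using ev_add[of p "- r" q] by (simp add: ev_uminus)

lemma ev_sum: "ev (\<Sum>i\<in>I. f i) q = (\<Sum>i\<in>I. ev (f i) q)"
  by (induction I rule: infinite_finite_induct) (simp_all add: ev_add)

lemma ev_prod: "ev (\<Prod>i\<in>I. f i) q = (\<Prod>i\<in>I. ev (f i) q)"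
  by (induction I rule: infinite_finite_induct) (simp_all add: ev_mult)

lemma ev_power: "ev (p ^ n) q = ev p q ^ n"
  by (induction n) (simp_all add: ev_mult)

lemmas ev_simps = ev_add ev_mult ev_uminus ev_diff ev_sum ev_prod ev_power

lemma ev_homogeneous:
  assumes "homogeneous n p"
  shows "ev p (c *s q) = c ^ n * ev p q"
proof -
  have "ev p (c *s q) = (\<Sum>\<mu>\<in>Poly_Mapping.keys p. c ^ mdeg \<mu> *
      (Poly_Mapping.lookup p \<mu> * (\<Prod>i\<in>UNIV. (q $ i) ^ Poly_Mapping.lookup \<mu> i)))"
    unfolding ev_def mdeg_def
    by (rule sum.cong) (simp_all add: power_mult_distrib prod.distrib power_sum)
  also have "\<dots> = c ^ n * ev p q"
    unfolding ev_def sum_distrib_left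
    by (rule sum.cong) (use assms in \<open>auto simp: homogeneous_iff\<close>)
  finally show ?thesis .
qed

lemma base_digits_unique:
  fixes a b c :: nat
  assumes "a + B * (b + B * c) = a' + B * (b' + B * c')"
    and "a < B" "a' < B" "b < B" "b' < B"
  shows "a = a' \<and> b = b' \<and> c = c'"
proof -
  have step: "x = x' \<and> y = y'" if "x + B * y = x' + B * y'" "x < B" "x' < B" for x y x' y' :: nat
  proof -
    have "(x + B * y) mod B = (x' + B * y') mod B" "(x + B * y) div B = (x' + B * y') div B"
      by (simp_all add: that(1))
    then show ?thesis using that(2,3) by (simp)
  qed
  show ?thesis using step[OF assms(1-3)] step[of b c b' c'] assms(4,5) by blast
qed

text \<open>Kronecker substitution: the curve \<open>(t, t^B, t^(B * B))\<close> with large B separates the monomials.\<close>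

lemma ev_eq_zeroD:
  fixes p :: "'k::field_char_0 poly3"
  assumes "\<And>q. ev p q = 0"
  shows "p = 0"
proof (rule poly_mapping_eqI)
  fix \<nu>
  let ?K = "Poly_Mapping.keys p"
  define B where "B = Suc (\<Sum>\<mu>\<in>?K. mdeg \<mu>)"
  define code where "code \<mu> = Poly_Mapping.lookup \<mu> 0 + B * (Poly_Mapping.lookup \<mu> 1 + B * Poly_Mapping.lookup \<mu> 2)"
    for \<mu> :: "3 \<Rightarrow>\<^sub>0 nat"
  have small: "Poly_Mapping.lookup \<mu> i < B" if "\<mu> \<in> ?K" for \<mu> i
  proof -
    have "Poly_Mapping.lookup \<mu> i \<le> mdeg \<mu>"
      unfolding mdeg_def by (rule member_le_sum) auto
    also have "\<dots> \<le> (\<Sum>\<mu>\<in>?K. mdeg \<mu>)"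
      by (rule member_le_sum) (use that in auto)
    finally show ?thesis by (simp add: B_def)
  qed
  have inj: "\<mu> = \<mu>'" if "\<mu> \<in> ?K" "\<mu>' \<in> ?K" "code \<mu> = code \<mu>'" for \<mu> \<mu>'
  proof -
    have "\<forall>i. Poly_Mapping.lookup \<mu> i = Poly_Mapping.lookup \<mu>' i"
      unfolding all_index
      using base_digits_unique[OF that(3)[unfolded code_def]] small that by blast
    then show ?thesis by (intro poly_mapping_eqI) simp
  qed
  define P where "P = (\<Sum>\<mu>\<in>?K. monom (Poly_Mapping.lookup p \<mu>) (code \<mu>))"
  have "poly P t = 0" for t
  proof -
    have "poly P t = ev p (\<chi> i. if i = 0 then t else if i = 1 then t ^ B else t ^ (B * B))"
      unfolding P_def ev_def poly_sum prod_index code_def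
      by (simp add: poly_monom power_add power_mult mult.assoc distrib_left)
    then show ?thesis using assms by simp
  qed
  then have "P = 0" by (simp add: poly_all_0_iff_0[symmetric])
  show "Poly_Mapping.lookup p \<nu> = Poly_Mapping.lookup 0 \<nu>"
  proof (cases "\<nu> \<in> ?K")
    case True
    have "coeff P (code \<nu>) = (\<Sum>\<mu>\<in>?K. if \<mu> = \<nu> then Poly_Mapping.lookup p \<mu> else 0)"
      unfolding P_def coeff_sum by (rule sum.cong) (use inj True in auto)
    then show ?thesis using True \<open>P = 0\<close> by simp
  qed (simp add: in_keys_iff)
qed

lemma ev_eqI: "(\<And>q. ev p q = ev r q) \<Longrightarrow> p = r"
  using ev_eq_zeroD[of "p - r"] by (simp add: ev_diff)

text \<open>The trace of p on the line through u and v in the affine coordinate t of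
  \<open>u + t *s v\<close>. The point v lies at infinity; hence the recurring condition that the
  lines of the arrangement avoid v, and the degree bounds on restrictions.\<close>

definition rest :: "'k::field_char_0 ^ 3 \<Rightarrow> 'k ^ 3 \<Rightarrow> 'k poly3 \<Rightarrow> 'k poly" where
  "rest u v p = (\<Sum>\<mu>\<in>Poly_Mapping.keys p.
     smult (Poly_Mapping.lookup p \<mu>) (\<Prod>i\<in>UNIV. [:u $ i, v $ i:] ^ Poly_Mapping.lookup \<mu> i))"

lemma poly_rest: "poly (rest u v p) t = ev p (u + t *s v)"
  unfolding rest_def ev_def poly_sum
  by (rule sum.cong) (simp_all add: poly_prod mult.commute)

lemma rest_add: "rest u v (p + q) = rest u v p + rest u v q"
  by (rule poly_ext) (simp add: poly_rest ev_simps)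

lemma rest_diff: "rest u v (p - q) = rest u v p - rest u v q"
  by (rule poly_ext) (simp add: poly_rest ev_simps)

lemma rest_mult: "rest u v (p * q) = rest u v p * rest u v q"
  by (rule poly_ext) (simp add: poly_rest ev_simps)

lemma rest_power: "rest u v (p ^ n) = rest u v p ^ n"
  by (rule poly_ext) (simp add: poly_rest ev_simps)

lemma rest_const: "rest u v (const c) = [:c:]"
  by (rule poly_ext) (simp add: poly_rest)

lemma rest_zero [simp]: "rest u v 0 = 0"
  by (rule poly_ext) (simp add: poly_rest)

lemma rest_X: "rest u v (X i) = [:u $ i, v $ i:]"
  by (rule poly_ext) (simp add: poly_rest)

lemma degree_rest: "homogeneous n p \<Longrightarrow> Polynomial.degree (rest u v p) \<le> n"
  unfolding rest_def
proof (rule degree_sum_le)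
  fix \<mu> assume "homogeneous n p" "\<mu> \<in> Poly_Mapping.keys p"
  have lin: "Polynomial.degree ([:a, b:] ^ k) \<le> k" for a b :: 'a and k
    using degree_power_le[of "[:a, b:]" k] by (simp split: if_splits)
  have "Polynomial.degree (smult (Poly_Mapping.lookup p \<mu>) (\<Prod>i\<in>UNIV. [:u $ i, v $ i:] ^ Poly_Mapping.lookup \<mu> i))
     \<le> Polynomial.degree (\<Prod>i\<in>UNIV. [:u $ i, v $ i:] ^ Poly_Mapping.lookup \<mu> i)"
    by (rule degree_smult_le)
  also have "\<dots> \<le> (\<Sum>i\<in>UNIV. Polynomial.degree ([:u $ i, v $ i:] ^ Poly_Mapping.lookup \<mu> i))"
    using degree_prod_sum_le[of UNIV "\<lambda>i. [:u $ i, v $ i:] ^ Poly_Mapping.lookup \<mu> i"] by (simp add: o_def)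
  also have "\<dots> \<le> mdeg \<mu>" unfolding mdeg_def by (intro sum_mono lin)
  also have "mdeg \<mu> = n" using \<open>homogeneous n p\<close> \<open>\<mu> \<in> _\<close> by (simp add: homogeneous_iff)
  finally show "Polynomial.degree (smult (Poly_Mapping.lookup p \<mu>) (\<Prod>i\<in>UNIV. [:u $ i, v $ i:] ^ Poly_Mapping.lookup \<mu> i)) \<le> n" .
qed simp

definition dot :: "'a::comm_ring_1 ^ 3 \<Rightarrow> 'a ^ 3 \<Rightarrow> 'a" where
  "dot a p = (\<Sum>i\<in>UNIV. a $ i * p $ i)"

lemma dot_expand: "dot a p = a $ 0 * p $ 0 + a $ 1 * p $ 1 + a $ 2 * p $ 2"
  by (simp add: dot_def sum_index)

lemma dot_add: "dot a (p + q) = dot a p + dot a q"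
  by (simp add: dot_expand algebra_simps)

lemma dot_diff: "dot a (p - q) = dot a p - dot a q"
  by (simp add: dot_expand algebra_simps)

lemma dot_scale: "dot a (c *s p) = c * dot a p"
  by (simp add: dot_expand algebra_simps)

lemma proj_line_iff: "p \<in> proj_line a \<longleftrightarrow> dot a p = 0"
  by (simp add: proj_line_def dot_def)

lemma ev_linear_form [simp]: "ev (linear_form a) q = dot a q"
  by (simp add: linear_form_def dot_def ev_simps)

lemma rest_linear_form: "rest u v (linear_form a) = [:dot a u, dot a v:]"
  by (rule poly_ext) (simp add: poly_rest dot_add dot_scale)

lemma linear_form_nonzero: "a \<noteq> 0 \<Longrightarrow> linear_form a \<noteq> 0"
proof
  assume "a \<noteq> 0" "linear_form a = 0"
  then obtain i where "a $ i \<noteq> 0" by (auto simp: vec_eq_iff)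
  moreover have "dot a (\<chi> j. if j = i then 1 else 0) = a $ i"
    by (simp add: dot_def if_distrib cong: if_cong)
  ultimately show False
    by (metis \<open>linear_form a = 0\<close> ev_linear_form ev_zero)
qed

lemma linear_form_eq_0_iff [simp]: "linear_form a = 0 \<longleftrightarrow> a = 0"
  using linear_form_nonzero[of a] by (auto simp: linear_form_def)

text \<open>Modulo the linear form every polynomial is congruent to one not involving a variable that
  occurs in the form.\<close>

lemma linear_form_dvdI:
  fixes a :: "'k::field_char_0 ^ 3"
  assumes "a \<noteq> 0" and vanish: "\<And>q. dot a q = 0 \<Longrightarrow> ev p q = 0"
  shows "linear_form a dvd p"
proof -
  obtain i where i: "a $ i \<noteq> 0" using \<open>a \<noteq> 0\<close> by (auto simp: vec_eq_iff)
  \<comment> \<open>Independence of the variable x_i, expressed through values.\<close>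
  let ?free = "\<lambda>r. \<forall>q q'. (\<forall>j. j \<noteq> i \<longrightarrow> q $ j = q' $ j) \<longrightarrow> ev r q = ev r q'"
  have "\<exists>g r. p = linear_form a * g + r \<and> ?free r"
  proof (induction p rule: poly3_induct)
    case (const c)
    show ?case by (rule exI[of _ 0], rule exI[of _ "const c"]) simp
  next
    case (X j)
    show ?case
    proof (cases "j = i")
      case False
      then show ?thesis by (intro exI[of _ 0] exI[of _ "X j"]) auto
    next
      case True
      \<comment> \<open>The equation a = 0 solved for x_i.\<close>
      let ?r = "X i - linear_form a * const (inverse (a $ i))"
      have "?free ?r"
      proof (intro allI impI)
        fix q q' :: "'k ^ 3" assume eq: "\<forall>j. j \<noteq> i \<longrightarrow> q $ j = q' $ j"
        have "q $ i - dot a q / a $ i = - (\<Sum>j\<in>UNIV - {i}. a $ j * q $ j) / a $ i" for q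
          using i by (simp add: dot_def sum.remove[of UNIV i] field_simps)
        moreover have "(\<Sum>j\<in>UNIV - {i}. a $ j * q $ j) = (\<Sum>j\<in>UNIV - {i}. a $ j * q' $ j)"
          using eq by (intro sum.cong) auto
        ultimately show "ev ?r q = ev ?r q'" by (simp add: ev_simps divide_inverse)
      qed
      then show ?thesis using True
        by (intro exI[of _ "const (inverse (a $ i))"] exI[of _ ?r]) simp
    qed
  next
    case (add p q)
    then obtain g r g' r' where "p = linear_form a * g + r" "?free r"
      "q = linear_form a * g' + r'" "?free r'" by blast
    then have "p + q = linear_form a * (g + g') + (r + r') \<and> ?free (r + r')"
      by (auto simp: algebra_simps ev_simps) (metis)
    then show ?case by blast
  next
    case (mult p q)
    then obtain g r g' r' where "p = linear_form a * g + r" "?free r"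
      "q = linear_form a * g' + r'" "?free r'" by blast
    then have "p * q = linear_form a * (g * q + r * g') + (r * r') \<and> ?free (r * r')"
      by (auto simp: algebra_simps ev_simps) (metis)
    then show ?case by blast
  qed
  then obtain g r where gr: "p = linear_form a * g + r" "?free r" by blast
  have "ev r q = 0" for q
  proof -
    \<comment> \<open>q is moved in direction i onto the plane of a, which does not change the value
      of r.\<close>
    define q' where "q' = (\<chi> j. if j = i then q $ i - dot a q / a $ i else q $ j)"
    have "dot a q' = (\<Sum>j\<in>UNIV - {i}. a $ j * q $ j) + a $ i * (q $ i - dot a q / a $ i)"
      unfolding dot_def q'_def by (simp add: sum.remove[of UNIV i])
    also have "\<dots> = dot a q - dot a q"
      using i by (subst (1) dot_def) (simp add: sum.remove[of UNIV i] field_simps)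
    finally have "dot a q' = 0" by simp
    then have "ev r q' = 0" using vanish[of q'] gr(1) by (simp add: ev_simps)
    moreover have "ev r q = ev r q'" using gr(2) by (auto simp: q'_def)
    ultimately show ?thesis by simp
  qed
  then have "r = 0" by (rule ev_eq_zeroD)
  then show ?thesis using gr by simp
qed

lemma homogeneous_factor:
  assumes "homogeneous a p" "homogeneous n f" "f = p * g" "p \<noteq> 0"
  shows "homogeneous (n - a) g" and "g \<noteq> 0 \<Longrightarrow> a \<le> n"
proof -
  have f: "f = (if a \<le> n then p * hpart (n - a) g else 0)"
    using hpart_mult[OF assms(1), of n g] assms(2,3) by (simp add: hpart_homogeneous)
  show "homogeneous (n - a) g"
  proof (cases "g = 0")
    case False
    then have "f \<noteq> 0" using assms by simp
    then have "p * g = p * hpart (n - a) g" using f assms(3) by (auto split: if_splits)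
    then have "hpart (n - a) g = g" using assms(4) by simp
    then show ?thesis by (simp add: homogeneous_iff_hpart)
  qed simp
  show "a \<le> n" if "g \<noteq> 0"
  proof (rule ccontr)
    assume "\<not> a \<le> n"
    then have "p * g = 0" using f assms(3) by simp
    then show False using that assms(4) by simp
  qed
qed

text \<open>A monomial with all three exponents below N has degree at most 3N - 3 < n, so every
  monomial of p is divisible by some \<open>X i ^ N\<close>. This is the vanishing of the second
  cohomology of O(m) for m = n - 3N >= -2.\<close>

lemma X_power_sum_of_degree:
  assumes "homogeneous n p" "3 * N \<le> n + 2"
  shows "\<exists>g. p = (\<Sum>i\<in>UNIV. X i ^ N * g i)"
proof -
  define r0 where "r0 = mpart (\<lambda>\<mu>. Poly_Mapping.lookup \<mu> 0 < N) p"
  define r1 where "r1 = mpart (\<lambda>\<mu>. Poly_Mapping.lookup \<mu> 1 < N) r0"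
  define r2 where "r2 = mpart (\<lambda>\<mu>. Poly_Mapping.lookup \<mu> 2 < N) r1"
  obtain q0 q1 q2 where q: "p = X 0 ^ N * q0 + r0" "r0 = X 1 ^ N * q1 + r1" "r1 = X 2 ^ N * q2 + r2"
    using X_power_division[of p 0 N] X_power_division[of r0 1 N] X_power_division[of r1 2 N]
    unfolding r0_def[symmetric] r1_def[symmetric] r2_def[symmetric] by blast
  have "Poly_Mapping.keys r2 = {}"
  proof (rule ccontr)
    assume "Poly_Mapping.keys r2 \<noteq> {}"
    then obtain \<mu> where "\<mu> \<in> Poly_Mapping.keys r2" by blast
    then have "\<mu> \<in> Poly_Mapping.keys p" "Poly_Mapping.lookup \<mu> 0 < N" "Poly_Mapping.lookup \<mu> 1 < N"
      "Poly_Mapping.lookup \<mu> 2 < N" unfolding r0_def r1_def r2_def by (auto simp: keys_mpart)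
    moreover have "mdeg \<mu> = n" using assms(1) calculation by (simp add: homogeneous_iff)
    ultimately show False using assms(2) by (simp add: mdeg_def sum_index)
  qed
  then have "r2 = 0" by simp
  define g where "g i = (if i = 0 then q0 else if i = 1 then q1 else q2)" for i :: 3
  have "p = (\<Sum>i\<in>UNIV. X i ^ N * g i)"
    using q \<open>r2 = 0\<close> by (simp add: sum_index g_def)
  then show ?thesis by blast
qed

text \<open>The two sides have no monomial in common: one has exponents at least N at i, the other
  exponents below N.\<close>

lemma X_power_eq_rest_zero:
  fixes p q :: "'k::field_char_0 poly3"
  assumes "X i ^ N * p = mpart (\<lambda>\<mu>. Poly_Mapping.lookup \<mu> i < N) q"
  shows "X i ^ N * p = 0"
proof (rule poly_mapping_eqI)
  fix \<nu>
  show "Poly_Mapping.lookup (X i ^ N * p) \<nu> = Poly_Mapping.lookup 0 \<nu>"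
  proof (cases "Poly_Mapping.lookup \<nu> i < N")
    case True
    then show ?thesis by (simp add: lookup_X_power_mult_zero)
  next
    case False
    then show ?thesis unfolding assms by (simp add: lookup_mpart)
  qed
qed

lemma mpart_X_power_mult:
  fixes p :: "'k::field_char_0 poly3"
  assumes "j \<noteq> i"
  shows "mpart (\<lambda>\<mu>. Poly_Mapping.lookup \<mu> i < N) (X j ^ M * p) = X j ^ M * mpart (\<lambda>\<mu>. Poly_Mapping.lookup \<mu> i < N) p"
proof (induction p rule: monomial_induct)
  case (monomial \<mu> c)
  then show ?case using assms by (simp add: X_power mult_single mpart_single lookup_add lookup_single when_def)
qed (simp add: distrib_left mpart_add)

text \<open>The remainder of p modulo \<open>X j ^ N\<close>, multiplied by \<open>X i ^ N\<close>,
  is both truncated at j and a multiple of \<open>X j ^ N\<close>, hence zero.\<close>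

lemma X_power_coprime:
  fixes p q :: "'k::field_char_0 poly3"
  assumes "i \<noteq> j" "X i ^ N * p = X j ^ N * q"
  obtains r where "p = X j ^ N * r" "q = X i ^ N * r"
proof -
  let ?m = "mpart (\<lambda>\<mu>. Poly_Mapping.lookup \<mu> j < N)"
  obtain r where r: "p = X j ^ N * r + ?m p" using X_power_division by blast
  have "X j ^ N * (q - X i ^ N * r) = X i ^ N * (p - X j ^ N * r)"
    using assms(2) by (simp add: algebra_simps)
  also have "p - X j ^ N * r = ?m p" using r by (metis add_diff_cancel_left')
  finally have eq: "X j ^ N * (q - X i ^ N * r) = ?m (X i ^ N * p)"
    using assms(1) by (simp add: mpart_X_power_mult)
  have "X j ^ N * (q - X i ^ N * r) = 0" by (rule X_power_eq_rest_zero[OF eq])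
  then have q: "q = X i ^ N * r" by simp
  moreover have "X i ^ N * ?m p = 0"
    using eq q assms(1) by (simp add: mpart_X_power_mult)
  then have "?m p = 0" by simp
  ultimately show ?thesis using that r by (metis add.right_neutral)
qed

lemma mpart_uminus: "mpart U (- p) = - mpart U (p :: 'a \<Rightarrow>\<^sub>0 'b::ab_group_add)"
  by (rule poly_mapping_eqI) (simp add: lookup_mpart)

text \<open>The Koszul complex of the regular sequence of N-th powers of the variables is exact in the
  middle.\<close>

lemma koszul:
  fixes a b c :: "'k::field_char_0 poly3"
  assumes "X 0 ^ N * a + X 1 ^ N * b + X 2 ^ N * c = 0"
  obtains f0 f1 f2 where "a = X 1 ^ N * f2 - X 2 ^ N * f1" "b = X 2 ^ N * f0 - X 0 ^ N * f2"
    "c = X 0 ^ N * f1 - X 1 ^ N * f0"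
proof -
  let ?m = "mpart (\<lambda>\<mu>. Poly_Mapping.lookup \<mu> 0 < N)"
  have ne: "(1::3) \<noteq> 0" "(2::3) \<noteq> 0" "(1::3) \<noteq> 2" by simp_all
  obtain B where B: "b = X 0 ^ N * B + ?m b" using X_power_division by blast
  obtain C where C: "c = X 0 ^ N * C + ?m c" using X_power_division by blast
  \<comment> \<open>The left side is a multiple of \<open>X 0 ^ N\<close> and the right side is
    truncated at 0, so both vanish. This leaves a relation between two powers only.\<close>
  have "X 0 ^ N * (a + X 1 ^ N * B + X 2 ^ N * C) = - (X 1 ^ N * ?m b + X 2 ^ N * ?m c)"
  proof -
    have "X 0 ^ N * (a + X 1 ^ N * B + X 2 ^ N * C) =
      X 0 ^ N * a + X 1 ^ N * (X 0 ^ N * B + ?m b) + X 2 ^ N * (X 0 ^ N * C + ?m c) - (X 1 ^ N * ?m b + X 2 ^ N * ?m c)"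
      by (simp add: algebra_simps)
    then show ?thesis using assms B C by simp
  qed
  also have "\<dots> = ?m (- (X 1 ^ N * b + X 2 ^ N * c))"
    using ne by (simp add: mpart_uminus mpart_minus mpart_X_power_mult)
  finally have eq: "X 0 ^ N * (a + X 1 ^ N * B + X 2 ^ N * C) = ?m (- (X 1 ^ N * b + X 2 ^ N * c))" .
  have z: "X 0 ^ N * (a + X 1 ^ N * B + X 2 ^ N * C) = 0"
    by (rule X_power_eq_rest_zero[OF eq])
  then have "a + X 1 ^ N * B + X 2 ^ N * C = 0" by simp
  then have a: "a = X 1 ^ N * (- B) - X 2 ^ N * C"
  proof -
    have "a = (a + X 1 ^ N * B + X 2 ^ N * C) - X 1 ^ N * B - X 2 ^ N * C" by simp
    also have "\<dots> = 0 - X 1 ^ N * B - X 2 ^ N * C" by (simp only: \<open>a + X 1 ^ N * B + X 2 ^ N * C = 0\<close>)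
    finally show ?thesis by simp
  qed
  have "X 1 ^ N * ?m b + X 2 ^ N * ?m c = 0"
    using z \<open>X 0 ^ N * (a + X 1 ^ N * B + X 2 ^ N * C) = - (X 1 ^ N * ?m b + X 2 ^ N * ?m c)\<close>
    by (metis neg_equal_0_iff_equal)
  then have "X 1 ^ N * ?m b = X 2 ^ N * (- ?m c)"
    by (simp add: add_eq_0_iff2)
  then obtain r where r: "?m b = X 2 ^ N * r" "- ?m c = X 1 ^ N * r"
    using X_power_coprime ne by blast
  show ?thesis
  proof (rule that)
    show "a = X 1 ^ N * (- B) - X 2 ^ N * C" by (rule a)
    show "b = X 2 ^ N * r - X 0 ^ N * (- B)"
      using B unfolding r(1) by (metis add.commute diff_minus_eq_add mult_minus_right)
    show "c = X 0 ^ N * C - X 1 ^ N * r"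
      using C r(2) by (metis add_uminus_conv_diff minus_minus)
  qed
qed

section \<open>Logarithmic derivations\<close>

text \<open>The cross product: the meeting point of two lines, or the line joining two points;
  together with \<open>dot\<close> it gives the determinant. Commutative rings are allowed so that
  it applies to polynomial vectors too.\<close>

definition cr :: "'a::comm_ring_1 ^ 3 \<Rightarrow> 'a ^ 3 \<Rightarrow> 'a ^ 3" where
  "cr p q = (\<chi> i. if i = 0 then p $ 1 * q $ 2 - p $ 2 * q $ 1
     else if i = 1 then p $ 2 * q $ 0 - p $ 0 * q $ 2 else p $ 0 * q $ 1 - p $ 1 * q $ 0)"

lemma cr_nth [simp]:
  "cr p q $ 0 = p $ 1 * q $ 2 - p $ 2 * q $ 1"
  "cr p q $ 1 = p $ 2 * q $ 0 - p $ 0 * q $ 2"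
  "cr p q $ 2 = p $ 0 * q $ 1 - p $ 1 * q $ 0"
  by (simp_all add: cr_def)

lemma vec3_eq_iff: "p = (q :: 'a ^ 3) \<longleftrightarrow> p $ 0 = q $ 0 \<and> p $ 1 = q $ 1 \<and> p $ 2 = q $ 2"
  by (simp add: vec_eq_iff all_index)

lemma dot_cr_self [simp]: "dot (cr p q) p = 0" "dot (cr p q) q = 0" "dot p (cr p q) = 0" "dot q (cr p q) = 0"
  by (simp_all add: dot_expand algebra_simps)

lemma dot_zero [simp]: "dot 0 q = 0" "dot q 0 = 0"
  by (simp_all add: dot_expand)

lemma cr_skew: "cr p q = - cr q p"
  by (simp add: vec3_eq_iff algebra_simps)

lemma cr_self [simp]: "cr p p = 0"
  by (simp add: vec3_eq_iff)

lemma cr_zero [simp]: "cr 0 p = 0" "cr p 0 = 0"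
  by (simp_all add: vec3_eq_iff)

lemma cr_cr: "cr a (cr p q) = dot a q *s p - dot a p *s q"
  by (simp add: vec3_eq_iff dot_expand algebra_simps)

lemma cr_move: "cr (p + c *s q) q = cr p q" "cr p (q + c *s p) = cr p q"
  by (simp_all add: vec3_eq_iff algebra_simps)

lemma dot_cr_cr: "dot (cr p q) (cr a c) = dot a p * dot c q - dot c p * dot a q"
  by (simp add: dot_expand algebra_simps)

lemma cramer: "dot (cr p q) r *s x = dot (cr x q) r *s p + dot (cr p x) r *s q + dot (cr p q) x *s r"
  by (simp add: vec3_eq_iff dot_expand) (simp add: algebra_simps)

lemma cr_eq_zeroD: "cr a w = 0 \<Longrightarrow> a $ i * w $ j = a $ j * w $ i"
proof -
  assume "cr a w = 0"
  then have "\<forall>i j. a $ i * w $ j = a $ j * w $ i"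
    by (simp add: all_index vec3_eq_iff)
  then show ?thesis by blast
qed

text \<open>The cross product of q and x is proportional to a, and p is orthogonal to a.\<close>

lemma coplanar_det_zero:
  fixes a :: "'a::field ^ 3"
  assumes "a \<noteq> 0" "dot a p = 0" "dot a q = 0" "dot a x = 0"
  shows "dot p (cr q x) = 0"
proof -
  obtain i where i: "a $ i \<noteq> 0" using \<open>a \<noteq> 0\<close> by (auto simp: vec_eq_iff)
  have "cr a (cr q x) = 0" using assms by (simp add: cr_cr)
  then have "a $ i * cr q x $ j = a $ j * cr q x $ i" for j by (rule cr_eq_zeroD)
  then have "a $ i * dot p (cr q x) = dot a p * cr q x $ i"
    unfolding dot_def sum_distrib_left sum_distrib_right
  proof (intro sum.cong refl)
    fix j
    have "a $ i * (p $ j * cr q x $ j) = p $ j * (a $ i * cr q x $ j)" by (rule mult.left_commute)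
    also have "\<dots> = p $ j * (a $ j * cr q x $ i)" by (simp only: \<open>a $ i * cr q x $ j = a $ j * cr q x $ i\<close>)
    also have "\<dots> = a $ j * p $ j * cr q x $ i" by (simp only: mult.assoc mult.left_commute)
    finally show "a $ i * (p $ j * cr q x $ j) = a $ j * p $ j * cr q x $ i" .
  qed
  then show ?thesis using assms i by simp
qed

lemma normal_vector:
  fixes b :: "'a::field ^ 3"
  assumes "b \<noteq> 0"
  obtains w where "dot b w = 1"
proof -
  obtain i where i: "b $ i \<noteq> 0" using \<open>b \<noteq> 0\<close> by (auto simp: vec_eq_iff)
  have "dot b (\<chi> j. if j = i then inverse (b $ i) else 0) = (\<Sum>j\<in>UNIV. if j = i then 1 else 0)"
    unfolding dot_def by (intro sum.cong) (use i in auto)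
  then show ?thesis using that by simp
qed

lemma plane_span:
  fixes b :: "'a::field ^ 3"
  assumes "b \<noteq> 0" "cr u v = b" "dot b q = 0"
  obtains \<alpha> \<beta> where "q = \<alpha> *s u + \<beta> *s v"
proof -
  obtain w where "dot b w = 1" using normal_vector \<open>b \<noteq> 0\<close> by blast
  then have "q = dot (cr q v) w *s u + dot (cr u q) w *s v"
    using cramer[of u v w q] assms by simp
  then show ?thesis using that by blast
qed

text \<open>Adding a multiple of u to v keeps the cross product, so v can be moved off finitely many
  lines while the basis stays normalized to have cross product exactly b.\<close>

lemma plane_basis:
  fixes b :: "'k::field_char_0 ^ 3"
  assumes "b \<noteq> 0" "finite S" "\<And>a. a \<in> S \<Longrightarrow> cr a b \<noteq> 0"
  obtains u v where "cr u v = b" "\<And>a. a \<in> S \<Longrightarrow> dot a v \<noteq> 0"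
proof -
  define w where "w x y z = (\<chi> i::3. if i = 0 then x else if i = 1 then y else z)" for x y z :: 'k
  have "b $ 0 \<noteq> 0 \<or> b $ 1 \<noteq> 0 \<or> b $ 2 \<noteq> 0" using assms(1) by (auto simp: vec3_eq_iff)
  then obtain u v0 where uv: "cr u v0 = b"
  proof (elim disjE)
    assume "b $ 0 \<noteq> 0"
    then have "cr (w (- b $ 1 / b $ 0) 1 0) (w (- b $ 2) 0 (b $ 0)) = b"
      by (simp add: vec3_eq_iff w_def)
    then show ?thesis using that by blast
  next
    assume "b $ 1 \<noteq> 0"
    then have "cr (w 0 (- b $ 2 / b $ 1) 1) (w (b $ 1) (- b $ 0) 0) = b"
      by (simp add: vec3_eq_iff w_def)
    then show ?thesis using that by blast
  next
    assume "b $ 2 \<noteq> 0"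
    then have "cr (w 1 0 (- b $ 0 / b $ 2)) (w 0 (b $ 2) (- b $ 1)) = b"
      by (simp add: vec3_eq_iff w_def)
    then show ?thesis using that by blast
  qed
  \<comment> \<open>Each member of S excludes at most one multiple c of u.\<close>
  have "finite ((\<lambda>a. - dot a v0 / dot a u) ` S)" using assms(2) by simp
  then obtain c where c: "c \<notin> (\<lambda>a. - dot a v0 / dot a u) ` S"
    using ex_new_if_finite[OF infinite_UNIV_char_0] by blast
  have "dot a (v0 + c *s u) \<noteq> 0" if "a \<in> S" for a
  proof
    assume z: "dot a (v0 + c *s u) = 0"
    show False
    proof (cases "dot a u = 0")
      \<comment> \<open>Here a would vanish at both u and v0, that is on the whole line b, and be
        proportional to b.\<close>
      case True
      then have "cr a b = 0" using z unfolding uv[symmetric] cr_cr by (simp add: dot_add dot_scale)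
      then show False using assms(3)[OF that] by simp
    next
      case False
      then have "c = - dot a v0 / dot a u"
        using z by (simp add: dot_add dot_scale field_simps add_eq_0_iff)
      then show False using c that by blast
    qed
  qed
  then show ?thesis using that[of u "v0 + c *s u"] uv by (simp add: cr_move)
qed

lemma point_on_line_nonzero:
  assumes "cr u v = b" "b \<noteq> 0"
  shows "u + t *s v \<noteq> 0"
proof
  assume "u + t *s v = 0"
  then have "cr (u + t *s v) v = 0" by simp
  then show False using assms by (simp add: cr_move)
qed

text \<open>By homogeneity, vanishing along the affine line gives vanishing at every point of the
  plane with nonzero u-coordinate; the multiples of v need a further argument.\<close>

lemma vanish_on_plane:
  assumes "homogeneous n p" "b \<noteq> 0" "cr u v = b" "rest u v p = 0" "dot b q = 0"
  shows "ev p q = 0"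
proof -
  have affine: "ev p (u + t *s v) = 0" for t
    using assms(4) poly_rest[of u v p t] by simp
  obtain \<alpha> \<beta> where q: "q = \<alpha> *s u + \<beta> *s v" using plane_span assms by blast
  have nz: "ev p (x *s u + \<beta> *s v) = 0" if "x \<noteq> 0" for x
  proof -
    have "x *s u + \<beta> *s v = x *s (u + (\<beta> / x) *s v)"
      using that by (simp add: vec3_eq_iff algebra_simps)
    then show ?thesis by (simp add: ev_homogeneous[OF assms(1)] affine)
  qed
  \<comment> \<open>The factor x covers x = 0, where nothing is known yet; cancelling it yields the
    value at \<beta> v.\<close>
  have "poly ([:0, 1:] * rest (\<beta> *s v) u p) x = 0" for x
    using nz[of x] by (cases "x = 0") (simp_all add: poly_rest add.commute)
  then have "[:0, 1:] * rest (\<beta> *s v) u p = 0" by (metis poly_all_0_iff_0)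
  then have "rest (\<beta> *s v) u p = 0" by (metis mult_eq_0_iff one_neq_zero pCons_eq_0_iff)
  then have "ev p (\<beta> *s v + \<alpha> *s u) = 0" by (metis poly_0 poly_rest)
  then show ?thesis by (simp add: q add.commute)
qed

text \<open>The ideal of a plane is prime. It suffices to restrict to the line through q1 and q2,
  where the polynomial ring in one variable has no zero divisors.\<close>

lemma vanish_on_plane_prime:
  fixes a :: "'k::field_char_0 ^ 3"
  assumes "\<And>q. dot a q = 0 \<Longrightarrow> ev (p * r) q = 0" "dot a q1 = 0" "ev p q1 \<noteq> 0" "dot a q2 = 0"
  shows "ev r q2 = 0"
proof (rule ccontr)
  assume "ev r q2 \<noteq> 0"
  let ?v = "q2 - q1"
  have "rest q1 ?v (p * r) = 0"
    by (rule poly_ext) (use assms in \<open>simp add: poly_rest dot_add dot_scale dot_diff\<close>)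
  then have "rest q1 ?v p = 0 \<or> rest q1 ?v r = 0" by (simp add: rest_mult)
  moreover have "poly (rest q1 ?v p) 0 \<noteq> 0" "poly (rest q1 ?v r) 1 \<noteq> 0"
    using assms(3) \<open>ev r q2 \<noteq> 0\<close> by (simp_all add: poly_rest)
  ultimately show False by auto
qed

text \<open>Independence is only pairwise: S holds one equation for each of several distinct lines,
  and three of them may well be dependent.\<close>

definition independent_lines :: "('k::field_char_0 ^ 3) set \<Rightarrow> bool" where
  "independent_lines S \<longleftrightarrow> 0 \<notin> S \<and> (\<forall>a\<in>S. \<forall>c\<in>S. a \<noteq> c \<longrightarrow> cr a c \<noteq> 0)"

lemma independent_lines_subset: "independent_lines S \<Longrightarrow> T \<subseteq> S \<Longrightarrow> independent_lines T"
  by (auto simp: independent_lines_def)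

lemma plane_avoiding_point:
  assumes "independent_lines (insert c T)" "finite T" "c \<notin> T"
  obtains q where "dot c q = 0" "\<And>a. a \<in> T \<Longrightarrow> dot a q \<noteq> 0"
proof -
  have "c \<noteq> 0" "\<And>a. a \<in> T \<Longrightarrow> cr a c \<noteq> 0" using assms by (auto simp: independent_lines_def)
  from plane_basis[OF this(1) assms(2) this(2)] show ?thesis using that dot_cr_self(2) by metis
qed

text \<open>After division by the other forms, the product of these is cancelled on the line c by
  primeness, using a point of c that lies on none of the other lines.\<close>

lemma prod_linear_form_dvdI:
  assumes "finite T" "independent_lines T" "\<And>a q. a \<in> T \<Longrightarrow> dot a q = 0 \<Longrightarrow> ev p q = 0"
  shows "(\<Prod>a\<in>T. linear_form a) dvd p"
  using assms
proof (induction T rule: finite_induct)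
  case (insert c T)
  then have "(\<Prod>a\<in>T. linear_form a) dvd p"
    by (meson independent_lines_subset insertCI subset_insertI)
  then obtain g where g: "p = (\<Prod>a\<in>T. linear_form a) * g" by blast
  obtain q1 where q1: "dot c q1 = 0" "\<And>a. a \<in> T \<Longrightarrow> dot a q1 \<noteq> 0"
    using plane_avoiding_point insert by metis
  have "ev (\<Prod>a\<in>T. linear_form a) q1 \<noteq> 0"
    using q1(2) insert.hyps(1) by (simp add: ev_prod)
  then have "ev g q = 0" if "dot c q = 0" for q
    using vanish_on_plane_prime[of c "\<Prod>a\<in>T. linear_form a" g q1 q] insert.prems(2) q1(1) that
    unfolding g[symmetric] by blast
  moreover have "c \<noteq> 0" using insert.prems(1) by (auto simp: independent_lines_def)
  ultimately have "linear_form c dvd g" by (blast intro: linear_form_dvdI)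
  then show ?case using insert.hyps g by (simp add: mult.commute mult_dvd_mono)
qed simp

section \<open>Derivations tangent to every line\<close>

definition cvec :: "'k::field_char_0 ^ 3 \<Rightarrow> 'k poly3 ^ 3" where
  "cvec a = (\<chi> i. const (a $ i))"

definition Xvec :: "'k::field_char_0 poly3 ^ 3" where
  "Xvec = (\<chi> i. X i)"

definition evv :: "'k::field_char_0 poly3 ^ 3 \<Rightarrow> 'k ^ 3 \<Rightarrow> 'k ^ 3" where
  "evv \<theta> q = (\<chi> i. ev (\<theta> $ i) q)"

lemma evv_simps [simp]: "evv (cvec a) q = a" "evv Xvec q = q"
  by (simp_all add: evv_def cvec_def Xvec_def vec_eq_iff)

lemma evv_add: "evv (\<theta> + \<eta>) q = evv \<theta> q + evv \<eta> q"
  and evv_diff: "evv (\<theta> - \<eta>) q = evv \<theta> q - evv \<eta> q"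
  and evv_scale: "evv (p *s \<theta>) q = ev p q *s evv \<theta> q"
  by (simp_all add: evv_def vec_eq_iff ev_simps)

lemma evv_zero [simp]: "evv 0 q = 0"
  by (simp add: evv_def vec_eq_iff)

lemma ev_dot: "ev (dot \<theta> \<eta>) q = dot (evv \<theta> q) (evv \<eta> q)"
  by (simp add: dot_def evv_def ev_simps)

lemma evv_cr: "evv (cr \<theta> \<eta>) q = cr (evv \<theta> q) (evv \<eta> q)"
  by (simp add: vec3_eq_iff evv_def ev_simps)

lemma linear_form_eq_dot: "linear_form a = dot (cvec a) Xvec"
  by (simp add: linear_form_def dot_def cvec_def Xvec_def)

text \<open>Tangency is tested at k-points. As k is infinite, for nonzero a this means that
  \<open>linear_form a\<close> divides \<open>dot (cvec a) \<theta>\<close>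
  (\<open>log_der_dvd\<close>).\<close>

definition log_der :: "('k::field_char_0 ^ 3) set \<Rightarrow> ('k poly3 ^ 3) set" where
  "log_der S = {\<theta>. \<forall>a\<in>S. \<forall>q. dot a q = 0 \<longrightarrow> dot a (evv \<theta> q) = 0}"

lemma log_der_add: "\<theta> \<in> log_der S \<Longrightarrow> \<eta> \<in> log_der S \<Longrightarrow> \<theta> + \<eta> \<in> log_der S"
  by (simp add: log_der_def evv_add dot_add)

lemma log_der_diff: "\<theta> \<in> log_der S \<Longrightarrow> \<eta> \<in> log_der S \<Longrightarrow> \<theta> - \<eta> \<in> log_der S"
  by (simp add: log_der_def evv_diff dot_diff)

lemma log_der_scale: "\<theta> \<in> log_der S \<Longrightarrow> p *s \<theta> \<in> log_der S"
  by (simp add: log_der_def evv_scale dot_scale)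

lemma log_der_zero [simp]: "0 \<in> log_der S"
  by (simp add: log_der_def)

lemma log_der_empty [simp]: "log_der {} = UNIV"
  by (simp add: log_der_def)

lemma log_der_insert:
  "\<theta> \<in> log_der (insert b S) \<longleftrightarrow> \<theta> \<in> log_der S \<and> (\<forall>q. dot b q = 0 \<longrightarrow> dot b (evv \<theta> q) = 0)"
  by (auto simp: log_der_def)

lemma log_der_linear_form_scale:
  "\<theta> \<in> log_der S \<Longrightarrow> linear_form b *s \<theta> \<in> log_der (insert b S)"
  by (auto simp: log_der_def evv_scale dot_scale)

definition homv :: "nat \<Rightarrow> 'k::field_char_0 poly3 ^ 3 \<Rightarrow> bool" where
  "homv n \<theta> \<longleftrightarrow> (\<forall>i. homogeneous n (\<theta> $ i))"

lemma homv_zero [simp]: "homv n 0"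
  by (simp add: homv_def)

lemma homv_add: "homv n \<theta> \<Longrightarrow> homv n \<eta> \<Longrightarrow> homv n (\<theta> + \<eta>)"
  by (simp add: homv_def homogeneous_add)

lemma homv_diff: "homv n \<theta> \<Longrightarrow> homv n \<eta> \<Longrightarrow> homv n (\<theta> - \<eta>)"
  by (simp add: homv_def homogeneous_diff)

lemma homv_scale: "homogeneous k p \<Longrightarrow> homv n \<theta> \<Longrightarrow> homv (k + n) (p *s \<theta>)"
  by (simp add: homv_def homogeneous_mult)

lemma homv_const_scale: "homv n \<theta> \<Longrightarrow> homv n (const c *s \<theta>)"
  by (simp add: homv_def homogeneous_const_mult)

lemma homv_cvec [simp]: "homv 0 (cvec w)"
  by (simp add: homv_def cvec_def)

lemma homogeneous_dot_cvec: "homv n \<theta> \<Longrightarrow> homogeneous n (dot (cvec a) \<theta>)"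
  unfolding dot_def by (intro homogeneous_sum) (simp add: homv_def cvec_def homogeneous_const_mult)

lemma linear_factor_power_dvd_mult_iff:
  fixes t :: "'a::field"
  assumes "poly p t \<noteq> 0"
  shows "[:- t, 1:] ^ n dvd p * s \<longleftrightarrow> [:- t, 1:] ^ n dvd s"
proof (intro iffI)
  assume d: "[:- t, 1:] ^ n dvd p * s"
  show "[:- t, 1:] ^ n dvd s"
  proof (cases "s = 0")
    case False
    have "p \<noteq> 0" using assms by auto
    then have "order t (p * s) = order t p + order t s"
      by (intro order_mult) (use False in simp)
    moreover have "order t p = 0" using assms by (rule order_0I)
    ultimately show ?thesis using d False \<open>p \<noteq> 0\<close> by (simp add: order_divides)
  qed simp
qed (rule dvd_mult)

lemma rest_prod_linear_form:
  assumes "finite T" "\<And>a. a \<in> T \<Longrightarrow> dot a (u + t *s v) = 0"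
  shows "rest u v (\<Prod>a\<in>T. linear_form a) = smult (\<Prod>a\<in>T. dot a v) ([:- t, 1:] ^ card T)"
  using assms
proof (induction T rule: finite_induct)
  case empty
  show ?case using rest_const[of u v 1] by simp
next
  case (insert a T)
  have "dot a u = - (t * dot a v)"
    using insert.prems[of a] by (simp add: dot_add dot_scale add_eq_0_iff2)
  then have "rest u v (linear_form a) = smult (dot a v) [:- t, 1:]"
    by (simp add: rest_linear_form mult.commute)
  then show ?case
    using insert by (simp add: rest_mult mult.commute del: mult_pCons_left mult_pCons_right smult_pCons)
qed

text \<open>Lines of the arrangement through the point \<open>p = u + t v\<close> all divide \<open>det(p, x, \<theta>(x))\<close>, and on the
  line \<open>u + t' v\<close> this determinant is \<open>(t' - t) b\<cdot>\<theta>\<close>.\<close>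

lemma log_der_rest_dvd:
  assumes "finite S" "independent_lines S" "\<And>a. a \<in> S \<Longrightarrow> dot a v \<noteq> 0" "\<theta> \<in> log_der S"
  shows "[:- t, 1:] ^ (card {a \<in> S. dot a (u + t *s v) = 0} - 1) dvd rest u v (dot (cvec (cr u v)) \<theta>)"
proof -
  define p where "p = u + t *s v"
  define T where "T = {a \<in> S. dot a p = 0}"
  define G where "G = dot (cvec p) (cr Xvec \<theta>)"
  have T: "finite T" "independent_lines T" "T \<subseteq> S"
    using assms independent_lines_subset[of S T] by (auto simp: T_def)
  have "(\<Prod>a\<in>T. linear_form a) dvd G"
  proof (rule prod_linear_form_dvdI[OF T(1,2)])
    fix a q assume a: "a \<in> T" "dot a q = 0"
    \<comment> \<open>All of p, q and \<theta>(q) lie in the plane of a.\<close>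
    then have "dot p (cr q (evv \<theta> q)) = 0"
      using assms(2,4) by (intro coplanar_det_zero[of a]) (auto simp: T_def log_der_def independent_lines_def)
    then show "ev G q = 0" by (simp add: G_def ev_dot evv_cr)
  qed
  then have "rest u v (\<Prod>a\<in>T. linear_form a) dvd rest u v G"
    by (metis dvd_def rest_mult)
  moreover have "(\<Prod>a\<in>T. dot a v) \<noteq> 0" using T assms(3) by auto
  ultimately have d: "[:- t, 1:] ^ card T dvd rest u v G"
    using rest_prod_linear_form[OF T(1), of u t v] by (simp add: T_def p_def smult_dvd_iff)
  have "rest u v G = [:- t, 1:] * rest u v (dot (cvec (cr u v)) \<theta>)"
  proof (rule poly_ext)
    fix t'
    have "dot p (cr (u + t' *s v) x) = (t' - t) * dot (cr u v) x" for x
      by (simp add: p_def dot_expand algebra_simps)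
    then show "poly (rest u v G) t' = poly ([:- t, 1:] * rest u v (dot (cvec (cr u v)) \<theta>)) t'"
      by (simp add: poly_rest G_def ev_dot evv_cr algebra_simps)
  qed
  then have d: "[:- t, 1:] ^ card T dvd [:- t, 1:] * rest u v (dot (cvec (cr u v)) \<theta>)" using d by simp
  have "[:- t, 1:] ^ (card T - 1) dvd rest u v (dot (cvec (cr u v)) \<theta>)"
  proof (cases "card T")
    case (Suc n)
    then show ?thesis using d by (simp del: mult_pCons_left)
  qed simp
  then show ?thesis by (simp add: T_def p_def)
qed

section \<open>Cocycles of logarithmic derivations\<close>

text \<open>Dual forms to u and v: along \<open>u + t *s v\<close> they restrict to 1 and to t.
  Powers of the first raise degrees without changing restrictions.\<close>

lemma affine_forms:
  fixes b :: "'a::field ^ 3"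
  assumes "b \<noteq> 0" "cr u v = b"
  obtains \<omega> \<omega>' where "dot \<omega> u = 1" "dot \<omega> v = 0" "dot \<omega>' u = 0" "dot \<omega>' v = 1"
proof -
  obtain w where w: "dot b w = 1" using normal_vector assms by blast
  show ?thesis
  proof (rule that)
    show "dot (cr v w) u = 1" "dot (cr w u) v = 1"
      using w unfolding assms(2)[symmetric] by (simp_all add: dot_expand algebra_simps)
  qed simp_all
qed

text \<open>The form is the homogenization of s to degree m in the dual forms of u and v.\<close>

lemma form_with_restriction:
  assumes "b \<noteq> 0" "cr u v = b" "Polynomial.degree s \<le> m"
  obtains F where "homogeneous m F" "rest u v F = s"
proof -
  obtain \<omega> \<omega>' where w: "dot \<omega> u = 1" "dot \<omega> v = 0" "dot \<omega>' u = 0" "dot \<omega>' v = 1"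
    using affine_forms assms by blast
  define F where "F = (\<Sum>k\<le>m. const (coeff s k) * (linear_form \<omega> ^ (m - k) * linear_form \<omega>' ^ k))"
  have "homogeneous m F"
    unfolding F_def
  proof (intro homogeneous_sum homogeneous_const_mult)
    fix k assume "k \<in> {..m}"
    then show "homogeneous m (linear_form \<omega> ^ (m - k) * linear_form \<omega>' ^ k)"
      using homogeneous_mult[OF homogeneous_power[OF homogeneous_linear_form(1)[of \<omega>], of "m - k"]
          homogeneous_power[OF homogeneous_linear_form(1)[of \<omega>'], of k]] by simp
  qed
  moreover have "rest u v F = s"
  proof (rule poly_ext)
    fix t
    have "poly (rest u v F) t = (\<Sum>k\<le>m. coeff s k * t ^ k)"
      by (simp add: F_def poly_rest ev_simps dot_add dot_scale w)
    also have "\<dots> = poly s t"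
      using assms(3) by (simp add: poly_altdef sum.mono_neutral_right coeff_eq_0
          sum.mono_neutral_left[of "{..m}" "{..Polynomial.degree s}"])
    finally show "poly (rest u v F) t = poly s t" .
  qed
  ultimately show ?thesis using that by blast
qed

lemma rest_linear_form_root:
  assumes "dot a (u + t *s v) = 0"
  shows "rest u v (linear_form a) = smult (dot a v) [:- t, 1:]"
  using rest_prod_linear_form[of "{a}" u t v] assms by simp

text \<open>Log derivations with prescribed restriction of \<open>b\<cdot>\<theta>\<close> to the line \<open>b = 0\<close>; the divisibility
  conditions are necessary by \<open>log_der_rest_dvd\<close>.  A line meeting \<open>b = 0\<close> in an old point contributes a
  linear factor; for a line through a new point the value there is adjusted by an explicit derivation.\<close>

lemma log_der_with_restriction:
  fixes b :: "'k::field_char_0 ^ 3"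
  assumes b: "b \<noteq> 0" "cr u v = b"
    and "finite S" "independent_lines S" "\<And>a. a \<in> S \<Longrightarrow> dot a v \<noteq> 0"
    and "Polynomial.degree s \<le> m" "card S \<le> m + 2"
    and "\<And>t. [:- t, 1:] ^ (card {a \<in> S. dot a (u + t *s v) = 0} - 1) dvd s"
  shows "\<exists>\<theta>. \<theta> \<in> log_der S \<and> homv m \<theta> \<and> rest u v (dot (cvec b) \<theta>) = s"
  using assms(3-)
proof (induction S arbitrary: s m rule: finite_induct)
  case empty
  obtain F where F: "homogeneous m F" "rest u v F = s"
    using form_with_restriction b empty by blast
  \<comment> \<open>With b normalized against w, the derivation F w has restriction that of F, so
    any form extending s will do.\<close>
  obtain w where w: "dot b w = 1" using normal_vector b by blast
  have "rest u v (dot (cvec b) (F *s cvec w)) = s"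
    by (rule poly_ext) (simp add: poly_rest ev_dot ev_mult dot_scale w flip: F(2))
  moreover have "homv m (F *s cvec w)" using homv_scale[OF F(1) homv_cvec] by simp
  ultimately show ?case by auto
next
  case (insert c S)
  let ?e = "\<lambda>T t. card {a \<in> T. dot a (u + t *s v) = 0}"
  have indS: "independent_lines S" using insert.prems(1) independent_lines_subset by blast
  have cv: "dot c v \<noteq> 0" using insert.prems(2) by simp
  define \<tau> where "\<tau> = - dot c u / dot c v"
  have root: "dot c (u + t *s v) = 0 \<longleftrightarrow> t = \<tau>" for t
    using cv by (auto simp: \<tau>_def dot_add dot_scale field_simps add_eq_0_iff2)
  define l where "l = const (inverse (dot c v)) * linear_form c"
  have l: "homogeneous 1 l" "rest u v l = [:- \<tau>, 1:]"
    using cv rest_linear_form_root[of c u \<tau> v] root[of \<tau>]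
    by (simp_all add: l_def homogeneous_const_mult rest_mult rest_const)
  have l_der: "l *s \<theta> \<in> log_der (insert c S)" if "\<theta> \<in> log_der S" for \<theta>
    using log_der_scale[OF log_der_linear_form_scale[OF that], of "const (inverse (dot c v))" c]
    by (simp add: l_def vector_smult_assoc)
  have e_other: "?e (insert c S) t = ?e S t" if "t \<noteq> \<tau>" for t
    using root[of t] that by (intro arg_cong[where f = card]) auto
  \<comment> \<open>A solution for s1 with one line less and in degree m - 1 is multiplied by the
    normalized equation l of c. The case s1 = 0 is separate because it does not force m to be
    positive.\<close>
  have lift: "\<exists>\<theta>. \<theta> \<in> log_der (insert c S) \<and> homv m \<theta> \<and> rest u v (dot (cvec b) \<theta>) = [:- \<tau>, 1:] * s1"
    if deg: "Polynomial.degree ([:- \<tau>, 1:] * s1) \<le> m"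
      and dvd: "\<And>t. [:- t, 1:] ^ (?e S t - 1) dvd s1" for s1
  proof (cases "s1 = 0")
    case True
    have "rest u v (dot (cvec b) 0) = 0" by simp
    then show ?thesis using True by (intro exI[of _ 0]) simp
  next
    case False
    then have "Suc (Polynomial.degree s1) \<le> m"
      using deg by (subst (asm) degree_mult_eq) simp_all
    then obtain m' where m': "m = Suc m'" "Polynomial.degree s1 \<le> m'" by (cases m) auto
    have "card S \<le> m' + 2" using insert.prems(4) insert.hyps m'(1) by simp
    then obtain \<theta> where \<theta>: "\<theta> \<in> log_der S" "homv m' \<theta>" "rest u v (dot (cvec b) \<theta>) = s1"
      using insert.IH[of s1 m'] indS insert.prems(2) m'(2) dvd by blast
    show ?thesis
    proof (intro exI[of _ "l *s \<theta>"] conjI)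
      show "homv m (l *s \<theta>)" using homv_scale[OF l(1) \<theta>(2)] m' by simp
      show "rest u v (dot (cvec b) (l *s \<theta>)) = [:- \<tau>, 1:] * s1"
        by (simp add: dot_scale rest_mult l \<theta>(3) del: mult_pCons_left)
    qed (rule l_der[OF \<theta>(1)])
  qed
  show ?case
  proof (cases "\<exists>a\<in>S. dot a (u + \<tau> *s v) = 0")
    case True
    have "{a \<in> insert c S. dot a (u + \<tau> *s v) = 0} = insert c {a \<in> S. dot a (u + \<tau> *s v) = 0}"
      using root[of \<tau>] by auto
    then have e: "?e (insert c S) \<tau> = Suc (?e S \<tau>)"
      using insert.hyps by (simp add: card_insert_if)
    have "{a \<in> S. dot a (u + \<tau> *s v) = 0} \<noteq> {}" using True by auto
    then have "?e S \<tau> \<noteq> 0" using insert.hyps(1) by (simp add: card_eq_0_iff)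
    then obtain n where n: "?e S \<tau> = Suc n" by (cases "?e S \<tau>") auto
    \<comment> \<open>Besides c, n + 1 old lines pass through the point: s has order n + 1 there,
      and order n is what remains to be asked of s1.\<close>
    have d: "[:- \<tau>, 1:] ^ Suc n dvd s" using insert.prems(5)[of \<tau>] e n by simp
    then have "[:- \<tau>, 1:] dvd s" by (metis dvd_mult_left power_Suc)
    then obtain s1 where s1: "s = [:- \<tau>, 1:] * s1" by blast
    have "[:- t, 1:] ^ (?e S t - 1) dvd s1" for t
    proof (cases "t = \<tau>")
      case True
      then show ?thesis using d n unfolding s1 by (simp del: mult_pCons_left)
    next
      case False
      then have "[:- t, 1:] ^ (?e S t - 1) dvd [:- \<tau>, 1:] * s1"
        using insert.prems(5)[of t] e_other s1 by simp
      then show ?thesis using False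
        by (subst (asm) linear_factor_power_dvd_mult_iff) auto
    qed
    then show ?thesis using lift[of s1] insert.prems(3) s1 by blast
  next
    case new: False
    \<comment> \<open>One derivation with nonzero value at the new point suffices: subtracting a
      multiple of its restriction makes s vanish there, and \<open>lift\<close> applies to the
      difference.\<close>
    have "\<exists>\<theta>. \<theta> \<in> log_der (insert c S) \<and> homv m \<theta> \<and> poly (rest u v (dot (cvec b) \<theta>)) \<tau> \<noteq> 0"
    proof (cases "S = {}")
      case True
      have "cr b c \<noteq> 0"
      proof
        assume "cr b c = 0"
        then have "cr c (cr u v) = 0" using cr_skew[of c b] b by simp
        then have "cr (dot c v *s u - dot c u *s v) v = 0" by (simp add: cr_cr)
        moreover have "cr (x *s u - y *s v) v = x *s cr u v" for x y
          by (simp add: vec3_eq_iff algebra_simps)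
        ultimately have "dot c v *s b = 0" by (simp add: b)
        then show False using cv b by (simp add: vec_eq_iff)
      qed
      moreover have "c \<noteq> 0" using cv by auto
      ultimately obtain x y where "cr x y = c" "dot b y \<noteq> 0"
        using plane_basis[of c "{b}"] by auto
      then have y: "dot c y = 0" "dot b y \<noteq> 0" by auto
      obtain \<omega> where \<omega>: "dot \<omega> u = 1" "dot \<omega> v = 0" using affine_forms b by metis
      let ?\<theta> = "linear_form \<omega> ^ m *s cvec y"
      have "homv m ?\<theta>"
        using homv_scale[OF homogeneous_power[OF homogeneous_linear_form(1)] homv_cvec, of m \<omega> y] by simp
      moreover have "?\<theta> \<in> log_der (insert c S)"
        using True y by (simp add: log_der_def evv_scale dot_scale)
      moreover have "poly (rest u v (dot (cvec b) ?\<theta>)) \<tau> \<noteq> 0"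
        using y \<omega> by (simp add: poly_rest dot_scale ev_simps ev_dot dot_add)
      ultimately show ?thesis by blast
    next
      case False
      then obtain a where a: "a \<in> S" by blast
      obtain \<omega> where \<omega>: "dot \<omega> u = 1" "dot \<omega> v = 0" using affine_forms b by metis
      \<comment> \<open>The direction \<open>cr a c\<close> is tangent to a and c, and the product
        makes F vanish on all other lines; the power of \<omega> fills the degree up to m. Here
        \<open>card S \<le> m + 1\<close> is needed.\<close>
      define F where "F = linear_form \<omega> ^ (m + 1 - card S) * (\<Prod>d\<in>S - {a}. linear_form d)"
      let ?\<theta> = "F *s cvec (cr a c)"
      have "card S = Suc (card (S - {a}))" "card S \<le> m + 1"
        using a insert.hyps insert.prems(4) by (simp_all add: card_Suc_Diff1 del: card_Diff_insert)
      then have "m + 1 - card S + card (S - {a}) = m" by linarith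
      then have "homogeneous m F"
        using homogeneous_mult[OF homogeneous_power[OF homogeneous_linear_form(1)[of \<omega>], of "m + 1 - card S"]
            homogeneous_prod_linear_form[of "S - {a}"]]
        by (simp add: F_def)
      then have "homv m ?\<theta>" using homv_scale[OF _ homv_cvec] by fastforce
      moreover have "?\<theta> \<in> log_der (insert c S)"
        unfolding log_der_def
      proof (intro CollectI ballI allI impI)
        fix d q assume d: "d \<in> insert c S" "dot d q = 0"
        show "dot d (evv ?\<theta> q) = 0"
        proof (cases "d = a \<or> d = c")
          case False
          then have "d \<in> S - {a}" using d by auto
          then have "(\<Prod>d\<in>S - {a}. dot d q) = 0"
            using d(2) insert.hyps(1) by (intro prod_zero) auto
          then show ?thesis by (simp add: F_def evv_scale dot_scale ev_simps)
        qed (auto simp: evv_scale dot_scale)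
      qed
      moreover have "poly (rest u v (dot (cvec b) ?\<theta>)) \<tau> \<noteq> 0"
      proof -
        \<comment> \<open>This determinant is nonzero because a misses the point where c meets
          b.\<close>
        have "dot b (cr a c) = dot a u * dot c v - dot c u * dot a v"
          by (simp add: b(2)[symmetric] dot_cr_cr)
        also have "\<dots> = dot c v * dot a (u + \<tau> *s v)"
          using cv by (simp add: \<tau>_def dot_add dot_scale field_simps)
        finally have "dot b (cr a c) \<noteq> 0" using new a cv by simp
        moreover have "(\<Prod>d\<in>S - {a}. dot d (u + \<tau> *s v)) \<noteq> 0"
          using new insert.hyps(1) by auto
        ultimately show ?thesis
          using \<omega> by (simp add: poly_rest dot_scale ev_simps ev_dot F_def dot_add)
      qed
      ultimately show ?thesis by blast
    qed
    then obtain \<theta>2 where \<theta>2: "\<theta>2 \<in> log_der (insert c S)" "homv m \<theta>2"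
      "poly (rest u v (dot (cvec b) \<theta>2)) \<tau> \<noteq> 0" by blast
    define s2 where "s2 = rest u v (dot (cvec b) \<theta>2)"
    define \<kappa> where "\<kappa> = poly s \<tau> / poly s2 \<tau>"
    have "poly (s - smult \<kappa> s2) \<tau> = 0" using \<theta>2(3) by (simp add: \<kappa>_def s2_def)
    then obtain s1 where s1: "s - smult \<kappa> s2 = [:- \<tau>, 1:] * s1"
      unfolding poly_eq_0_iff_dvd by blast
    have "Polynomial.degree s2 \<le> m"
      unfolding s2_def by (intro degree_rest homogeneous_dot_cvec \<theta>2)
    then have "Polynomial.degree (s - smult \<kappa> s2) \<le> m"
      using insert.prems(3) by (meson degree_diff_le degree_smult_le order_trans)
    moreover have "[:- t, 1:] ^ (?e S t - 1) dvd s1" for t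
    proof (cases "t = \<tau>")
      case True
      have "{a \<in> S. dot a (u + \<tau> *s v) = 0} = {}" using new by auto
      then have "?e S t = 0" using True by (metis card.empty)
      then show ?thesis by simp
    next
      case False
      \<comment> \<open>Being the restriction of a log derivation, the correction satisfies the
        divisibility conditions itself.\<close>
      have "[:- t, 1:] ^ (?e S t - 1) dvd s2"
        using log_der_rest_dvd[OF _ insert.prems(1,2) \<theta>2(1), of t u] insert.hyps(1) e_other[OF False]
        by (simp add: s2_def b)
      moreover have "[:- t, 1:] ^ (?e S t - 1) dvd s"
        using insert.prems(5)[of t] e_other[OF False] by simp
      ultimately have "[:- t, 1:] ^ (?e S t - 1) dvd [:- \<tau>, 1:] * s1"
        unfolding s1[symmetric] by (intro dvd_diff dvd_smult)
      then show ?thesis using False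
        by (subst (asm) linear_factor_power_dvd_mult_iff) auto
    qed
    ultimately obtain \<theta>1 where \<theta>1: "\<theta>1 \<in> log_der (insert c S)" "homv m \<theta>1"
      "rest u v (dot (cvec b) \<theta>1) = s - smult \<kappa> s2"
      using lift[of s1] unfolding s1 by blast
    show ?thesis
    proof (intro exI[of _ "\<theta>1 + const \<kappa> *s \<theta>2"] conjI)
      show "\<theta>1 + const \<kappa> *s \<theta>2 \<in> log_der (insert c S)"
        by (intro log_der_add log_der_scale \<theta>1 \<theta>2)
      show "homv m (\<theta>1 + const \<kappa> *s \<theta>2)"
        by (intro homv_add homv_const_scale \<theta>1 \<theta>2)
      show "rest u v (dot (cvec b) (\<theta>1 + const \<kappa> *s \<theta>2)) = s"
        by (simp add: dot_add dot_scale rest_add rest_mult \<theta>1(3) rest_const s2_def)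
    qed
  qed
qed

text \<open>Each term of the binomial expansion contains p^i or q^j. It turns a linear relation into
  one between high powers: once on a line, where it gives a Bezout identity, and once for the second
  cohomology.\<close>

lemma binomial_two_powers:
  fixes p q :: "'a::comm_ring_1"
  shows "\<exists>A B. (p + q) ^ (i + j) = p ^ i * A + q ^ j * B"
proof (induction "i + j" arbitrary: i j rule: less_induct)
  case less
  consider "i = 0" | "j = 0" | i' j' where "i = Suc i'" "j = Suc j'" by (metis not0_implies_Suc)
  then show ?case
  proof cases
    case 1
    then show ?thesis by (intro exI[of _ "(p + q) ^ (i + j)"] exI[of _ 0]) simp
  next
    case 2
    then show ?thesis by (intro exI[of _ 0] exI[of _ "(p + q) ^ (i + j)"]) simp
  next
    case 3
    obtain A B where 1: "(p + q) ^ (i' + j) = p ^ i' * A + q ^ j * B"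
      using less[of i' j] 3 by auto
    obtain A' B' where 2: "(p + q) ^ (i + j') = p ^ i * A' + q ^ j' * B'"
      using less[of i j'] 3 by auto
    have "(p + q) ^ (i + j) = p * (p + q) ^ (i' + j) + q * (p + q) ^ (i + j')"
      using 3 by (simp add: algebra_simps)
    also have "\<dots> = p ^ i * (A + q * A') + q ^ j * (p * B + B')"
      unfolding 1 2 using 3 by (simp add: algebra_simps)
    finally show ?thesis by blast
  qed
qed

text \<open>Vanishing of the first cohomology of O(m)^3 in every degree, from Koszul exactness in
  each coordinate.\<close>

lemma free_cocycle:
  fixes g :: "3 \<Rightarrow> 3 \<Rightarrow> 'k::field_char_0 poly3 ^ 3"
  assumes hom: "\<And>j k. homv (e + N) (g j k)"
    and cocycle: "\<And>j k l. X l ^ N *s g j k + X j ^ N *s g k l + X k ^ N *s g l j = 0"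
  shows "\<exists>\<theta>. (\<forall>j. homv e (\<theta> j)) \<and> (\<forall>j k. g j k = X j ^ N *s \<theta> k - X k ^ N *s \<theta> j)"
proof -
  have cocycle': "X l ^ N * g j k $ i + X j ^ N * g k l $ i + X k ^ N * g l j $ i = 0" for j k l i
    using cocycle[of l j k] by (simp add: vec_eq_iff)
  \<comment> \<open>Equal indices turn the cocycle condition into three times one term; alternation
    of g is thus a consequence of the condition for all triples.\<close>
  have diag: "g j j = 0" for j
  proof -
    have "3 * (X j ^ N * g j j $ i) = 0" for i using cocycle'[of j j j i] by simp
    then have "X j ^ N * g j j $ i = 0" for i
      by (metis mult_eq_0_iff zero_neq_numeral)
    then show ?thesis by (simp add: vec_eq_iff)
  qed
  have skew: "g k j = - g j k" for j k
    using cocycle'[of k j k] diag[of k]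
    by (simp add: vec_eq_iff add_eq_0_iff2 flip: mult_minus_right)
  have "\<exists>f. (\<forall>j. homogeneous e (f j)) \<and> (\<forall>j k. g j k $ i = X j ^ N * f k - X k ^ N * f j)" for i
  proof -
    have "X 0 ^ N * g 1 2 $ i + X 1 ^ N * g 2 0 $ i + X 2 ^ N * g 0 1 $ i = 0"
      using cocycle'[of 2 0 1 i] by (simp add: add.commute add.left_commute)
    then obtain f0 f1 f2 where f: "g 1 2 $ i = X 1 ^ N * f2 - X 2 ^ N * f1"
      "g 2 0 $ i = X 2 ^ N * f0 - X 0 ^ N * f2" "g 0 1 $ i = X 0 ^ N * f1 - X 1 ^ N * f0"
      by (rule koszul)
    define f where "f j = hpart e (if j = 0 then f0 else if j = 1 then f1 else f2)" for j :: 3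
    have part: "hpart (e + N) (X j ^ N * p) = X j ^ N * hpart e p" for j p
      using hpart_mult[of N "X j ^ N" "e + N" p] by simp
    have fix_part: "hpart (e + N) (g j k $ i) = g j k $ i" for j k
      using hom[of j k] by (simp add: homv_def hpart_homogeneous)
    have g: "g 1 2 $ i = X 1 ^ N * f 2 - X 2 ^ N * f 1"
      "g 2 0 $ i = X 2 ^ N * f 0 - X 0 ^ N * f 2" "g 0 1 $ i = X 0 ^ N * f 1 - X 1 ^ N * f 0"
      using fix_part[of 1 2] fix_part[of 2 0] fix_part[of 0 1] unfolding f
      by (simp_all add: f_def mpart_minus part)
    have "\<forall>j k. g j k $ i = X j ^ N * f k - X k ^ N * f j"
      unfolding all_index using g diag skew[of 2 1] skew[of 0 2] skew[of 1 0] by simp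
    moreover have "homogeneous e (f j)" for j by (simp add: f_def)
    ultimately show ?thesis by blast
  qed
  then obtain f where f: "\<And>i j. homogeneous e (f i j)"
    "\<And>i j k. g j k $ i = X j ^ N * f i k - X k ^ N * f i j" by metis
  show ?thesis
    by (rule exI[of _ "\<lambda>j. \<chi> i. f i j"]) (simp add: homv_def vec_eq_iff f)
qed

text \<open>The cochain g j k / (x_j x_k)^N is the coboundary of \<theta> j / x_j^N. In the degree m
  = e - N the numerical hypothesis reads m >= card S - 3.\<close>

theorem log_der_cocycle:
  fixes g :: "3 \<Rightarrow> 3 \<Rightarrow> 'k::field_char_0 poly3 ^ 3"
  assumes "finite S" "independent_lines S" "N + card S \<le> e + 3"
    and "\<And>j k. g j k \<in> log_der S" "\<And>j k. homv (e + N) (g j k)"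
    and "\<And>j k l. X l ^ N *s g j k + X j ^ N *s g k l + X k ^ N *s g l j = 0"
  shows "\<exists>\<theta>. (\<forall>j. \<theta> j \<in> log_der S \<and> homv e (\<theta> j)) \<and> (\<forall>j k. g j k = X j ^ N *s \<theta> k - X k ^ N *s \<theta> j)"
  using assms
proof (induction S rule: finite_induct)
  case empty
  then show ?case using free_cocycle[of e N g] by auto
next
  case (insert b S)
  have ind: "independent_lines S" using insert.prems(1) independent_lines_subset by blast
  have "\<And>j k. g j k \<in> log_der S" using insert.prems(3) log_der_insert by blast
  then obtain \<theta> where \<theta>: "\<And>j. \<theta> j \<in> log_der S" "\<And>j. homv e (\<theta> j)"
    "\<And>j k. g j k = X j ^ N *s \<theta> k - X k ^ N *s \<theta> j"
    using insert.IH[OF ind _ _ insert.prems(4,5)] insert.prems(2) insert.hyps by auto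
  have b0: "b \<noteq> 0" and "\<And>a. a \<in> S \<Longrightarrow> cr a b \<noteq> 0"
    using insert.prems(1) insert.hyps(2) by (auto simp: independent_lines_def)
  then obtain u v where uv: "cr u v = b" "\<And>a. a \<in> S \<Longrightarrow> dot a v \<noteq> 0"
    using plane_basis[OF b0 insert.hyps(1)] by metis
  define \<sigma> where "\<sigma> j = rest u v (dot (cvec b) (\<theta> j))" for j
  define y where "y j = [:u $ j, v $ j:]" for j
  have y: "rest u v (X j ^ N) = y j ^ N" for j by (simp add: y_def rest_power rest_X)
  \<comment> \<open>As g j k is tangent to b, the local restrictions \<sigma> j / y_j^N agree and
    glue to one section on the line.\<close>
  have sym: "y j ^ N * \<sigma> k = y k ^ N * \<sigma> j" for j k
  proof -
    have "rest u v (dot (cvec b) (g j k)) = 0"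
    proof (rule poly_ext)
      fix t
      have "dot b (u + t *s v) = 0" by (simp add: dot_add dot_scale flip: uv(1))
      then show "poly (rest u v (dot (cvec b) (g j k))) t = poly 0 t"
        using insert.prems(3)[of j k] by (simp add: poly_rest ev_dot log_der_insert)
    qed
    then show ?thesis by (simp add: \<theta>(3) dot_diff dot_scale rest_diff rest_mult y \<sigma>_def)
  qed
  have "\<exists>j k. u $ j * v $ k - u $ k * v $ j \<noteq> 0"
  proof (rule ccontr)
    assume "\<not> ?thesis"
    then have "cr u v = 0" by (simp add: vec3_eq_iff)
    then show False using b0 uv(1) by simp
  qed
  then obtain j k \<delta> where jk: "\<delta> \<noteq> 0" "\<delta> = u $ j * v $ k - u $ k * v $ j" by blast
  \<comment> \<open>The linear combination equals the constant \<delta>, a nonzero minor of u and v.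
    So y_j^N and y_k^N generate the unit ideal, and the glued section s is a polynomial.\<close>
  obtain A B where "(smult (v $ k) (y j) + smult (- v $ j) (y k)) ^ (N + N)
      = smult (v $ k) (y j) ^ N * A + smult (- v $ j) (y k) ^ N * B"
    using binomial_two_powers by blast
  moreover have "smult (v $ k) (y j) + smult (- v $ j) (y k) = [:\<delta>:]"
    by (simp add: y_def jk(2) algebra_simps)
  ultimately have bezout: "[:\<delta> ^ (N + N):] = y j ^ N * smult ((v $ k) ^ N) A + y k ^ N * smult ((- v $ j) ^ N) B"
    by (simp add: poly_const_pow smult_power del: smult_minus_left)
  define s where "s = smult (inverse (\<delta> ^ (N + N))) (smult ((v $ k) ^ N) A * \<sigma> j + smult ((- v $ j) ^ N) B * \<sigma> k)"
  have \<sigma>: "\<sigma> i = y i ^ N * s" for i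
  proof -
    have "y i ^ N * (smult ((v $ k) ^ N) A * \<sigma> j + smult ((- v $ j) ^ N) B * \<sigma> k)
        = smult ((v $ k) ^ N) A * (y i ^ N * \<sigma> j) + smult ((- v $ j) ^ N) B * (y i ^ N * \<sigma> k)"
      by (simp only: distrib_left mult.left_commute)
    also have "\<dots> = (y j ^ N * smult ((v $ k) ^ N) A + y k ^ N * smult ((- v $ j) ^ N) B) * \<sigma> i"
      unfolding sym[of i j] sym[of i k] by (simp only: distrib_right mult.assoc mult.left_commute)
    also have "\<dots> = smult (\<delta> ^ (N + N)) (\<sigma> i)" by (simp only: bezout[symmetric]) simp
    finally show ?thesis using jk(1) by (simp add: s_def)
  qed
  \<comment> \<open>The difference e - N truncates if e < N; in that case s = 0 by degrees, and the
    correction is 0.\<close>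
  have "\<exists>\<eta>. \<eta> \<in> log_der S \<and> homv (e - N) \<eta> \<and> rest u v (dot (cvec b) \<eta>) = s \<and> (N \<le> e \<or> \<eta> = 0)"
  proof (cases "s = 0")
    case True
    then show ?thesis by (intro exI[of _ 0]) simp
  next
    case False
    obtain i where i: "v $ i \<noteq> 0" using jk by (metis diff_zero mult_zero_right)
    \<comment> \<open>With \<open>v $ i\<close> nonzero, y_i has degree exactly 1, so the bound on
      \<sigma> i turns into one on s.\<close>
    have "Polynomial.degree (y i ^ N * s) = N + Polynomial.degree s"
      using i False by (simp add: y_def degree_mult_eq degree_power_eq)
    moreover have "Polynomial.degree (\<sigma> i) \<le> e"
      unfolding \<sigma>_def by (intro degree_rest homogeneous_dot_cvec \<theta>)
    ultimately have deg: "N \<le> e" "Polynomial.degree s \<le> e - N" using \<sigma>[of i] by auto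
    have "[:- t, 1:] ^ (card {a \<in> S. dot a (u + t *s v) = 0} - 1) dvd s" for t
    proof -
      \<comment> \<open>Some coordinate y_i is nonzero at the point, so the vanishing order forced
        on \<sigma> i passes to s.\<close>
      have "u + t *s v \<noteq> 0" using point_on_line_nonzero uv(1) b0 by blast
      then obtain i where "poly (y i) t \<noteq> 0" by (auto simp: vec_eq_iff y_def)
      then have "poly (y i ^ N) t \<noteq> 0" by simp
      moreover have "[:- t, 1:] ^ (card {a \<in> S. dot a (u + t *s v) = 0} - 1) dvd y i ^ N * s"
        using log_der_rest_dvd[OF insert.hyps(1) ind uv(2) \<theta>(1), of t u i] \<sigma>[of i]
        by (simp add: \<sigma>_def uv(1))
      ultimately show ?thesis using linear_factor_power_dvd_mult_iff by blast
    qed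
    then have "\<exists>\<eta>. \<eta> \<in> log_der S \<and> homv (e - N) \<eta> \<and> rest u v (dot (cvec b) \<eta>) = s"
      using log_der_with_restriction[OF b0 uv(1) insert.hyps(1) ind uv(2) deg(2)] insert.prems(2) insert.hyps deg(1)
      by simp
    then show ?thesis using deg(1) by blast
  qed
  then obtain \<eta> where \<eta>: "\<eta> \<in> log_der S" "homv (e - N) \<eta>" "rest u v (dot (cvec b) \<eta>) = s"
    "N \<le> e \<or> \<eta> = 0" by blast
  show ?case
  \<comment> \<open>Subtracting one global section from all local ones preserves the coboundary and
    achieves tangency to b.\<close>
  proof (intro exI[of _ "\<lambda>j. \<theta> j - X j ^ N *s \<eta>"] conjI allI)
    fix j k
    show hom: "homv e (\<theta> j - X j ^ N *s \<eta>)"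
      using \<eta>(4)
    proof
      assume "N \<le> e"
      then show ?thesis
        using homv_diff[OF \<theta>(2)[of j]] homv_scale[OF homogeneous_X_power[of N j] \<eta>(2)] by simp
    qed (simp add: \<theta>(2))
    have "rest u v (dot (cvec b) (\<theta> j - X j ^ N *s \<eta>)) = 0"
      using \<sigma>[of j] by (simp add: dot_diff dot_scale rest_diff rest_mult y \<eta>(3) \<sigma>_def)
    then have "ev (dot (cvec b) (\<theta> j - X j ^ N *s \<eta>)) q = 0" if "dot b q = 0" for q
      using vanish_on_plane[OF homogeneous_dot_cvec[OF hom] b0 uv(1)] that by blast
    then show "\<theta> j - X j ^ N *s \<eta> \<in> log_der (insert b S)"
      using log_der_diff[OF \<theta>(1)[of j] log_der_scale[OF \<eta>(1)]] by (simp add: log_der_insert ev_dot)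
    show "g j k = X j ^ N *s (\<theta> k - X k ^ N *s \<eta>) - X k ^ N *s (\<theta> j - X j ^ N *s \<eta>)"
      by (simp add: \<theta>(3) vec_eq_iff algebra_simps)
  qed
qed

section \<open>Derivations annihilating the defining polynomial\<close>

lemma lookup_partial_deriv:
  "Poly_Mapping.lookup (partial_deriv i p) \<nu> =
    of_nat (Suc (Poly_Mapping.lookup \<nu> i)) * Poly_Mapping.lookup p (\<nu> + Poly_Mapping.single i 1)"
proof -
  have shift: "\<mu> - Poly_Mapping.single i 1 + Poly_Mapping.single i 1 = \<mu>"
    if "Poly_Mapping.lookup \<mu> i \<noteq> 0" for \<mu> :: "3 \<Rightarrow>\<^sub>0 nat"
    using that by (intro poly_mapping_eqI) (auto simp: lookup_add lookup_minus lookup_single when_def)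
  have "Poly_Mapping.lookup (partial_deriv i p) \<nu> = (\<Sum>\<mu>\<in>Poly_Mapping.keys p.
      if \<mu> = \<nu> + Poly_Mapping.single i 1 then of_nat (Poly_Mapping.lookup \<mu> i) * Poly_Mapping.lookup p \<mu> else 0)"
    unfolding partial_deriv_def lookup_sum
  proof (rule sum.cong)
    fix \<mu>
    show "Poly_Mapping.lookup (Poly_Mapping.single (\<mu> - Poly_Mapping.single i 1)
        (of_nat (Poly_Mapping.lookup \<mu> i) * Poly_Mapping.lookup p \<mu>)) \<nu> =
      (if \<mu> = \<nu> + Poly_Mapping.single i 1 then of_nat (Poly_Mapping.lookup \<mu> i) * Poly_Mapping.lookup p \<mu> else 0)"
      using shift[of \<mu>]
      by (cases "Poly_Mapping.lookup \<mu> i = 0") (auto simp: lookup_single when_def simp del: One_nat_def)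
  qed simp
  also have "\<dots> = of_nat (Suc (Poly_Mapping.lookup \<nu> i)) * Poly_Mapping.lookup p (\<nu> + Poly_Mapping.single i 1)"
    by (simp add: in_keys_iff lookup_add)
  finally show ?thesis .
qed

lemma partial_deriv_add: "partial_deriv i (p + q) = partial_deriv i p + partial_deriv i q"
  by (rule poly_mapping_eqI) (simp add: lookup_partial_deriv lookup_add distrib_left)

lemma partial_deriv_single:
  "partial_deriv i (Poly_Mapping.single \<mu> c) =
    Poly_Mapping.single (\<mu> - Poly_Mapping.single i 1) (of_nat (Poly_Mapping.lookup \<mu> i) * c)"
  by (cases "c = 0") (simp_all add: partial_deriv_def)

lemma partial_deriv_const [simp]: "partial_deriv i (const c) = 0"
  by (simp add: partial_deriv_single)

lemma partial_deriv_mult: "partial_deriv i (p * q) = partial_deriv i p * q + p * partial_deriv i q"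
proof (induction p rule: monomial_induct)
  case (monomial \<mu> c)
  show ?case
  proof (induction q rule: monomial_induct)
    case (monomial \<nu> d)
    have shift: "(\<mu> + \<nu>) - Poly_Mapping.single i 1 = (\<mu> - Poly_Mapping.single i 1) + \<nu>"
      if "Poly_Mapping.lookup \<mu> i \<noteq> 0" for \<mu> \<nu> :: "3 \<Rightarrow>\<^sub>0 nat"
      using that by (intro poly_mapping_eqI) (auto simp: lookup_add lookup_minus lookup_single when_def)
    have 1: "Poly_Mapping.single (\<mu> - Poly_Mapping.single i 1 + \<nu>) (of_nat (Poly_Mapping.lookup \<mu> i) * c * d)
      = Poly_Mapping.single (\<mu> + \<nu> - Poly_Mapping.single i 1) (of_nat (Poly_Mapping.lookup \<mu> i) * c * d)"
      using shift[of \<mu> \<nu>] by (cases "Poly_Mapping.lookup \<mu> i = 0") simp_all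
    have 2: "Poly_Mapping.single (\<mu> + (\<nu> - Poly_Mapping.single i 1)) (c * (of_nat (Poly_Mapping.lookup \<nu> i) * d))
      = Poly_Mapping.single (\<mu> + \<nu> - Poly_Mapping.single i 1) (c * (of_nat (Poly_Mapping.lookup \<nu> i) * d))"
      using shift[of \<nu> \<mu>] by (cases "Poly_Mapping.lookup \<nu> i = 0") (simp_all add: add.commute)
    show ?case
      unfolding mult_single partial_deriv_single 1 2 single_add[symmetric]
      by (simp add: lookup_add algebra_simps)
  qed (simp add: distrib_left partial_deriv_add algebra_simps)
qed (simp add: distrib_right partial_deriv_add algebra_simps)

lemma derivation_add: "derivation \<theta> (p + q) = derivation \<theta> p + derivation \<theta> q"
  by (simp add: derivation_def partial_deriv_add distrib_left sum.distrib)

lemma derivation_mult: "derivation \<theta> (p * q) = derivation \<theta> p * q + p * derivation \<theta> q"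
  by (simp add: derivation_def partial_deriv_mult sum_index) (simp add: algebra_simps)

lemma derivation_const [simp]: "derivation \<theta> (const c) = 0"
  by (simp add: derivation_def)

lemma derivation_X [simp]: "derivation \<theta> (X i) = (\<theta> :: 'k::field_char_0 poly3 ^ 3) $ i"
proof -
  have "partial_deriv j (X i :: 'k poly3) = (if j = i then 1 else 0)" for j
    by (simp add: X_def partial_deriv_single lookup_single when_def)
  then show ?thesis
    by (simp add: derivation_def if_distrib[of "(*) _"] cong: if_cong)
qed

lemma derivation_linear_form: "derivation \<theta> (linear_form a) = dot (cvec a) \<theta>"
  by (simp add: linear_form_def sum_index derivation_add derivation_mult dot_expand cvec_def)

lemma derivation_one [simp]: "derivation \<theta> 1 = 0"
  using derivation_const[of \<theta> 1] by simp

lemma derivation_prod: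
  "finite S \<Longrightarrow> derivation \<theta> (\<Prod>a\<in>S. linear_form a)
    = (\<Sum>a\<in>S. dot (cvec a) \<theta> * (\<Prod>c\<in>S - {a}. linear_form c))"
proof (induction S rule: finite_induct)
  case (insert b S)
  have "(\<Prod>c\<in>insert b S - {a}. linear_form c) = linear_form b * (\<Prod>c\<in>S - {a}. linear_form c)" if "a \<in> S" for a
    using insert.hyps that by (subst insert_Diff_if) auto
  moreover have "insert b S - {b} = S" using insert.hyps by auto
  ultimately show ?case
    using insert by (simp add: derivation_mult derivation_linear_form sum_distrib_left mult.left_commute add.commute)
qed simp

lemma derivation_plus: "derivation (\<theta> + \<eta>) p = derivation \<theta> p + derivation \<eta> p"
  by (simp add: derivation_def distrib_right sum.distrib)

lemma derivation_minus: "derivation (\<theta> - \<eta>) p = derivation \<theta> p - derivation \<eta> p"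
  by (simp add: derivation_def left_diff_distrib sum_subtractf)

lemma derivation_scale: "derivation (f *s \<theta>) p = f * derivation \<theta> p"
  by (simp add: derivation_def sum_distrib_left mult.assoc)

lemma derivation_euler:
  "finite S \<Longrightarrow> derivation Xvec (\<Prod>a\<in>S. linear_form a) = const (of_nat (card S)) * (\<Prod>a\<in>S. linear_form a)"
  by (simp add: derivation_prod prod.remove[symmetric] flip: linear_form_eq_dot)

section \<open>Splitting off the Euler derivation\<close>

lemma D0_add: "\<theta> \<in> D0 Q \<Longrightarrow> \<eta> \<in> D0 Q \<Longrightarrow> \<theta> + \<eta> \<in> D0 Q"
  by (simp add: D0_def derivation_plus)

lemma D0_diff: "\<theta> \<in> D0 Q \<Longrightarrow> \<eta> \<in> D0 Q \<Longrightarrow> \<theta> - \<eta> \<in> D0 Q"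
  by (simp add: D0_def derivation_minus)

lemma D0_scale: "\<theta> \<in> D0 Q \<Longrightarrow> p *s \<theta> \<in> D0 Q"
  by (simp add: D0_def derivation_scale)

text \<open>On the plane of a only the summand of a survives in the product rule. The remaining
  product vanishes at some points of the plane, so it is cancelled by primeness. With g = 0 this
  gives tangency; a nonzero g serves the generic case.\<close>

lemma dot_on_plane_of_derivation:
  assumes S: "finite S" "independent_lines S" "a \<in> S"
    and eq: "\<And>q. dot a q = 0 \<Longrightarrow>
      ev (derivation \<theta> (\<Prod>c\<in>S. linear_form c)) q = ev g q * (\<Prod>c\<in>S - {a}. dot c q)"
    and "dot a q = 0"
  shows "dot a (evv \<theta> q) = ev g q"
proof -
  let ?P = "\<Prod>c\<in>S - {a}. linear_form c"
  obtain q1 where q1: "dot a q1 = 0" "\<And>c. c \<in> S - {a} \<Longrightarrow> dot c q1 \<noteq> 0"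
    using plane_avoiding_point[of a "S - {a}"] S by (auto simp: insert_absorb)
  have "ev (?P * (dot (cvec a) \<theta> - g)) q = 0" if "dot a q = 0" for q
  proof -
    have "(\<Sum>b\<in>S. dot b (evv \<theta> q) * (\<Prod>c\<in>S - {b}. dot c q)) = dot a (evv \<theta> q) * (\<Prod>c\<in>S - {a}. dot c q)"
    proof (subst sum.remove[OF S(1,3)])
      have "(\<Sum>b\<in>S - {a}. dot b (evv \<theta> q) * (\<Prod>c\<in>S - {b}. dot c q)) = 0"
      proof (intro sum.neutral ballI)
        fix b assume "b \<in> S - {a}"
        then have "(\<Prod>c\<in>S - {b}. dot c q) = 0"
          using S that by (intro prod_zero) auto
        then show "dot b (evv \<theta> q) * (\<Prod>c\<in>S - {b}. dot c q) = 0" by simp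
      qed
      then show "dot a (evv \<theta> q) * (\<Prod>c\<in>S - {a}. dot c q) + (\<Sum>b\<in>S - {a}. dot b (evv \<theta> q) * (\<Prod>c\<in>S - {b}. dot c q))
        = dot a (evv \<theta> q) * (\<Prod>c\<in>S - {a}. dot c q)" by simp
    qed
    then show ?thesis
      using eq[OF that] S(1) by (simp add: derivation_prod ev_simps ev_dot algebra_simps)
  qed
  moreover have "ev ?P q1 \<noteq> 0" using q1 S(1) by (simp add: ev_prod)
  ultimately have "ev (dot (cvec a) \<theta> - g) q = 0"
    using vanish_on_plane_prime[of a ?P "dot (cvec a) \<theta> - g" q1 q] q1(1) assms(5) by blast
  then show ?thesis by (simp add: ev_simps ev_dot)
qed

lemma D0_subset_log_der:
  assumes "finite S" "independent_lines S"
  shows "D0 (\<Prod>a\<in>S. linear_form a) \<subseteq> log_der S"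
proof
  fix \<theta> assume "\<theta> \<in> D0 (\<Prod>a\<in>S. linear_form a)"
  then have "dot a (evv \<theta> q) = ev 0 q" if "a \<in> S" "dot a q = 0" for a q
    using dot_on_plane_of_derivation[OF assms, of a \<theta> 0] that by (simp add: D0_def)
  then show "\<theta> \<in> log_der S" by (simp add: log_der_def)
qed

text \<open>The last conclusion guards the truncated n - 1: a nonzero quotient occurs only in
  positive degree.\<close>

lemma log_der_factors:
  assumes "independent_lines S" "\<theta> \<in> log_der S" "homv n \<theta>"
  obtains h where "\<And>a. a \<in> S \<Longrightarrow> dot (cvec a) \<theta> = linear_form a * h a"
    "\<And>a. a \<in> S \<Longrightarrow> homogeneous (n - 1) (h a)" "\<And>a. a \<in> S \<Longrightarrow> h a \<noteq> 0 \<Longrightarrow> 1 \<le> n"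
proof -
  have "\<exists>h. dot (cvec a) \<theta> = linear_form a * h \<and> homogeneous (n - 1) h \<and> (h \<noteq> 0 \<longrightarrow> 1 \<le> n)" if "a \<in> S" for a
  proof -
    have "a \<noteq> 0" using assms that by (auto simp: independent_lines_def)
    moreover have "ev (dot (cvec a) \<theta>) q = 0" if "dot a q = 0" for q
      using assms(2) \<open>a \<in> S\<close> that by (simp add: log_der_def ev_dot)
    ultimately obtain h where h: "dot (cvec a) \<theta> = linear_form a * h"
      using linear_form_dvdI[of a "dot (cvec a) \<theta>"] by (auto elim: dvdE)
    then show ?thesis
      using homogeneous_factor[OF homogeneous_linear_form(1) homogeneous_dot_cvec[OF assms(3)] h
          linear_form_nonzero[OF \<open>a \<noteq> 0\<close>]] by auto
  qed
  then show ?thesis using that by metis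
qed

lemma homv_euler_scale:
  assumes "homogeneous (n - 1) \<rho>" "\<rho> \<noteq> 0 \<Longrightarrow> 1 \<le> n"
  shows "homv n (\<rho> *s Xvec)"
proof (cases "\<rho> = 0")
  case False
  then have "homogeneous n (\<rho> * X i)" for i
    using homogeneous_mult[OF assms(1) homogeneous_X(1)[of i]] assms(2) by simp
  then show ?thesis by (simp add: homv_def Xvec_def)
qed (simp add: homv_def)

text \<open>With h_a the quotient of a.\<theta> by a, \<theta>(Q) is Q times the sum of the h_a,
  while E(Q) = card S Q. Hence \<rho> is the mean of the h_a, which needs characteristic 0.\<close>

lemma log_der_euler_split:
  assumes "finite S" "independent_lines S" "S \<noteq> {}" "\<theta> \<in> log_der S" "homv n \<theta>"
  obtains \<rho> where "\<theta> - \<rho> *s Xvec \<in> D0 (\<Prod>a\<in>S. linear_form a)" "homv n (\<theta> - \<rho> *s Xvec)"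
proof -
  let ?Q = "\<Prod>a\<in>S. linear_form a"
  obtain h where h: "\<And>a. a \<in> S \<Longrightarrow> dot (cvec a) \<theta> = linear_form a * h a"
    "\<And>a. a \<in> S \<Longrightarrow> homogeneous (n - 1) (h a)" "\<And>a. a \<in> S \<Longrightarrow> h a \<noteq> 0 \<Longrightarrow> 1 \<le> n"
    using log_der_factors[OF assms(2,4,5)] by metis
  have card: "card S \<noteq> 0" using assms by simp
  define \<rho> where "\<rho> = const (inverse (of_nat (card S))) * (\<Sum>a\<in>S. h a)"
  have "const (of_nat (card S)) * \<rho> = (\<Sum>a\<in>S. h a)"
  proof -
    have "const (of_nat (card S)) * const (inverse (of_nat (card S))) = (1 :: 'a poly3)"
      using card by (simp add: mult_single del: single_of_nat)
    then show ?thesis by (simp only: \<rho>_def mult.assoc[symmetric] mult_1_left)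
  qed
  moreover have "derivation \<theta> ?Q = (\<Sum>a\<in>S. h a) * ?Q"
    unfolding derivation_prod[OF assms(1)] sum_distrib_right
    by (rule sum.cong) (use assms(1) h(1) in \<open>simp_all add: prod.remove ac_simps\<close>)
  ultimately have "derivation (\<theta> - \<rho> *s Xvec) ?Q = 0"
    by (simp add: derivation_minus derivation_scale derivation_euler[OF assms(1)] algebra_simps)
  moreover have "homv n (\<theta> - \<rho> *s Xvec)"
  proof (intro homv_diff assms(5) homv_euler_scale)
    show "homogeneous (n - 1) \<rho>"
      unfolding \<rho>_def by (intro homogeneous_const_mult homogeneous_sum h)
    assume "\<rho> \<noteq> 0"
    then have "(\<Sum>a\<in>S. h a) \<noteq> 0" by (auto simp: \<rho>_def)
    then obtain a where "a \<in> S" "h a \<noteq> 0" by (meson sum.neutral)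
    then show "1 \<le> n" using h(3) by blast
  qed
  ultimately show ?thesis using that by (simp add: D0_def)
qed

text \<open>This makes the sum of \<open>D0\<close> and the multiples of E direct: E(Q) is a nonzero
  multiple of Q.\<close>

lemma euler_not_in_D0:
  assumes "finite S" "independent_lines S" "S \<noteq> {}" "\<rho> *s Xvec \<in> D0 (\<Prod>a\<in>S. linear_form a)"
  shows "\<rho> = 0"
proof -
  have "(\<Prod>a\<in>S. linear_form a) \<noteq> 0"
    using assms by (auto simp: independent_lines_def)
  moreover have "const (of_nat (card S)) \<noteq> (0 :: 'a poly3)"
    using assms by (metis card_eq_0_iff lookup_single_eq lookup_zero of_nat_eq_0_iff)
  ultimately show ?thesis
    using assms(4) by (auto simp: D0_def derivation_scale derivation_euler[OF assms(1)])
qed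

section \<open>Second cohomology: three independent lines, then one more\<close>

lemma dot_dual_basis:
  "dot a (cr b c) *s x = dot a x *s cr b c + dot b x *s cr c a + dot c x *s cr a b"
  by (simp add: vec3_eq_iff dot_expand) (simp add: algebra_simps)

lemma cvec_cr: "cr (cvec a) (cvec b) = cvec (cr a b)"
  by (simp add: vec3_eq_iff cvec_def mult_single single_diff)

lemma dot_cvec: "dot (cvec a) (cvec b) = const (dot a b)"
  by (simp add: dot_expand cvec_def mult_single single_add)

text \<open>A greedy choice: b avoids some point of a, and c avoids the point where a and b
  meet.\<close>

lemma noncollinear_triple:
  assumes S: "independent_lines S" "\<not> (\<exists>p. p \<noteq> 0 \<and> (\<forall>a\<in>S. dot a p = 0))"
  obtains a b c where "a \<in> S" "b \<in> S" "c \<in> S" "dot a (cr b c) \<noteq> 0"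
proof -
  have "(1 :: 'a ^ 3) \<noteq> 0" by (subst vec_eq_iff) simp
  then have "S \<noteq> {}" using S(2) by blast
  then obtain a where a: "a \<in> S" by blast
  then have "a \<noteq> 0" using S(1) by (auto simp: independent_lines_def)
  obtain u v where uv: "cr u v = a" using plane_basis[OF \<open>a \<noteq> 0\<close>, of "{}"] by auto
  then have "v \<noteq> 0" "dot a v = 0" using \<open>a \<noteq> 0\<close> by auto
  then obtain b where b: "b \<in> S" "dot b v \<noteq> 0" using S(2) by blast
  then have "a \<noteq> b" using \<open>dot a v = 0\<close> by auto
  then have "cr a b \<noteq> 0" using S(1) a b by (auto simp: independent_lines_def)
  then obtain c where "c \<in> S" "dot c (cr a b) \<noteq> 0" using S(2) by blast
  then show ?thesis using that a b by blast
qed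

text \<open>In the dual basis of a, b, c the module is free with generators in degree 1. The
  coordinates of \<theta> have degree n - 1, to which the pigeonhole bound of
  \<open>X_power_sum_of_degree\<close> applies.\<close>

lemma log_der_triple_second:
  assumes det: "dot a (cr b c) \<noteq> 0" and ind: "independent_lines {a, b, c}"
    and "\<theta> \<in> log_der {a, b, c}" "homv n \<theta>" "3 * N \<le> n + 1"
  shows "\<exists>g. (\<forall>i. g i \<in> log_der {a, b, c}) \<and> \<theta> = (\<Sum>i\<in>UNIV. X i ^ N *s g i)"
proof -
  obtain h where h: "\<And>d. d \<in> {a, b, c} \<Longrightarrow> dot (cvec d) \<theta> = linear_form d * h d"
    "\<And>d. d \<in> {a, b, c} \<Longrightarrow> homogeneous (n - 1) (h d)"
    using log_der_factors[OF ind assms(3,4)] by metis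
  have "\<exists>k. h d = (\<Sum>i\<in>UNIV. X i ^ N * k i)" if "d \<in> {a, b, c}" for d
    using X_power_sum_of_degree[OF h(2)[OF that]] assms(5) by auto
  then have "\<forall>d\<in>{a, b, c}. \<exists>k. h d = (\<Sum>i\<in>UNIV. X i ^ N * k i)" by (rule ballI)
  from bchoice[OF this] obtain k where k: "\<forall>d\<in>{a, b, c}. h d = (\<Sum>i\<in>UNIV. X i ^ N * k d i)" ..
  define g where "g i = const (inverse (dot a (cr b c))) *s
    ((linear_form a * k a i) *s cvec (cr b c) + (linear_form b * k b i) *s cvec (cr c a)
      + (linear_form c * k c i) *s cvec (cr a b))" for i
  have "(linear_form a * p) *s cvec (cr b c) \<in> log_der {a, b, c}"
    "(linear_form b * p) *s cvec (cr c a) \<in> log_der {a, b, c}"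
    "(linear_form c * p) *s cvec (cr a b) \<in> log_der {a, b, c}" for p
    by (auto simp: log_der_def evv_scale dot_scale ev_mult)
  then have "g i \<in> log_der {a, b, c}" for i
    unfolding g_def by (intro log_der_scale[of _ _ "const _"] log_der_add)
  moreover have "\<theta> = (\<Sum>i\<in>UNIV. X i ^ N *s g i)"
  proof -
    have "const (dot a (cr b c)) *s \<theta> = dot (cvec a) (cr (cvec b) (cvec c)) *s \<theta>"
      by (simp add: cvec_cr dot_cvec)
    also have "\<dots> = (linear_form a * h a) *s cvec (cr b c) + (linear_form b * h b) *s cvec (cr c a)
        + (linear_form c * h c) *s cvec (cr a b)"
      unfolding dot_dual_basis by (simp add: h cvec_cr)
    finally have "const (inverse (dot a (cr b c))) *s (const (dot a (cr b c)) *s \<theta>) =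
      const (inverse (dot a (cr b c))) *s ((linear_form a * h a) *s cvec (cr b c)
        + (linear_form b * h b) *s cvec (cr c a) + (linear_form c * h c) *s cvec (cr a b))" by simp
    moreover have "const (inverse (dot a (cr b c))) *s (const (dot a (cr b c)) *s \<theta>) = \<theta>"
      using det by (simp add: vector_smult_assoc mult_single)
    ultimately show ?thesis
      by (simp add: g_def k sum_index vec_eq_iff) (simp add: algebra_simps)
  qed
  ultimately show ?thesis by blast
qed

text \<open>If \<open>x\<^sub>i\<close> occurs in the equation of the added line b, then \<open>x\<^sub>i\<^sup>2\<^sup>N\<close> lies in the ideal generated by
  that equation and the N-th powers of the other two variables; so \<open>\<theta> / (x\<^sub>0x\<^sub>1x\<^sub>2)\<^sup>N\<close> is a boundary up to
  b times a cochain for the arrangement without b.\<close>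

lemma log_der_second_step:
  fixes b :: "'k::field_char_0 ^ 3"
  assumes b: "b \<noteq> 0" and \<theta>: "\<theta> \<in> log_der (insert b S)" "homv n \<theta>"
    and IH: "\<And>\<eta> n N. \<eta> \<in> log_der S \<Longrightarrow> homv n \<eta> \<Longrightarrow> 3 * N + card S \<le> n + 4 \<Longrightarrow>
      \<exists>L g. (\<forall>i. g i \<in> log_der S) \<and> (\<Prod>i\<in>UNIV. X i) ^ L *s \<eta> = (\<Sum>i\<in>UNIV. X i ^ (N + L) *s g i)"
    and N: "3 * N + Suc (card S) \<le> n + 4"
  shows "\<exists>L g. (\<forall>i. g i \<in> log_der (insert b S)) \<and>
    (\<Prod>i\<in>UNIV. X i) ^ L *s \<theta> = (\<Sum>i\<in>UNIV. X i ^ (N + L) *s g i)"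
proof -
  obtain i where i: "b $ i \<noteq> 0" using b by (auto simp: vec_eq_iff)
  have "\<exists>j k. (UNIV :: 3 set) = {i, j, k} \<and> i \<noteq> j \<and> i \<noteq> k \<and> j \<noteq> k"
  proof -
    have "\<forall>i. \<exists>j k. {0, 1, 2} = {i, j, k :: 3} \<and> i \<noteq> j \<and> i \<noteq> k \<and> j \<noteq> k"
      unfolding all_index
    proof (intro conjI)
      show "\<exists>j k. {0, 1, 2} = {0, j, k :: 3} \<and> 0 \<noteq> j \<and> 0 \<noteq> k \<and> j \<noteq> k"
        by (intro exI[of _ 1] exI[of _ 2]) simp
      show "\<exists>j k. {0, 1, 2} = {1, j, k :: 3} \<and> 1 \<noteq> j \<and> 1 \<noteq> k \<and> j \<noteq> k"
        by (intro exI[of _ 0] exI[of _ 2]) auto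
      show "\<exists>j k. {0, 1, 2} = {2, j, k :: 3} \<and> 2 \<noteq> j \<and> 2 \<noteq> k \<and> j \<noteq> k"
        by (intro exI[of _ 0] exI[of _ 1]) auto
    qed
    then show ?thesis unfolding UNIV_index by blast
  qed
  then obtain j k where U: "(UNIV :: 3 set) = {i, j, k}" and ne: "i \<noteq> j" "i \<noteq> k" "j \<noteq> k" by blast
  have sum_ijk: "(\<Sum>l\<in>UNIV. f l) = f i + (f j + f k)" for f :: "3 \<Rightarrow> 'b::comm_monoid_add"
    unfolding U using ne by simp
  have prod_ijk: "(\<Prod>l\<in>UNIV. f l) = f i * (f j * f k)" for f :: "3 \<Rightarrow> 'b::comm_monoid_mult"
    unfolding U using ne by simp
  define cj ck where "cj = const (- b $ j / b $ i)" and "ck = const (- b $ k / b $ i)"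
  \<comment> \<open>The value of x_i on the line b, so that X i - y is a multiple of the equation of
    b.\<close>
  define y where "y = cj * X j + ck * X k"
  obtain A B where AB: "y ^ (N + N) = (cj * X j) ^ N * A + (ck * X k) ^ N * B"
    unfolding y_def using binomial_two_powers by blast
  \<comment> \<open>The cofactor of X i - y in the factorization of X i^(2N) - y^(2N).\<close>
  define C where "C = (\<Sum>l<N + N. y ^ (N + N - Suc l) * X i ^ l)"
  have xy: "X i - y = const (inverse (b $ i)) * linear_form b"
  proof (rule ev_eqI)
    fix q show "ev (X i - y) q = ev (const (inverse (b $ i)) * linear_form b) q"
      using i by (simp add: y_def cj_def ck_def ev_simps dot_def sum_ijk field_simps)
  qed
  have Xi: "X i ^ (N + N) = (cj * X j) ^ N * A + (ck * X k) ^ N * B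
      + linear_form b * (const (inverse (b $ i)) * C)"
    using power_diff_sumr2[of "X i" "N + N" y] unfolding xy AB C_def
    by (simp add: algebra_simps)
  have "homogeneous 1 y"
    unfolding y_def cj_def ck_def by (intro homogeneous_add homogeneous_const_mult homogeneous_X)
  have C: "homogeneous (N + N - 1) C"
    unfolding C_def
  proof (rule homogeneous_sum)
    fix l assume "l \<in> {..<N + N}"
    then show "homogeneous (N + N - 1) (y ^ (N + N - Suc l) * X i ^ l)"
      using homogeneous_mult[OF homogeneous_power[OF \<open>homogeneous 1 y\<close>] homogeneous_X_power[of l i],
          of "N + N - Suc l"] by simp
  qed
  \<comment> \<open>\<theta> and its denominator are enlarged by (x_0 x_1 x_2)^(2N); E is the
    resulting cofactor of b. For positive N it has degree 6N - 1, so E \<theta> / (x_0 x_1 x_2)^(3N)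
    has degree one less than the class of \<theta>, matching one line less.\<close>
  define E where "E = const (inverse (b $ i)) * C * (X j ^ (N + N) * X k ^ (N + N))"
  have "homogeneous ((N + N - 1) + ((N + N) + (N + N))) E"
    unfolding E_def by (intro homogeneous_mult homogeneous_const_mult C homogeneous_X_power)
  then have "homv ((N + N - 1) + ((N + N) + (N + N)) + n) (E *s \<theta>)"
    using homv_scale \<theta>(2) by blast
  moreover have "E *s \<theta> \<in> log_der S"
    using \<theta>(1) by (simp add: log_der_insert log_der_scale)
  moreover have "3 * (3 * N) + card S \<le> ((N + N - 1) + ((N + N) + (N + N)) + n) + 4"
    using N by arith
  ultimately obtain L h where h: "\<And>l. h l \<in> log_der S"
    "(\<Prod>l\<in>UNIV. X l) ^ L *s (E *s \<theta>) = (\<Sum>l\<in>UNIV. X l ^ (3 * N + L) *s h l)"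
    using IH by blast
  \<comment> \<open>These collect the terms of X i^(2N) containing X j^N or X k^N.\<close>
  define p where "p l = (if l = j then X i ^ L * X k ^ (L + (N + N)) * cj ^ N * A
    else if l = k then X i ^ L * X j ^ (L + (N + N)) * ck ^ N * B else 0)" for l
  define g where "g l = linear_form b *s h l + p l *s \<theta>" for l
  have "g l \<in> log_der (insert b S)" for l
    unfolding g_def by (intro log_der_add log_der_scale log_der_linear_form_scale h \<theta>)
  moreover have "(\<Prod>l\<in>UNIV. X l) ^ (L + (N + N)) *s \<theta> = (\<Sum>l\<in>UNIV. X l ^ (N + (L + (N + N))) *s g l)"
  proof -
    have "(\<Prod>l\<in>UNIV. X l) ^ (L + (N + N)) =
        (\<Prod>l\<in>UNIV. X l) ^ L * (X j ^ (N + N) * X k ^ (N + N)) * X i ^ (N + N)"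
      by (simp add: prod_ijk power_add power_mult_distrib ac_simps)
    also have "\<dots> = (\<Prod>l\<in>UNIV. X l) ^ L * (X j ^ (N + N) * X k ^ (N + N)) * ((cj * X j) ^ N * A + (ck * X k) ^ N * B)
      + linear_form b * ((\<Prod>l\<in>UNIV. X l) ^ L * E)"
      unfolding Xi E_def by (simp add: algebra_simps)
    also have "(\<Prod>l\<in>UNIV. X l) ^ L * (X j ^ (N + N) * X k ^ (N + N)) * ((cj * X j) ^ N * A + (ck * X k) ^ N * B)
      = X j ^ (N + (L + (N + N))) * p j + X k ^ (N + (L + (N + N))) * p k"
      using ne by (simp add: p_def prod_ijk power_add power_mult_distrib algebra_simps)
    finally have "(\<Prod>l\<in>UNIV. X l) ^ (L + (N + N)) *s \<theta> =
      (X j ^ (N + (L + (N + N))) * p j + X k ^ (N + (L + (N + N))) * p k) *s \<theta>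
      + linear_form b *s ((\<Prod>l\<in>UNIV. X l) ^ L *s (E *s \<theta>))"
      by (simp add: vector_sadd_rdistrib vector_smult_assoc)
    also have "(\<Prod>l\<in>UNIV. X l) ^ L *s (E *s \<theta>) = (\<Sum>l\<in>UNIV. X l ^ (N + (L + (N + N))) *s h l)"
    proof -
      have "3 * N + L = N + (L + (N + N))" by simp
      then show ?thesis using h(2) by (simp only:)
    qed
    finally show ?thesis
      using ne by (simp add: sum_ijk g_def p_def vec_eq_iff) (simp add: algebra_simps)
  qed
  ultimately show ?thesis by blast
qed

text \<open>The identity says that \<theta> / (x_0 x_1 x_2)^N is a boundary, with L the growth of
  the denominator. In the degree m = n - 3N the hypothesis reads m >= card S - 4. The g i carry no
  degrees yet.\<close>

theorem log_der_second:
  fixes \<theta> :: "'k::field_char_0 poly3 ^ 3"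
  assumes S: "finite S" "independent_lines S" "\<not> (\<exists>p. p \<noteq> 0 \<and> (\<forall>a\<in>S. dot a p = 0))"
    and "\<theta> \<in> log_der S" "homv n \<theta>" "3 * N + card S \<le> n + 4"
  shows "\<exists>L g. (\<forall>i. g i \<in> log_der S) \<and> (\<Prod>i\<in>UNIV. X i) ^ L *s \<theta> = (\<Sum>i\<in>UNIV. X i ^ (N + L) *s g i)"
proof -
  obtain a b c where abc: "a \<in> S" "b \<in> S" "c \<in> S" "dot a (cr b c) \<noteq> 0"
    using noncollinear_triple S(2,3) by blast
  let ?T = "{a, b, c}"
  have "\<forall>n N \<theta>. \<theta> \<in> log_der (?T \<union> U) \<longrightarrow> homv n \<theta> \<longrightarrow> 3 * N + card (?T \<union> U) \<le> n + 4 \<longrightarrow>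
    (\<exists>L g. (\<forall>i. g i \<in> log_der (?T \<union> U)) \<and> (\<Prod>i\<in>UNIV. X i) ^ L *s \<theta> = (\<Sum>i\<in>UNIV. X i ^ (N + L) *s g i))"
    if "finite U" "U \<subseteq> S - ?T" for U
    using that
  proof (induction U rule: finite_induct)
    case empty
    have "a \<noteq> b" "a \<noteq> c" "b \<noteq> c" using abc(4) by auto
    then have card: "card ?T = 3" by simp
    have ind: "independent_lines ?T"
      by (rule independent_lines_subset[OF S(2)]) (use abc in simp)
    show ?case
    proof (intro allI impI)
      fix n N and \<theta> :: "'k poly3 ^ 3"
      assume "\<theta> \<in> log_der (?T \<union> {})" "homv n \<theta>" "3 * N + card (?T \<union> {}) \<le> n + 4"
      then obtain g where "\<forall>i. g i \<in> log_der ?T" "\<theta> = (\<Sum>i\<in>UNIV. X i ^ N *s g i)"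
        using log_der_triple_second[OF abc(4) ind, of \<theta> n N] card by auto
      then show "\<exists>L g. (\<forall>i. g i \<in> log_der (?T \<union> {})) \<and>
          (\<Prod>i\<in>UNIV. X i) ^ L *s \<theta> = (\<Sum>i\<in>UNIV. X i ^ (N + L) *s g i)"
        by (intro exI[of _ 0] exI[of _ g]) simp
    qed
  next
    case (insert d U)
    have "d \<noteq> 0" using insert.prems S(2) by (auto simp: independent_lines_def)
    have card: "card (?T \<union> insert d U) = Suc (card (?T \<union> U))"
      using insert.hyps insert.prems by simp
    have eq: "?T \<union> insert d U = insert d (?T \<union> U)" by auto
    have IH: "\<exists>L g. (\<forall>i. g i \<in> log_der (?T \<union> U)) \<and>
        (\<Prod>i\<in>UNIV. X i) ^ L *s \<eta> = (\<Sum>i\<in>UNIV. X i ^ (N + L) *s g i)"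
      if "\<eta> \<in> log_der (?T \<union> U)" "homv n \<eta>" "3 * N + card (?T \<union> U) \<le> n + 4" for \<eta> n N
      using insert.IH insert.prems that by simp
    show ?case
      unfolding card unfolding eq
      using log_der_second_step[OF \<open>d \<noteq> 0\<close> _ _ IH] by simp
  qed
  note extend = this[of "S - ?T"]
  have "\<forall>n N \<theta>. \<theta> \<in> log_der S \<longrightarrow> homv n \<theta> \<longrightarrow> 3 * N + card S \<le> n + 4 \<longrightarrow>
    (\<exists>L g. (\<forall>i. g i \<in> log_der S) \<and> (\<Prod>i\<in>UNIV. X i) ^ L *s \<theta> = (\<Sum>i\<in>UNIV. X i ^ (N + L) *s g i))"
  proof -
    have "?T \<union> (S - ?T) = S" using abc by auto
    then show ?thesis using extend S(1) by simp
  qed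
  then show ?thesis using assms(4-) by blast
qed

section \<open>Nonvanishing classes\<close>

lemma log_der_dvd:
  assumes "independent_lines S" "a \<in> S" "\<theta> \<in> log_der S"
  shows "linear_form a dvd dot (cvec a) \<theta>"
  using assms by (intro linear_form_dvdI) (auto simp: independent_lines_def log_der_def ev_dot)

lemma prod_X_power:
  "(\<Prod>i\<in>UNIV. X i) ^ M = Poly_Mapping.single (\<Sum>i\<in>UNIV. Poly_Mapping.single i M) (1 :: 'k::field_char_0)"
proof -
  have "(\<Prod>i\<in>UNIV. X i ^ M) = Poly_Mapping.single (\<Sum>i\<in>UNIV. Poly_Mapping.single i M) (1 :: 'k)"
    by (subst monomial_eq_X) (simp add: lookup_sum lookup_single when_def)
  then show ?thesis by (simp add: prod_power_distrib)
qed

text \<open>The map \<open>\<theta> \<mapsto> s\<cdot>\<theta> / s - r\<cdot>\<theta> / r\<close> sends \<open>D\<^sub>0\<close> to \<open>R(-1)\<close>; the class \<open>1 / (x\<^sub>0x\<^sub>1x\<^sub>2)\<close> in the second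
  cohomology of the latter is hit by a multiple of \<open>Q\<close> in a direction lying in r but not in s.\<close>

theorem D0_second_nonzero:
  fixes S :: "('k::field_char_0 ^ 3) set"
  assumes S: "finite S" "independent_lines S" and rs: "r \<in> S" "s \<in> S" "r \<noteq> s"
  obtains \<theta> n N where "\<theta> \<in> D0 (\<Prod>a\<in>S. linear_form a)" "homv n \<theta>" "n + 2 = 3 * N"
    "\<forall>L g. (\<forall>i. g i \<in> log_der S) \<longrightarrow> (\<Prod>i\<in>UNIV. X i) ^ L *s \<theta> \<noteq> (\<Sum>i\<in>UNIV. X i ^ (N + L) *s g i)"
proof -
  define Q where "Q = (\<Prod>a\<in>S. linear_form a)"
  define Qs where "Qs = (\<Prod>a\<in>S - {s}. linear_form a)"
  have Q: "Q = linear_form s * Qs" unfolding Q_def Qs_def by (rule prod.remove[OF S(1) rs(2)])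
  have nz: "linear_form r \<noteq> 0" "linear_form s \<noteq> 0"
    using S(2) rs by (auto simp: independent_lines_def)
  have "Qs \<noteq> 0" using S by (auto simp: Qs_def independent_lines_def)
  then obtain \<mu> where \<mu>: "\<mu> \<in> Poly_Mapping.keys Qs" by fastforce
  define M where "M = card (S - {s})"
  have card: "card S = Suc M" unfolding M_def by (rule card_Suc_Diff1[OF S(1) rs(2), symmetric])
  have deg: "mdeg \<mu> = M"
    using \<mu> homogeneous_prod_linear_form[of "S - {s}"] unfolding homogeneous_iff Qs_def M_def by blast
  define full where "full K = (\<Sum>i\<in>UNIV. Poly_Mapping.single (i :: 3) K)" for K :: nat
  have full: "Poly_Mapping.lookup (full K) i = K" for K i
    by (simp add: full_def lookup_sum lookup_single when_def)
  have le: "Poly_Mapping.lookup \<mu> i \<le> M" for i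
    using deg member_le_sum[of i UNIV "Poly_Mapping.lookup \<mu>"] by (simp add: mdeg_def)
  have \<nu>: "full M - \<mu> + \<mu> = full M"
    using le by (intro poly_mapping_eqI) (simp add: lookup_add lookup_minus full)
  have "mdeg (full M - \<mu>) + M = 3 * M"
    using arg_cong[OF \<nu>, of mdeg] unfolding mdeg_add deg by (simp add: mdeg_def[of "full M"] full)
  then have deg\<nu>: "mdeg (full M - \<mu>) = 2 * M" by simp
  \<comment> \<open>F completes a monomial of Qs to (x_0 x_1 x_2)^M, so F Qs / (x_0 x_1 x_2)^(M + 1)
    has a nonzero coefficient at 1 / (x_0 x_1 x_2).\<close>
  define F where "F = Poly_Mapping.single (full M - \<mu>) (1 :: 'k)"
  have F: "homogeneous (2 * M) F" by (simp add: F_def homogeneous_iff deg\<nu>)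
  have coeff: "Poly_Mapping.lookup (F * Qs) (full M) \<noteq> 0"
    using lookup_monomial_mult[of "full M - \<mu>" 1 Qs \<mu>] \<mu> unfolding \<nu> F_def by (simp add: in_keys_iff)
  have "cr r s \<noteq> 0" "r \<noteq> 0" using S(2) rs by (auto simp: independent_lines_def)
  then have "cr s r \<noteq> 0" using cr_skew[of r s] by auto
  then obtain u v where uv: "cr u v = r" "dot s v \<noteq> 0"
    using plane_basis[OF \<open>r \<noteq> 0\<close>, of "{s}"] by auto
  define w where "w = inverse (dot s v) *s v"
  have w: "dot s w = 1" "dot r w = 0" using uv by (auto simp: w_def dot_scale)
  \<comment> \<open>The factor Q makes any constant direction logarithmic. As w lies in r and s.w =
    1, only the quotient by s sees F Qs.\<close>
  define \<theta>0 where "\<theta>0 = (F * Q) *s cvec w"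
  have "homv (2 * M + Suc M + 0) \<theta>0"
    unfolding \<theta>0_def Q_def card[symmetric]
    by (intro homv_scale homogeneous_mult F homogeneous_prod_linear_form homv_cvec)
  then have "homv (2 * M + Suc M) \<theta>0" by simp
  moreover have "\<theta>0 \<in> log_der S"
    unfolding log_der_def
  proof (intro CollectI ballI allI impI)
    fix a q assume "a \<in> S" "dot a q = 0"
    then have "ev Q q = 0" using S(1) by (auto simp: Q_def ev_prod)
    then show "dot a (evv \<theta>0 q) = 0" by (simp add: \<theta>0_def evv_scale dot_scale ev_mult)
  qed
  moreover have "S \<noteq> {}" using rs by auto
  ultimately obtain \<rho> where \<rho>: "\<theta>0 - \<rho> *s Xvec \<in> D0 Q" "homv (2 * M + Suc M) (\<theta>0 - \<rho> *s Xvec)"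
    using log_der_euler_split[OF S] unfolding Q_def by metis
  have degree: "2 * M + Suc M + 2 = 3 * Suc M" by simp
  show ?thesis
  proof (rule that[OF \<rho>(1)[unfolded Q_def] \<rho>(2) degree], intro allI impI)
    fix L and g :: "3 \<Rightarrow> 'k poly3 ^ 3" assume "\<forall>i. g i \<in> log_der S"
    then have g: "\<And>i. g i \<in> log_der S" by blast
    show "(\<Prod>i\<in>UNIV. X i) ^ L *s (\<theta>0 - \<rho> *s Xvec) \<noteq> (\<Sum>i\<in>UNIV. X i ^ (Suc M + L) *s g i)"
    proof (rule notI)
      assume eq: "(\<Prod>i\<in>UNIV. X i) ^ L *s (\<theta>0 - \<rho> *s Xvec) = (\<Sum>i\<in>UNIV. X i ^ (Suc M + L) *s g i)"
      \<comment> \<open>The Euler correction \<rho> enters the quotients by r and by s alike and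
        cancels in their difference.\<close>
      have quot: "\<exists>h. (\<Prod>i\<in>UNIV. X i) ^ L * (p - \<rho>) = (\<Sum>i\<in>UNIV. X i ^ (Suc M + L) * h i)"
        if a: "a \<in> S" "linear_form a \<noteq> 0" "dot (cvec a) \<theta>0 = linear_form a * p" for a p
      proof -
        have "\<forall>i. \<exists>h. dot (cvec a) (g i) = linear_form a * h"
          using log_der_dvd[OF S(2) a(1) g] by (auto elim: dvdE)
        then obtain h where h: "\<And>i. dot (cvec a) (g i) = linear_form a * h i" by metis
        have "linear_form a * ((\<Prod>i\<in>UNIV. X i) ^ L * (p - \<rho>)) = dot (cvec a) ((\<Prod>i\<in>UNIV. X i) ^ L *s (\<theta>0 - \<rho> *s Xvec))"
          by (simp add: dot_scale dot_diff a(3) algebra_simps flip: linear_form_eq_dot)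
        also have "\<dots> = linear_form a * (\<Sum>i\<in>UNIV. X i ^ (Suc M + L) * h i)"
          unfolding eq by (simp add: sum_index dot_add dot_scale h algebra_simps)
        finally show ?thesis using a(2) by auto
      qed
      have "dot (cvec s) \<theta>0 = linear_form s * (F * Qs)" "dot (cvec r) \<theta>0 = linear_form r * 0"
        using w by (simp_all add: \<theta>0_def dot_scale dot_cvec Q)
      from quot[OF rs(2) nz(2) this(1)] quot[OF rs(1) nz(1) this(2)] obtain h k where
        h: "(\<Prod>i\<in>UNIV. X i) ^ L * (F * Qs - \<rho>) = (\<Sum>i\<in>UNIV. X i ^ (Suc M + L) * h i)" and
        k: "(\<Prod>i\<in>UNIV. X i) ^ L * (0 - \<rho>) = (\<Sum>i\<in>UNIV. X i ^ (Suc M + L) * k i)" by blast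
      have "(\<Prod>i\<in>UNIV. X i) ^ L * (F * Qs) = (\<Prod>i\<in>UNIV. X i) ^ L * (F * Qs - \<rho>) - (\<Prod>i\<in>UNIV. X i) ^ L * (0 - \<rho>)"
        by (simp add: algebra_simps)
      also have "\<dots> = (\<Sum>i\<in>UNIV. X i ^ (Suc M + L) * (h i - k i))"
        unfolding h k by (simp add: sum_subtractf right_diff_distrib)
      finally have sum: "(\<Prod>i\<in>UNIV. X i) ^ L * (F * Qs) = (\<Sum>i\<in>UNIV. X i ^ (Suc M + L) * (h i - k i))" .
      have "Poly_Mapping.lookup ((\<Prod>i\<in>UNIV. X i) ^ L * (F * Qs)) (full L + full M)
          = Poly_Mapping.lookup (F * Qs) (full M)"
        unfolding prod_X_power full_def[symmetric] by (simp add: lookup_monomial_mult)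
      \<comment> \<open>All exponents of this monomial equal L + M, one short of the power of
        x_i.\<close>
      moreover have "Poly_Mapping.lookup (X i ^ (Suc M + L) * (h i - k i)) (full L + full M) = 0" for i
        by (rule lookup_X_power_mult_zero) (simp add: lookup_add full)
      ultimately show False using coeff unfolding sum lookup_sum by simp
    qed
  qed
qed

section \<open>Generic arrangements: a class in the first cohomology\<close>

lemma collinear_of_cr_zero:
  fixes w :: "'a::field ^ 3"
  assumes "w \<noteq> 0" "cr a w = 0"
  obtains k where "a = k *s w"
proof -
  obtain i where i: "w $ i \<noteq> 0" using \<open>w \<noteq> 0\<close> by (auto simp: vec_eq_iff)
  have "a = (a $ i / w $ i) *s w"
    using cr_eq_zeroD[OF assms(2), of i] i by (simp add: vec_eq_iff field_simps)
  then show ?thesis using that by blast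
qed

text \<open>Two distinct planes through the origin meet in a one-dimensional space, which contains
  both q and x.\<close>

lemma cr_zero_of_common_orthogonal:
  fixes a :: "'a::field ^ 3"
  assumes "cr a c \<noteq> 0" "dot a q = 0" "dot c q = 0" "dot a x = 0" "dot c x = 0"
  shows "cr q x = 0"
proof (rule ccontr)
  assume ne: "cr q x \<noteq> 0"
  have "cr a (cr q x) = 0" "cr c (cr q x) = 0" using assms by (simp_all add: cr_cr)
  then obtain k l where "a = k *s cr q x" "c = l *s cr q x"
    using collinear_of_cr_zero[OF ne] by metis
  moreover have "cr (k *s w) (l *s w) = 0" for w
    by (simp add: vec3_eq_iff algebra_simps)
  ultimately show False using assms(1) by metis
qed

lemma det_nonzero_common_zero:
  fixes a :: "'a::field ^ 3"
  assumes "dot a (cr b c) \<noteq> 0" "dot a q = 0" "dot b q = 0" "dot c q = 0"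
  shows "q = 0"
proof -
  have "dot a (cr b c) *s q = 0" using dot_dual_basis[of a b c q] assms by simp
  then show ?thesis using assms(1) by (simp add: vec_eq_iff)
qed

definition generic_lines :: "('k::field_char_0 ^ 3) set \<Rightarrow> bool" where
  "generic_lines S \<longleftrightarrow> (\<forall>a\<in>S. \<forall>b\<in>S. \<forall>c\<in>S. a \<noteq> b \<longrightarrow> a \<noteq> c \<longrightarrow> b \<noteq> c \<longrightarrow> dot a (cr b c) \<noteq> 0)"

lemma generic_linesD:
  "generic_lines S \<Longrightarrow> a \<in> S \<Longrightarrow> b \<in> S \<Longrightarrow> c \<in> S \<Longrightarrow> a \<noteq> b \<Longrightarrow> a \<noteq> c \<Longrightarrow> b \<noteq> c \<Longrightarrow>
    dot a q = 0 \<Longrightarrow> dot b q = 0 \<Longrightarrow> dot c q = 0 \<Longrightarrow> q = 0"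
  unfolding generic_lines_def using det_nonzero_common_zero by blast

text \<open>On the line b the cross product of the point with \<open>h\<close> has degree \<open>m + 1\<close> and vanishes at the
  intersections with all lines of the arrangement other than a; there are \<open>card S - 2\<close> of these.\<close>

lemma generic_radial:
  fixes S :: "('k::field_char_0 ^ 3) set"
  assumes S: "finite S" "independent_lines S" "generic_lines S" "m + 4 \<le> card S"
    and ab: "a \<in> S" "b \<in> S" "a \<noteq> b" and h: "h \<in> log_der (S - {a})" "homv m h"
    and q: "dot b q = 0"
  shows "cr q (evv h q) = 0"
proof -
  have b0: "b \<noteq> 0" and cb: "\<And>c. c \<in> S - {b} \<Longrightarrow> cr c b \<noteq> 0"
    using S(2) ab by (auto simp: independent_lines_def)
  obtain u v where uv: "cr u v = b" "\<And>c. c \<in> S - {b} \<Longrightarrow> dot c v \<noteq> 0"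
    using plane_basis[OF b0, of "S - {b}"] cb S(1) by auto
  define \<tau> where "\<tau> c = - dot c u / dot c v" for c
  have root: "dot c (u + \<tau> c *s v) = 0" if "c \<in> S - {b}" for c
    using uv(2)[OF that] by (simp add: \<tau>_def dot_add dot_scale)
  have on_b: "dot b (u + t *s v) = 0" for t
    by (simp add: dot_add dot_scale flip: uv(1))
  let ?T = "S - {a} - {b}"
  \<comment> \<open>Two lines through the same point of b would give three concurrent lines.\<close>
  have "inj_on \<tau> ?T"
  proof (rule inj_onI, rule ccontr)
    fix c d assume cd: "c \<in> ?T" "d \<in> ?T" "\<tau> c = \<tau> d" "c \<noteq> d"
    then have "u + \<tau> c *s v = 0"
      using generic_linesD[OF S(3), of c d b "u + \<tau> c *s v"] root[of c] root[of d] on_b ab by auto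
    then show False using point_on_line_nonzero[OF uv(1) b0] by blast
  qed
  then have card: "card (\<tau> ` ?T) = card S - 2"
    using S(1) ab by (simp add: card_image card_Diff_singleton)
  have hom: "homogeneous (1 + m) (cr Xvec h $ i)" for i
  proof -
    have "homogeneous (1 + m) (X j * h $ k)" for j k
      using h(2) by (intro homogeneous_mult) (simp_all add: homv_def)
    then have "\<forall>i. homogeneous (1 + m) (cr Xvec h $ i)"
      unfolding all_index by (simp add: Xvec_def homogeneous_diff)
    then show ?thesis by blast
  qed
  have "rest u v (cr Xvec h $ i) = 0" for i
  proof (rule ccontr)
    assume ne: "rest u v (cr Xvec h $ i) \<noteq> 0"
    have "\<tau> ` ?T \<subseteq> {t. poly (rest u v (cr Xvec h $ i)) t = 0}"
    proof safe
      fix c assume c: "c \<in> S" "c \<noteq> a" "c \<noteq> b"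
      let ?q = "u + \<tau> c *s v"
      have "dot c ?q = 0" "dot b ?q = 0" using root[of c] c on_b by auto
      \<comment> \<open>Tangency to two lines leaves only the radial direction at their meeting
        point.\<close>
      moreover have "dot c (evv h ?q) = 0" "dot b (evv h ?q) = 0"
        using h(1) c ab calculation by (auto simp: log_der_def)
      ultimately have "evv (cr Xvec h) ?q = 0"
        using cr_zero_of_common_orthogonal[OF cb, of c] c by (simp add: evv_cr)
      then show "poly (rest u v (cr Xvec h $ i)) (\<tau> c) = 0"
        by (simp add: poly_rest evv_def vec_eq_iff)
    qed
    then have "card (\<tau> ` ?T) \<le> card {t. poly (rest u v (cr Xvec h $ i)) t = 0}"
      using poly_roots_finite[OF ne] by (rule card_mono[rotated])
    also have "\<dots> \<le> Polynomial.degree (rest u v (cr Xvec h $ i))"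
      by (rule card_poly_roots_bound[OF ne])
    also have "\<dots> \<le> 1 + m" using degree_rest hom by blast
    finally show False using card S(4) by simp
  qed
  then have "ev (cr Xvec h $ i) q = 0" for i
    using vanish_on_plane[OF hom b0 uv(1)] q by blast
  then have "evv (cr Xvec h) q = 0" by (simp add: evv_def vec_eq_iff)
  then show ?thesis by (simp add: evv_cr)
qed

text \<open>Here G = x_i^m Q / a. The f j / x_j^N are local preimages of G under \<theta> \<mapsto>
  \<theta>(Q), whose kernel is \<open>D0\<close>; without a global preimage their differences form a
  nontrivial cocycle of \<open>D0\<close>.\<close>

theorem generic_first_nonzero:
  fixes S :: "('k::field_char_0 ^ 3) set"
  assumes S: "finite S" "independent_lines S" "generic_lines S" "m + 4 \<le> card S"
  obtains f G N where "\<forall>j. homv (m + N) (f j)"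
    "\<forall>j. derivation (f j) (\<Prod>a\<in>S. linear_form a) = X j ^ N * G"
    "\<forall>h. homv m h \<longrightarrow> derivation h (\<Prod>a\<in>S. linear_form a) \<noteq> G"
proof -
  define Q where "Q = (\<Prod>a\<in>S. linear_form a)"
  have "\<exists>a\<in>S. \<exists>b\<in>S. a \<noteq> b"
  proof (rule ccontr)
    assume "\<not> ?thesis"
    then have "card S \<le> 1" using card_le_Suc0_iff_eq[OF S(1)] by auto
    then show False using S(4) by simp
  qed
  then obtain a b where ab: "a \<in> S" "b \<in> S" "a \<noteq> b" by blast
  define S' where "S' = S - {a}"
  define Qa where "Qa = (\<Prod>c\<in>S'. linear_form c)"
  have Q: "Q = linear_form a * Qa" unfolding Q_def Qa_def S'_def by (rule prod.remove[OF S(1) ab(1)])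
  have S': "finite S'" "independent_lines S'" "S' \<subseteq> S" "card S' + 1 = card S"
    using S independent_lines_subset[OF S(2), of S'] card_Suc_Diff1[OF S(1) ab(1)] by (auto simp: S'_def)
  have a0: "a \<noteq> 0" and ca: "\<And>c. c \<in> S' \<Longrightarrow> cr c a \<noteq> 0"
    using S(2) ab by (auto simp: S'_def independent_lines_def)
  obtain u v where uv: "cr u v = a" "\<And>c. c \<in> S' \<Longrightarrow> dot c v \<noteq> 0"
    using plane_basis[OF a0 S'(1) ca] by metis
  have on_a: "dot a (u + t *s v) = 0" for t
    by (simp add: dot_add dot_scale flip: uv(1))
  have "cr a b \<noteq> 0" using S(2) ab by (auto simp: independent_lines_def)
  \<comment> \<open>x_i must be nonzero where a and b meet, the point at which the contradiction
    appears.\<close>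
  then obtain i where i: "cr a b $ i \<noteq> 0" by (metis vec_eq_iff zero_index)
  \<comment> \<open>Large enough for the degree condition of
    \<open>log_der_with_restriction\<close>, and to make m + N positive.\<close>
  define N where "N = card S"
  define G where "G = X i ^ m * Qa"
  have "\<exists>f. homv (m + N) f \<and> derivation f Q = X j ^ N * G" for j
  proof -
    have hom: "homogeneous (m + N) (X j ^ N * X i ^ m)"
      using homogeneous_mult[OF homogeneous_X_power[of N j] homogeneous_X_power[of m i]]
      by (simp add: add.commute)
    \<comment> \<open>By genericity at most one other line passes through a point of a, so the
      divisibility conditions on the restriction are void.\<close>
    have "card {c \<in> S'. dot c (u + t *s v) = 0} - 1 = 0" for t
    proof -
      have "c = d" if "c \<in> S'" "d \<in> S'" "dot c (u + t *s v) = 0" "dot d (u + t *s v) = 0" for c d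
      proof (rule ccontr)
        assume "c \<noteq> d"
        then have "u + t *s v = 0"
          using generic_linesD[OF S(3), of c d a "u + t *s v"] that on_a ab by (auto simp: S'_def)
        then show False using point_on_line_nonzero[OF uv(1) a0] by blast
      qed
      then have "card {c \<in> S'. dot c (u + t *s v) = 0} \<le> Suc 0"
        using S'(1) by (subst card_le_Suc0_iff_eq) auto
      then show ?thesis by simp
    qed
    then have "[:- t, 1:] ^ (card {c \<in> S'. dot c (u + t *s v) = 0} - 1) dvd rest u v (X j ^ N * X i ^ m)" for t
      by simp
    moreover have "card S' \<le> m + N + 2" using S'(4) by (simp add: N_def)
    ultimately obtain \<theta> where \<theta>: "\<theta> \<in> log_der S'" "homv (m + N) \<theta>"
      "rest u v (dot (cvec a) \<theta>) = rest u v (X j ^ N * X i ^ m)"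
      using log_der_with_restriction[OF a0 uv(1) S'(1,2) uv(2) degree_rest[OF hom]] by blast
    have hom': "homogeneous (m + N) (dot (cvec a) \<theta> - X j ^ N * X i ^ m)"
      by (intro homogeneous_diff homogeneous_dot_cvec \<theta> hom)
    have "ev (dot (cvec a) \<theta> - X j ^ N * X i ^ m) q = 0" if "dot a q = 0" for q
      using vanish_on_plane[OF hom' a0 uv(1)] \<theta>(3) that by (simp add: rest_diff)
    then have "linear_form a dvd dot (cvec a) \<theta> - X j ^ N * X i ^ m"
      by (rule linear_form_dvdI[OF a0])
    then obtain k where k: "dot (cvec a) \<theta> - X j ^ N * X i ^ m = linear_form a * k"
      by (rule dvdE)
    have k': "homogeneous (m + N - 1) k"
      using homogeneous_factor(1)[OF homogeneous_linear_form(1) hom' k] a0 by simp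
    obtain h where h: "\<And>c. c \<in> S' \<Longrightarrow> dot (cvec c) \<theta> = linear_form c * h c"
      "\<And>c. c \<in> S' \<Longrightarrow> homogeneous (m + N - 1) (h c)"
      using log_der_factors[OF S'(2) \<theta>(1,2)] by metis
    \<comment> \<open>\<theta>(Q) exceeds X j^N G by (k + sum of the h c) Q; subtracting \<rho> E
      removes this multiple of Q.\<close>
    define \<rho> where "\<rho> = const (inverse (of_nat (card S))) * (k + (\<Sum>c\<in>S'. h c))"
    have "const (of_nat (card S)) * \<rho> = k + (\<Sum>c\<in>S'. h c)"
    proof -
      have "const (of_nat (card S)) * const (inverse (of_nat (card S))) = (1 :: 'k poly3)"
        using S(4) by (auto simp: mult_single simp del: single_of_nat)
      then show ?thesis by (simp only: \<rho>_def mult.assoc[symmetric] mult_1_left)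
    qed
    moreover have "derivation \<theta> Q = X j ^ N * G + (k + (\<Sum>c\<in>S'. h c)) * Q"
    proof -
      have "derivation \<theta> Q = dot (cvec a) \<theta> * Qa + (\<Sum>c\<in>S'. dot (cvec c) \<theta> * (\<Prod>d\<in>S - {c}. linear_form d))"
        unfolding Q_def Qa_def S'_def derivation_prod[OF S(1)] by (rule sum.remove[OF S(1) ab(1)])
      also have "(\<Sum>c\<in>S'. dot (cvec c) \<theta> * (\<Prod>d\<in>S - {c}. linear_form d)) = (\<Sum>c\<in>S'. h c * Q)"
      proof (rule sum.cong)
        fix c assume c: "c \<in> S'"
        then have "Q = linear_form c * (\<Prod>d\<in>S - {c}. linear_form d)"
          unfolding Q_def using S'(3) by (intro prod.remove[OF S(1)]) auto
        then show "dot (cvec c) \<theta> * (\<Prod>d\<in>S - {c}. linear_form d) = h c * Q"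
          by (simp add: h(1)[OF c] ac_simps)
      qed simp
      also have "dot (cvec a) \<theta> = X j ^ N * X i ^ m + linear_form a * k"
        using k by (simp add: diff_eq_eq)
      finally have "derivation \<theta> Q = (X j ^ N * X i ^ m + linear_form a * k) * Qa + (\<Sum>c\<in>S'. h c) * Q"
        by (simp only: sum_distrib_right)
      then show ?thesis by (simp add: G_def Q algebra_simps)
    qed
    moreover have "derivation (\<rho> *s Xvec) Q = (const (of_nat (card S)) * \<rho>) * Q"
      unfolding Q_def derivation_scale derivation_euler[OF S(1)] by (simp only: ac_simps)
    ultimately have "derivation (\<theta> - \<rho> *s Xvec) Q = X j ^ N * G"
      by (simp only: derivation_minus add_diff_cancel_right')
    moreover have "homv (m + N) (\<theta> - \<rho> *s Xvec)"
    proof (intro homv_diff \<theta> homv_euler_scale)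
      show "homogeneous (m + N - 1) \<rho>"
        unfolding \<rho>_def by (intro homogeneous_const_mult homogeneous_add homogeneous_sum h k')
      show "1 \<le> m + N" using S(4) by (simp add: N_def)
    qed
    ultimately show ?thesis by blast
  qed
  then obtain f where f: "\<forall>j. homv (m + N) (f j)" "\<forall>j. derivation (f j) Q = X j ^ N * G" by metis
  show ?thesis
  proof (rule that[OF f(1) f(2)[unfolded Q_def]], intro allI impI)
    fix h :: "'k poly3 ^ 3" assume h: "homv m h"
    show "derivation h (\<Prod>a\<in>S. linear_form a) \<noteq> G"
    proof
      assume eq: "derivation h (\<Prod>a\<in>S. linear_form a) = G"
      have "dot c (evv h q) = ev 0 q" if c: "c \<in> S'" "dot c q = 0" for c q
      proof (rule dot_on_plane_of_derivation[OF S(1,2) _ _ c(2)])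
        fix q assume "dot c q = 0"
        then have "ev Qa q = 0" using c(1) S'(1) by (auto simp: Qa_def ev_prod)
        then show "ev (derivation h (\<Prod>a\<in>S. linear_form a)) q = ev 0 q * (\<Prod>d\<in>S - {c}. dot d q)"
          by (simp add: eq G_def ev_mult)
      qed (use c S' in auto)
      then have log: "h \<in> log_der (S - {a})" by (simp add: log_der_def S'_def)
      have on_a: "dot a (evv h q) = ev (X i ^ m) q" if "dot a q = 0" for q
        by (rule dot_on_plane_of_derivation[OF S(1,2) ab(1) _ that])
          (simp add: eq G_def Qa_def S'_def ev_mult ev_prod)
      let ?q = "cr a b"
      \<comment> \<open>Where a and b meet, h would be radial, hence tangent to a; but there a.h
        equals x_i^m, which is nonzero.\<close>
      have "cr ?q (evv h ?q) = 0"
        by (rule generic_radial[OF S ab log h]) simp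
      then have "cr (evv h ?q) ?q = 0" using cr_skew[of "evv h ?q" ?q] by simp
      then obtain c where "evv h ?q = c *s ?q"
        using collinear_of_cr_zero \<open>cr a b \<noteq> 0\<close> by blast
      then have "dot a (evv h ?q) = 0" by (simp add: dot_scale)
      then show False using on_a[of ?q] i by (simp add: ev_power)
    qed
  qed
qed

section \<open>Cech cochains\<close>

lemma index_less: "(0::3) < 1" "(1::3) < 2" "(0::3) < 2"
  by (simp_all add: less_bit1_def bit1.Rep_0 bit1.Rep_1 bit1.Rep_numeral)

lemma index_below: "{i. i < (0::3)} = {}" "{i. i < (1::3)} = {0}" "{i. i < (2::3)} = {0, 1}"
proof -
  have "\<forall>i. (i < (0::3)) = False" "\<forall>i. (i < (1::3)) = (i = 0)" "\<forall>i. (i < (2::3)) = (i = 0 \<or> i = 1)"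
    unfolding all_index using index_less by auto
  then show "{i. i < (0::3)} = {}" "{i. i < (1::3)} = {0}" "{i. i < (2::3)} = {0, 1}" by auto
qed

lemma index_complement: "UNIV - {0::3} = {1, 2}" "UNIV - {1::3} = {0, 2}" "UNIV - {2::3} = {0, 1}"
  unfolding UNIV_index by auto

lemma index_subsets:
  fixes J :: "3 set"
  shows "card J = 1 \<Longrightarrow> \<exists>j. J = {j}"
    and "card J = 2 \<Longrightarrow> \<exists>j k. j < k \<and> J = {j, k}"
    and "card J = 3 \<Longrightarrow> J = UNIV"
    and "card J \<le> 3"
proof -
  show "\<exists>j. J = {j}" if "card J = 1" using that by (simp add: card_1_singleton_iff)
  show "\<exists>j k. j < k \<and> J = {j, k}" if card: "card J = 2"
  proof -
    obtain j k where "J = {j, k}" "j \<noteq> k" using card by (auto simp: card_2_iff)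
    then show ?thesis by (cases "j < k") (auto simp: insert_commute not_less_iff_gr_or_eq)
  qed
  have U: "card (UNIV :: 3 set) = 3" by simp
  show "J = UNIV" if "card J = 3"
    using card_subset_eq[of UNIV J] that U by simp
  show "card J \<le> 3" using card_mono[of UNIV J] U by simp
qed

definition fr :: "'k::field_char_0 poly3 ^ 'r \<Rightarrow> 'k poly3 \<Rightarrow> 'k poly3 fract ^ 'r" where
  "fr g f = (\<chi> j. Fract (g $ j) f)"

lemma fr_eq_iff: "f \<noteq> 0 \<Longrightarrow> f' \<noteq> 0 \<Longrightarrow> fr g f = fr g' f' \<longleftrightarrow> f' *s g = f *s g'"
  by (simp add: fr_def vec_eq_iff eq_fract mult.commute)

lemma fr_scale: "h \<noteq> 0 \<Longrightarrow> f \<noteq> 0 \<Longrightarrow> fr (h *s g) (h * f) = fr g f"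
  by (simp add: fr_eq_iff vector_smult_assoc ac_simps)

lemma fr_add: "f \<noteq> 0 \<Longrightarrow> fr g f + fr g' f = fr (g + g') f"
  by (simp add: fr_def vec_eq_iff eq_fract algebra_simps)

lemma fr_diff: "f \<noteq> 0 \<Longrightarrow> fr g f - fr g' f = fr (g - g') f"
  by (simp add: fr_def vec_eq_iff eq_fract algebra_simps)

lemma fr_zero [simp]: "fr 0 f = 0"
  by (simp add: fr_def vec_eq_iff fract_collapse)

lemma fr_eq_0_iff: "f \<noteq> 0 \<Longrightarrow> fr g f = 0 \<longleftrightarrow> g = 0"
  using fr_eq_iff[of f f g 0] by (simp add: vec_eq_iff)

lemma fr_sign: "f \<noteq> 0 \<Longrightarrow> fr ((- 1) ^ k *s g) f = (- 1) ^ k *s fr g f"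
proof -
  assume f: "f \<noteq> 0"
  have "fr (- g) f = - fr g f" using fr_diff[OF f, of 0 g] by simp
  then show ?thesis by (cases "even k") (simp_all add: vector_sneg_minus1[symmetric])
qed

lemma fr_sum: "f \<noteq> 0 \<Longrightarrow> (\<Sum>i\<in>I. fr (g i) f) = fr (\<Sum>i\<in>I. g i) f"
  by (induction I rule: infinite_finite_induct) (simp_all add: fr_add)

definition Xprod :: "3 set \<Rightarrow> 'k::field_char_0 poly3" where
  "Xprod I = (\<Prod>i\<in>I. X i)"

lemma Xprod_nonzero [simp]: "Xprod I \<noteq> 0"
  by (simp add: Xprod_def)

lemma Xprod_pair: "j \<noteq> k \<Longrightarrow> Xprod {j, k} = X j * X k"
  and Xprod_single [simp]: "Xprod {j} = X j"
  by (simp_all add: Xprod_def)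

lemma Xprod_union: "I \<subseteq> J \<Longrightarrow> Xprod J = Xprod (J - I) * Xprod I"
  unfolding Xprod_def by (rule prod.subset_diff) auto

lemma Xprod_UNIV: "Xprod UNIV = X i * Xprod (UNIV - {i})"
  unfolding Xprod_def by (rule prod.remove) auto

lemma homogeneous_Xprod: "homogeneous (card I) (Xprod I)"
  unfolding Xprod_def using homogeneous_prod[of I "\<lambda>_. 1" X] by simp

lemma homogeneous_degree_unique: "homogeneous e f \<Longrightarrow> homogeneous e' f \<Longrightarrow> f \<noteq> 0 \<Longrightarrow> e = e'"
proof -
  assume a: "homogeneous e f" "homogeneous e' f" "f \<noteq> 0"
  then obtain \<mu> where "\<mu> \<in> Poly_Mapping.keys f" by fastforce
  then show ?thesis using a(1,2) unfolding homogeneous_iff by auto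
qed

lemma D0_zero [simp]: "0 \<in> D0 Q"
  by (simp add: D0_def derivation_def)

lemma D0_sum: "(\<And>i. i \<in> I \<Longrightarrow> g i \<in> D0 Q) \<Longrightarrow> (\<Sum>i\<in>I. g i) \<in> D0 Q"
  by (induction I rule: infinite_finite_induct) (simp_all add: D0_add)

lemma homv_sign: "homv n g \<Longrightarrow> homv n ((- 1) ^ k *s g)"
  using homv_const_scale[of n g "(- 1) ^ k"]
  by (cases "even k") (simp_all add: single_uminus)

lemma sheaf_sectionsI:
  assumes "g \<in> D0 Q" "homv n g" "int n = m + int (N * card I)"
  shows "fr g (Xprod I ^ N) \<in> sheaf_sections (D0 Q) m (\<Prod>i\<in>I. X i)"
  unfolding sheaf_sections_def fr_def
  using assms homogeneous_Xprod[of I] unfolding homv_def Xprod_def by blast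

text \<open>The denominator can be taken to be any sufficiently large power, so that finitely many sections
  have a common one.\<close>

lemma sheaf_sectionsE:
  assumes "s \<in> sheaf_sections (D0 Q) m (\<Prod>i\<in>I. X i)" "I \<noteq> {}"
  shows "\<exists>N0. \<forall>N\<ge>N0. \<exists>g n. g \<in> D0 Q \<and> homv n g \<and> int n = m + int (N * card I) \<and> s = fr g (Xprod I ^ N)"
proof -
  obtain g N0 e n where raw: "s = (\<chi> j. Fract (g $ j) ((\<Prod>i\<in>I. X i) ^ N0))" "g \<in> D0 Q"
    "homogeneous e (\<Prod>i\<in>I. X i :: 'a poly3)" "\<forall>j. homogeneous n (g $ j)" "int n = m + int (N0 * e)"
    using assms(1) by (auto simp: sheaf_sections_def)
  then have g: "s = fr g (Xprod I ^ N0)" "g \<in> D0 Q" "homogeneous e (Xprod I :: 'a poly3)"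
    "homv n g" "int n = m + int (N0 * e)"
    by (simp_all add: fr_def Xprod_def homv_def)
  have e: "e = card I"
    by (rule homogeneous_degree_unique[OF g(3) homogeneous_Xprod Xprod_nonzero])
  show ?thesis
  proof (intro exI[of _ N0] allI impI)
    fix N assume "N0 \<le> N"
    then obtain k where k: "N = k + N0" by (metis add.commute le_Suc_ex)
    have "homv (k * card I + n) (Xprod I ^ k *s g)"
      by (intro homv_scale homogeneous_power homogeneous_Xprod g)
    moreover have "s = fr (Xprod I ^ k *s g) (Xprod I ^ N)"
      unfolding g(1) k power_add by (rule fr_scale[symmetric]) simp_all
    moreover have "int (k * card I + n) = m + int (N * card I)"
      using g(5) by (simp add: e k algebra_simps)
    ultimately show "\<exists>g n. g \<in> D0 Q \<and> homv n g \<and> int n = m + int (N * card I) \<and> s = fr g (Xprod I ^ N)"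
      using D0_scale[OF g(2)] by blast
  qed
qed

lemma sheaf_sections_restrict:
  assumes "s \<in> sheaf_sections (D0 Q) m (\<Prod>i\<in>I. X i)" "I \<noteq> {}" "I \<subseteq> J"
  shows "s \<in> sheaf_sections (D0 Q) m (\<Prod>i\<in>J. X i)"
proof -
  obtain N where "\<forall>N'\<ge>N. \<exists>g n. g \<in> D0 Q \<and> homv n g \<and> int n = m + int (N' * card I) \<and> s = fr g (Xprod I ^ N')"
    using sheaf_sectionsE[OF assms(1,2)] ..
  then obtain g n
    where g: "g \<in> D0 Q" "homv n g" "int n = m + int (N * card I)" "s = fr g (Xprod I ^ N)" by blast
  have "s = fr (Xprod (J - I) ^ N *s g) (Xprod J ^ N)"
    unfolding g(4) Xprod_union[OF assms(3)] power_mult_distrib by (rule fr_scale[symmetric]) simp_all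
  moreover have "homv (N * card (J - I) + n) (Xprod (J - I) ^ N *s g)"
    by (intro homv_scale homogeneous_power homogeneous_Xprod g)
  moreover have "card J = card (J - I) + card I"
    using assms(3) by (metis add.commute card_Diff_subset card_mono finite le_add_diff_inverse)
  ultimately show ?thesis
    using sheaf_sectionsI[OF D0_scale[OF g(1)]] g(3) by (simp add: algebra_simps)
qed

lemma sheaf_sections_combine:
  assumes "s \<in> sheaf_sections (D0 Q) m (\<Prod>i\<in>I. X i)" "s' \<in> sheaf_sections (D0 Q) m (\<Prod>i\<in>I. X i)" "I \<noteq> {}"
  shows "s + (- 1) ^ k *s s' \<in> sheaf_sections (D0 Q) m (\<Prod>i\<in>I. X i)"
proof -
  obtain N1 where N1: "\<forall>N\<ge>N1. \<exists>g n. g \<in> D0 Q \<and> homv n g \<and> int n = m + int (N * card I) \<and> s = fr g (Xprod I ^ N)"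
    using sheaf_sectionsE[OF assms(1,3)] ..
  obtain N2 where N2: "\<forall>N\<ge>N2. \<exists>g n. g \<in> D0 Q \<and> homv n g \<and> int n = m + int (N * card I) \<and> s' = fr g (Xprod I ^ N)"
    using sheaf_sectionsE[OF assms(2,3)] ..
  define N where "N = max N1 N2"
  obtain g n where g: "g \<in> D0 Q" "homv n g" "int n = m + int (N * card I)" "s = fr g (Xprod I ^ N)"
    using spec[OF N1, of N] by (auto simp: N_def)
  obtain g' n' where g': "g' \<in> D0 Q" "homv n' g'" "int n' = m + int (N * card I)" "s' = fr g' (Xprod I ^ N)"
    using spec[OF N2, of N] by (auto simp: N_def)
  have "n' = n" using g(3) g'(3) by simp
  then have "homv n (g + (- 1) ^ k *s g')" using g(2) g'(2) homv_add homv_sign by blast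
  moreover have "s + (- 1) ^ k *s s' = fr (g + (- 1) ^ k *s g') (Xprod I ^ N)"
    unfolding g(4) g'(4) by (simp add: fr_sign[symmetric] fr_add)
  ultimately show ?thesis
    using sheaf_sectionsI[OF D0_add[OF g(1) D0_scale[OF g'(1)]]] g(3) by simp
qed

lemma sheaf_sections_zero:
  assumes "I \<noteq> {}"
  shows "0 \<in> sheaf_sections (D0 Q) m (\<Prod>i\<in>I. X i)"
proof -
  have "1 \<le> card I" using assms by (simp add: Suc_le_eq card_gt_0_iff)
  then have "int (nat \<bar>m\<bar>) * 1 \<le> int (nat \<bar>m\<bar>) * int (card I)" by (intro mult_left_mono) simp_all
  then have "0 \<le> m + int (nat \<bar>m\<bar> * card I)" by simp
  then have "int (nat (m + int (nat \<bar>m\<bar> * card I))) = m + int (nat \<bar>m\<bar> * card I)" by simp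
  from sheaf_sectionsI[OF D0_zero homv_zero this] show ?thesis by simp
qed

section \<open>The Cech differential and its components\<close>

lemma cech_diff_support:
  assumes "\<And>I. card I \<noteq> p + 1 \<Longrightarrow> c I = 0" "card J \<noteq> p + 2"
  shows "cech_diff c J = 0"
  unfolding cech_diff_def
proof (intro sum.neutral ballI)
  fix j assume "j \<in> J"
  then have "card J = Suc (card (J - {j}))" using card_Suc_Diff1[of J j] by (simp add: finite)
  then show "(- 1) ^ card {i \<in> J. i < j} *s c (J - {j}) = 0"
    using assms(1)[of "J - {j}"] assms(2) by simp
qed

lemma cech_diff_pair: "j < k \<Longrightarrow> cech_diff c {j, k} = c {k} - c {j}"
proof -
  assume jk: "j < k"
  then have sets: "{i \<in> {j, k}. i < j} = {}" "{i \<in> {j, k}. i < k} = {j}" "{j, k} - {j} = {k}" "{j, k} - {k} = {j}"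
    by auto
  have "cech_diff c {j, k} = (- 1) ^ card {i \<in> {j, k}. i < j} *s c ({j, k} - {j})
      + (- 1) ^ card {i \<in> {j, k}. i < k} *s c ({j, k} - {k})"
    unfolding cech_diff_def using jk by (subst sum.insert) auto
  then show ?thesis unfolding sets by (simp add: vector_sneg_minus1[symmetric])
qed

lemma cech_diff_UNIV: "cech_diff c UNIV = c {1, 2} - c {0, 2} + c {0, 1}"
  by (simp add: cech_diff_def sum_index index_below index_complement vector_sneg_minus1[symmetric])

lemma cech_diff_diff:
  assumes "\<And>I. card I \<noteq> 1 \<Longrightarrow> b I = 0"
  shows "cech_diff (cech_diff b) J = 0"
proof (cases "J = UNIV")
  case True
  then show ?thesis by (simp add: cech_diff_UNIV cech_diff_pair index_less)
next
  case False
  then have "card J \<noteq> 3" using index_subsets(3) by blast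
  moreover have "card I \<noteq> 1 + 1 \<Longrightarrow> cech_diff b I = 0" for I
    using cech_diff_support[of 0 b I] assms by simp
  ultimately show ?thesis using cech_diff_support[of 1 "cech_diff b" J] by simp
qed

lemma cech_diff_in_cochains:
  assumes "b \<in> cech_cochains (D0 Q) m p"
  shows "cech_diff b \<in> cech_cochains (D0 Q) m (p + 1)"
  unfolding cech_cochains_def
proof (intro CollectI allI)
  fix J :: "3 set"
  have supp: "card I \<noteq> p + 1 \<Longrightarrow> b I = 0" for I
    using assms by (auto simp: cech_cochains_def)
  show "if card J = p + 1 + 1 then cech_diff b J \<in> sheaf_sections (D0 Q) m (\<Prod>i\<in>J. X i) else cech_diff b J = 0"
  proof (cases "card J = p + 1 + 1")
    case True
    then have "J \<noteq> {}" by auto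
    have face: "b (J - {j}) \<in> sheaf_sections (D0 Q) m (\<Prod>i\<in>J. X i)" if "j \<in> J" for j
    proof -
      have card: "card (J - {j}) = p + 1" using True that by simp
      then have "b (J - {j}) \<in> sheaf_sections (D0 Q) m (\<Prod>i\<in>J - {j}. X i)"
        using assms by (auto simp: cech_cochains_def)
      moreover have "J - {j} \<noteq> {}" using card by (metis card.empty add_is_0 one_neq_zero)
      ultimately show ?thesis by (rule sheaf_sections_restrict) auto
    qed
    have "(\<Sum>j\<in>K. (- 1) ^ card {i \<in> J. i < j} *s b (J - {j})) \<in> sheaf_sections (D0 Q) m (\<Prod>i\<in>J. X i)"
      if "K \<subseteq> J" for K
      using finite_subset[OF that finite] that
    proof (induction K rule: finite_induct)
      case empty
      then show ?case using sheaf_sections_zero[OF \<open>J \<noteq> {}\<close>] by simp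
    next
      case (insert j K)
      then have "(\<Sum>j\<in>K. (- 1) ^ card {i \<in> J. i < j} *s b (J - {j})) + (- 1) ^ card {i \<in> J. i < j} *s b (J - {j})
          \<in> sheaf_sections (D0 Q) m (\<Prod>i\<in>J. X i)"
        by (intro sheaf_sections_combine face \<open>J \<noteq> {}\<close>) auto
      then show ?case using insert.hyps by (simp add: add.commute)
    qed
    then show ?thesis using True by (simp add: cech_diff_def)
  next
    case False
    then show ?thesis using cech_diff_support[of p b J] supp by simp
  qed
qed

lemma cech_diff_zero_top:
  assumes "c \<in> cech_cochains M m p" "2 \<le> p"
  shows "cech_diff c = (\<lambda>J. 0)"
proof
  fix J :: "3 set"
  show "cech_diff c J = 0"
    by (rule cech_diff_support[of p]) (use assms index_subsets(4)[of J] in \<open>auto simp: cech_cochains_def\<close>)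
qed

lemma cech_coboundaries_subset:
  assumes "1 \<le> p"
  shows "cech_coboundaries (D0 Q) m p \<subseteq> cech_cocycles (D0 Q) m p"
proof
  fix c assume "c \<in> cech_coboundaries (D0 Q) m p"
  then obtain b where b: "b \<in> cech_cochains (D0 Q) m (p - 1)" "c = cech_diff b"
    using assms by (auto simp: cech_coboundaries_def)
  have c: "c \<in> cech_cochains (D0 Q) m p" using cech_diff_in_cochains[OF b(1)] b(2) assms by simp
  show "c \<in> cech_cocycles (D0 Q) m p"
  proof (cases "p = 1")
    case True
    then have "b I = 0" if "card I \<noteq> 1" for I using b(1) that by (auto simp: cech_cochains_def)
    then show ?thesis using c b(2) cech_diff_diff[of b] by (auto simp: cech_cocycles_def)
  next
    case False
    then show ?thesis using c cech_diff_zero_top[OF c] assms by (simp add: cech_cocycles_def)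
  qed
qed

lemma cohomology_vanishes_iff:
  "1 \<le> p \<Longrightarrow> cohomology_vanishes (D0 Q) m p \<longleftrightarrow>
    (\<forall>c \<in> cech_cocycles (D0 Q) m p. \<exists>b \<in> cech_cochains (D0 Q) m (p - 1). c = cech_diff b)"
  using cech_coboundaries_subset[of p Q m]
  by (auto simp: cohomology_vanishes_def cech_coboundaries_def)

lemma cohomology_vanishes_high:
  assumes "3 \<le> p"
  shows "cohomology_vanishes (D0 Q) m p"
proof -
  have "c = cech_diff (\<lambda>_. 0)" if "c \<in> cech_cocycles (D0 Q) m p" for c
  proof
    fix I :: "3 set"
    have "card I \<noteq> p + 1" using index_subsets(4)[of I] assms by simp
    then show "c I = cech_diff (\<lambda>_. 0) I"
      using that by (auto simp: cech_cocycles_def cech_cochains_def cech_diff_def)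
  qed
  moreover have "(\<lambda>_. 0) \<in> cech_cochains (D0 Q) m (p - 1)"
  proof -
    have "0 \<in> sheaf_sections (D0 Q) m (\<Prod>i\<in>I. X i)" if "card I = p - 1 + 1" for I
    proof -
      have "I \<noteq> {}" using that by auto
      then show ?thesis by (rule sheaf_sections_zero)
    qed
    then show ?thesis by (simp add: cech_cochains_def)
  qed
  ultimately show ?thesis using assms by (auto simp: cohomology_vanishes_iff)
qed

text \<open>The degree of the numerators depends only on N, p and m, so one N serves all faces. The
  inequality records that \<open>nat\<close> does not truncate.\<close>

lemma common_denominator:
  assumes "c \<in> cech_cochains (D0 Q) m p"
  obtains N0 where "\<And>N. N0 \<le> N \<Longrightarrow> \<exists>g. \<forall>I. card I = p + 1 \<longrightarrow>
    g I \<in> D0 Q \<and> homv (nat (m + int (N * (p + 1)))) (g I) \<and> 0 \<le> m + int (N * (p + 1)) \<and> c I = fr (g I) (Xprod I ^ N)"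
proof -
  let ?P = "\<lambda>I N g. g \<in> D0 Q \<and> homv (nat (m + int (N * (p + 1)))) g \<and> 0 \<le> m + int (N * (p + 1)) \<and> c I = fr g (Xprod I ^ N)"
  have "\<exists>N0. \<forall>N\<ge>N0. \<exists>g. ?P I N g" if I: "card I = p + 1" for I
  proof -
    have "c I \<in> sheaf_sections (D0 Q) m (\<Prod>i\<in>I. X i)" "I \<noteq> {}"
      using assms I by (auto simp: cech_cochains_def)
    from sheaf_sectionsE[OF this]
    obtain N0 where N0: "\<forall>N\<ge>N0. \<exists>g n. g \<in> D0 Q \<and> homv n g \<and> int n = m + int (N * card I) \<and> c I = fr g (Xprod I ^ N)" ..
    have "\<exists>g. ?P I N g" if "N0 \<le> N" for N
    proof -
      obtain g n where "g \<in> D0 Q" "homv n g" "int n = m + int (N * (p + 1))" "c I = fr g (Xprod I ^ N)"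
        using spec[OF N0, of N] \<open>N0 \<le> N\<close> unfolding I by blast
      moreover from this(3) have "nat (m + int (N * (p + 1))) = n" "0 \<le> m + int (N * (p + 1))" by linarith+
      ultimately show ?thesis by auto
    qed
    then show ?thesis by blast
  qed
  then obtain n0 where n0: "\<And>I N. card I = p + 1 \<Longrightarrow> n0 I \<le> N \<Longrightarrow> \<exists>g. ?P I N g" by metis
  show ?thesis
  proof (rule that)
    fix N assume "(\<Sum>I\<in>UNIV. n0 I) \<le> N"
    moreover have "n0 I \<le> (\<Sum>I\<in>UNIV. n0 I)" for I by (rule member_le_sum) (auto simp: finite)
    ultimately have "n0 I \<le> N" for I using order_trans by blast
    then have "\<forall>I. \<exists>g. card I = p + 1 \<longrightarrow> ?P I N g" using n0 by blast
    from choice[OF this] show "\<exists>g. \<forall>I. card I = p + 1 \<longrightarrow> ?P I N (g I)" .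
  qed
qed

lemma cech_cochains_eqI:
  assumes "c \<in> cech_cochains M m p" "\<And>I. card I = p + 1 \<Longrightarrow> c I = c' I" "\<And>I. card I \<noteq> p + 1 \<Longrightarrow> c' I = 0"
  shows "c = c'"
proof
  fix I show "c I = c' I"
    using assms by (cases "card I = p + 1") (auto simp: cech_cochains_def)
qed

section \<open>Cohomology and regularity\<close>

lemma euler_multiple_in_D0:
  assumes "finite S" "independent_lines S" "S \<noteq> {}"
    and "\<theta> \<in> D0 (\<Prod>a\<in>S. linear_form a)" "\<theta> = \<rho> *s Xvec"
  shows "\<theta> = 0"
  using euler_not_in_D0[OF assms(1-3)] assms(4,5) by auto

text \<open>A cocycle of \<open>D0\<close> is bounded by log derivations, which are then projected
  along E. The error of the projection is a multiple of E and lies in \<open>D0\<close>, so it is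
  zero.\<close>

theorem first_cohomology_vanishes:
  fixes S :: "('k::field_char_0 ^ 3) set"
  assumes S: "finite S" "independent_lines S" "S \<noteq> {}" and m: "int (card S) \<le> m + 3"
  shows "cohomology_vanishes (D0 (\<Prod>a\<in>S. linear_form a)) m 1"
proof -
  define Q where "Q = (\<Prod>a\<in>S. linear_form a)"
  have "\<exists>b \<in> cech_cochains (D0 Q) m 0. c = cech_diff b" if c: "c \<in> cech_cocycles (D0 Q) m 1" for c
  proof -
    have cc: "c \<in> cech_cochains (D0 Q) m 1" and closed: "cech_diff c UNIV = 0"
      using c by (auto simp: cech_cocycles_def)
    obtain N0 where N0: "\<And>N. N0 \<le> N \<Longrightarrow> \<exists>g. \<forall>I. card I = 1 + 1 \<longrightarrow>
      g I \<in> D0 Q \<and> homv (nat (m + int (N * (1 + 1)))) (g I) \<and> 0 \<le> m + int (N * (1 + 1)) \<and> c I = fr (g I) (Xprod I ^ N)"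
      using common_denominator[OF cc] by metis
    \<comment> \<open>The summand beyond N0 makes m + N nonnegative, so that the degree e is a
      natural number.\<close>
    define N where "N = N0 + nat \<bar>m\<bar>"
    define e where "e = nat (m + int N)"
    have e: "int e = m + int N" by (simp add: e_def N_def)
    then have deg: "nat (m + int (N * (1 + 1))) = e + N" by simp
    have "N0 \<le> N" by (simp add: N_def)
    from N0[OF this] obtain h where "\<forall>I. card I = 1 + 1 \<longrightarrow>
      h I \<in> D0 Q \<and> homv (e + N) (h I) \<and> 0 \<le> m + int (N * (1 + 1)) \<and> c I = fr (h I) (Xprod I ^ N)"
      unfolding deg ..
    then have h: "\<And>I. card I = 2 \<Longrightarrow> h I \<in> D0 Q" "\<And>I. card I = 2 \<Longrightarrow> homv (e + N) (h I)"
      "\<And>I. card I = 2 \<Longrightarrow> c I = fr (h I) (Xprod I ^ N)" by simp_all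
    \<comment> \<open>The alternating extension to ordered pairs, as \<open>log_der_cocycle\<close>
      expects.\<close>
    define g where "g j k = (if j < k then h {j, k} else if k < j then - h {k, j} else 0)" for j k
    have g_in: "g j k \<in> D0 Q" "homv (e + N) (g j k)" for j k
    proof -
      have "g j k = h {j, k} \<and> card {j, k} = 2 \<or> g j k = 0 - h {k, j} \<and> card {k, j} = 2 \<or> g j k = 0"
        by (cases j k rule: linorder_cases) (auto simp: g_def)
      then show "g j k \<in> D0 Q" "homv (e + N) (g j k)"
        using h D0_diff[of 0 Q] homv_diff[of "e + N" 0] by (metis D0_zero homv_zero)+
    qed
    have pairs: "c {j, k} = fr (g j k) ((X j * X k) ^ N)" if "j < k" for j k
      using h(3)[of "{j, k}"] that by (simp add: g_def Xprod_pair)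
    have "fr (g 1 2) ((X 1 * X 2) ^ N) - fr (g 0 2) ((X 0 * X 2) ^ N) + fr (g 0 1) ((X 0 * X 1) ^ N) = 0"
      using closed by (simp add: cech_diff_UNIV pairs index_less)
    moreover have "fr (g 1 2) ((X 1 * X 2) ^ N) = fr (X 0 ^ N *s g 1 2) (Xprod UNIV ^ N)"
      "fr (g 0 2) ((X 0 * X 2) ^ N) = fr (X 1 ^ N *s g 0 2) (Xprod UNIV ^ N)"
      "fr (g 0 1) ((X 0 * X 1) ^ N) = fr (X 2 ^ N *s g 0 1) (Xprod UNIV ^ N)"
      by (simp_all add: fr_eq_iff Xprod_def prod_index power_mult_distrib vector_smult_assoc ac_simps)
    ultimately have cyc: "X 0 ^ N *s g 1 2 - X 1 ^ N *s g 0 2 + X 2 ^ N *s g 0 1 = 0"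
      by (simp add: fr_add fr_diff fr_eq_0_iff)
    have skew: "g k j = - g j k" for j k by (auto simp: g_def)
    then have diag: "g j j = 0" for j by (simp add: g_def)
    have cocycle: "X l ^ N *s g j k + X j ^ N *s g k l + X k ^ N *s g l j = 0" for j k l
    proof -
      have "X 0 ^ N * g 1 2 $ i - X 1 ^ N * g 0 2 $ i + X 2 ^ N * g 0 1 $ i = 0" for i
        using cyc by (simp add: vec_eq_iff)
      then have eq: "X 0 ^ N * g 1 2 $ i = X 1 ^ N * g 0 2 $ i - X 2 ^ N * g 0 1 $ i" for i
        by (simp add: algebra_simps add_eq_0_iff2)
      have "\<forall>j k l. X l ^ N *s g j k + X j ^ N *s g k l + X k ^ N *s g l j = 0"
        unfolding all_index skew[of 1 0] skew[of 2 0] skew[of 2 1] diag vec_eq_iff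
        by (simp add: eq algebra_simps)
      then show ?thesis by blast
    qed
    have "N + card S \<le> e + 3" using m e by linarith
    moreover have "g j k \<in> log_der S" for j k
      using g_in(1)[of j k] D0_subset_log_der[OF S(1,2)] by (auto simp: Q_def)
    ultimately obtain \<theta> where \<theta>: "\<And>j. \<theta> j \<in> log_der S" "\<And>j. homv e (\<theta> j)"
      "\<And>j k. g j k = X j ^ N *s \<theta> k - X k ^ N *s \<theta> j"
      using log_der_cocycle[OF S(1,2) _ _ g_in(2) cocycle] by blast
    have "\<exists>\<rho>. \<theta> j - \<rho> *s Xvec \<in> D0 Q \<and> homv e (\<theta> j - \<rho> *s Xvec)" for j
      using log_der_euler_split[OF S \<theta>(1,2)] unfolding Q_def by metis
    then obtain \<rho> where \<rho>: "\<And>j. \<theta> j - \<rho> j *s Xvec \<in> D0 Q" "\<And>j. homv e (\<theta> j - \<rho> j *s Xvec)"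
      by metis
    define \<eta> where "\<eta> j = \<theta> j - \<rho> j *s Xvec" for j
    have g_eq: "g j k = X j ^ N *s \<eta> k - X k ^ N *s \<eta> j" for j k
    proof -
      have "g j k - (X j ^ N *s \<eta> k - X k ^ N *s \<eta> j) = (X j ^ N * \<rho> k - X k ^ N * \<rho> j) *s Xvec"
        by (simp add: \<theta>(3) \<eta>_def vec_eq_iff algebra_simps)
      moreover have "g j k - (X j ^ N *s \<eta> k - X k ^ N *s \<eta> j) \<in> D0 Q"
        unfolding \<eta>_def by (intro D0_diff D0_scale g_in \<rho>)
      ultimately have "g j k - (X j ^ N *s \<eta> k - X k ^ N *s \<eta> j) = 0"
        using euler_multiple_in_D0[OF S] unfolding Q_def by blast
      then show ?thesis by simp
    qed
    define b where "b I = (if card I = 1 then fr (\<eta> (the_elem I)) (X (the_elem I) ^ N) else 0)" for I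
    have "b \<in> cech_cochains (D0 Q) m 0"
    proof -
      have "b I \<in> sheaf_sections (D0 Q) m (\<Prod>i\<in>I. X i)" if "card I = 1" for I
      proof -
        obtain j where j: "I = {j}" using index_subsets(1) \<open>card I = 1\<close> by blast
        show ?thesis
          using sheaf_sectionsI[of "\<eta> j" Q e m N "{j}"] \<rho> e by (simp add: b_def j \<eta>_def)
      qed
      then show ?thesis by (simp add: cech_cochains_def b_def)
    qed
    moreover have "c = cech_diff b"
    proof (rule cech_cochains_eqI[OF cc])
      fix I :: "3 set" assume "card I = 1 + 1"
      then obtain j k where jk: "j < k" "I = {j, k}" using index_subsets(2)[of I] by auto
      have "cech_diff b I = fr (\<eta> k) (X k ^ N) - fr (\<eta> j) (X j ^ N)"
        using jk by (simp add: cech_diff_pair b_def)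
      also have "fr (\<eta> k) (X k ^ N) = fr (X j ^ N *s \<eta> k) ((X j * X k) ^ N)"
        by (simp add: fr_eq_iff power_mult_distrib vector_smult_assoc ac_simps)
      also have "fr (\<eta> j) (X j ^ N) = fr (X k ^ N *s \<eta> j) ((X j * X k) ^ N)"
        by (simp add: fr_eq_iff power_mult_distrib vector_smult_assoc ac_simps)
      finally show "c I = cech_diff b I" using jk by (simp add: pairs fr_diff g_eq)
    next
      fix I :: "3 set" assume "card I \<noteq> 1 + 1"
      then show "cech_diff b I = 0" using cech_diff_support[of 0 b I] by (simp add: b_def)
    qed
    ultimately show ?thesis by blast
  qed
  then show ?thesis by (simp add: cohomology_vanishes_iff Q_def)
qed

text \<open>The equations of the lines are homogeneous, so divisibility by them passes to
  components. This gives the witnesses of \<open>log_der_second\<close> their degree.\<close>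

lemma log_der_hpart:
  assumes "independent_lines S" "\<theta> \<in> log_der S"
  shows "(\<chi> i. hpart n (\<theta> $ i)) \<in> log_der S"
  unfolding log_der_def
proof (intro CollectI ballI allI impI)
  fix a q assume a: "a \<in> S" "dot a q = 0"
  obtain h where h: "dot (cvec a) \<theta> = linear_form a * h"
    using log_der_dvd[OF assms(1) a(1) assms(2)] by (rule dvdE)
  have "dot (cvec a) (\<chi> i. hpart n (\<theta> $ i)) = hpart n (dot (cvec a) \<theta>)"
    by (simp add: dot_expand mpart_add cvec_def hpart_mult[OF homogeneous_const])
  also have "\<dots> = linear_form a * (if 1 \<le> n then hpart (n - 1) h else 0)"
    unfolding h hpart_mult[OF homogeneous_linear_form(1)] by simp
  finally have "ev (dot (cvec a) (\<chi> i. hpart n (\<theta> $ i))) q = 0"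
    using a(2) by (simp add: ev_mult)
  then show "dot a (evv (\<chi> i. hpart n (\<theta> $ i)) q) = 0" by (simp add: ev_dot)
qed

lemma cech_diff_top:
  assumes "\<And>i. b (UNIV - {i}) = fr (g i) (Xprod (UNIV - {i}) ^ K)"
  shows "cech_diff b UNIV = fr (\<Sum>i\<in>UNIV. X i ^ K *s ((- 1) ^ card {j. j < i} *s g i)) (Xprod UNIV ^ K)"
proof -
  have "(- 1) ^ card {j. j < i} *s b (UNIV - {i})
      = fr (X i ^ K *s ((- 1) ^ card {j. j < i} *s g i)) (Xprod UNIV ^ K)" for i
  proof -
    have "(- 1) ^ card {j. j < i} *s b (UNIV - {i}) = fr ((- 1) ^ card {j. j < i} *s g i) (Xprod (UNIV - {i}) ^ K)"
      unfolding assms by (simp add: fr_sign)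
    then show ?thesis
      unfolding Xprod_UNIV[of i] power_mult_distrib by (subst fr_scale) simp_all
  qed
  then show ?thesis by (simp add: cech_diff_def fr_sum)
qed

theorem second_cohomology_vanishes:
  fixes S :: "('k::field_char_0 ^ 3) set"
  assumes S: "finite S" "independent_lines S" "\<not> (\<exists>p. p \<noteq> 0 \<and> (\<forall>a\<in>S. dot a p = 0))"
    and m: "int (card S) \<le> m + 4"
  shows "cohomology_vanishes (D0 (\<Prod>a\<in>S. linear_form a)) m 2"
proof -
  define Q where "Q = (\<Prod>a\<in>S. linear_form a)"
  have "S \<noteq> {}" using noncollinear_triple[OF S(2,3)] by blast
  note S' = S(1,2) this
  have "\<exists>b \<in> cech_cochains (D0 Q) m 1. c = cech_diff b" if c: "c \<in> cech_cocycles (D0 Q) m 2" for c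
  proof -
    have cc: "c \<in> cech_cochains (D0 Q) m 2" using c by (simp add: cech_cocycles_def)
    obtain N0 where N0: "\<And>N. N0 \<le> N \<Longrightarrow> \<exists>g. \<forall>I. card I = 2 + 1 \<longrightarrow>
      g I \<in> D0 Q \<and> homv (nat (m + int (N * (2 + 1)))) (g I) \<and> 0 \<le> m + int (N * (2 + 1)) \<and> c I = fr (g I) (Xprod I ^ N)"
      using common_denominator[OF cc] by metis
    define N where "N = N0 + nat \<bar>m\<bar>"
    define n where "n = nat (m + int (N * (2 + 1)))"
    have n: "int n = m + 3 * int N" by (simp add: n_def N_def)
    have "N0 \<le> N" by (simp add: N_def)
    from N0[OF this] obtain h where "\<forall>I. card I = 2 + 1 \<longrightarrow>
      h I \<in> D0 Q \<and> homv n (h I) \<and> 0 \<le> m + int (N * (2 + 1)) \<and> c I = fr (h I) (Xprod I ^ N)"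
      unfolding n_def ..
    then obtain \<theta> where \<theta>: "\<theta> \<in> D0 Q" "homv n \<theta>" "c UNIV = fr \<theta> (Xprod UNIV ^ N)"
      by (auto dest: spec[of _ UNIV])
    have "3 * N + card S \<le> n + 4" using m n by linarith
    moreover have "\<theta> \<in> log_der S" using \<theta>(1) D0_subset_log_der[OF S(1,2)] by (auto simp: Q_def)
    ultimately obtain L g where g: "\<And>i. g i \<in> log_der S"
      "(\<Prod>i\<in>UNIV. X i) ^ L *s \<theta> = (\<Sum>i\<in>UNIV. X i ^ (N + L) *s g i)"
      using log_der_second[OF S _ \<theta>(2)] by blast
    define K where "K = N + L"
    define k where "k = nat (m + int (2 * K))"
    have k: "int k = m + int (2 * K)" by (simp add: k_def K_def N_def)
    have deg: "L * 3 + n = K + k" using n k by (simp add: K_def)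
    define g' where "g' i = (\<chi> j. hpart k (g i $ j))" for i
    have g': "g' i \<in> log_der S" "homv k (g' i)" for i
      by (simp_all add: g'_def log_der_hpart[OF S(2) g(1)] homv_def)
    have eq: "(\<Prod>i\<in>UNIV. X i) ^ L *s \<theta> = (\<Sum>i\<in>UNIV. X i ^ K *s g' i)"
    proof -
      have "homogeneous (L * 3) ((\<Prod>i\<in>UNIV. X i :: 'k poly3) ^ L)"
        using homogeneous_power[OF homogeneous_Xprod[of UNIV], of L] by (simp add: Xprod_def)
      then have hom: "homogeneous (K + k) ((\<Prod>i\<in>UNIV. X i) ^ L * \<theta> $ j)" for j
        using homogeneous_mult[of "L * 3" _ n "\<theta> $ j"] \<theta>(2) deg by (simp add: homv_def)
      have part: "hpart (K + k) (X i ^ K * p) = X i ^ K * hpart k p" for i p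
        using hpart_mult[of K "X i ^ K" "K + k" p] by simp
      have "(\<Prod>i\<in>UNIV. X i) ^ L * \<theta> $ j = (\<Sum>i\<in>UNIV. X i ^ K * hpart k (g i $ j))" for j
      proof -
        have "(\<Prod>i\<in>UNIV. X i) ^ L * \<theta> $ j = (\<Sum>i\<in>UNIV. X i ^ K * g i $ j)"
          using arg_cong[OF g(2), of "\<lambda>v. v $ j"] by (simp add: sum_index K_def)
        then have "hpart (K + k) ((\<Prod>i\<in>UNIV. X i) ^ L * \<theta> $ j) = (\<Sum>i\<in>UNIV. X i ^ K * hpart k (g i $ j))"
          by (simp add: mpart_sum part)
        then show ?thesis by (simp add: hpart_homogeneous[OF hom])
      qed
      then show ?thesis by (simp add: vec_eq_iff sum_index g'_def)
    qed
    have "\<exists>\<rho>. g' i - \<rho> *s Xvec \<in> D0 Q \<and> homv k (g' i - \<rho> *s Xvec)" for i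
      using log_der_euler_split[OF S' g'] unfolding Q_def by metis
    then obtain \<rho> where \<rho>: "\<And>i. g' i - \<rho> i *s Xvec \<in> D0 Q" "\<And>i. homv k (g' i - \<rho> i *s Xvec)"
      by metis
    define \<eta> where "\<eta> i = g' i - \<rho> i *s Xvec" for i
    have \<eta>: "\<eta> i \<in> D0 Q" "homv k (\<eta> i)" for i using \<rho> by (simp_all add: \<eta>_def)
    have eq': "(\<Prod>i\<in>UNIV. X i) ^ L *s \<theta> = (\<Sum>i\<in>UNIV. X i ^ K *s \<eta> i)"
    proof -
      have "(\<Prod>i\<in>UNIV. X i) ^ L *s \<theta> - (\<Sum>i\<in>UNIV. X i ^ K *s \<eta> i) = (\<Sum>i\<in>UNIV. X i ^ K * \<rho> i) *s Xvec"
        unfolding eq by (simp add: \<eta>_def vec_eq_iff sum_index) (simp add: algebra_simps)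
      moreover have "(\<Prod>i\<in>UNIV. X i) ^ L *s \<theta> - (\<Sum>i\<in>UNIV. X i ^ K *s \<eta> i) \<in> D0 Q"
        by (intro D0_diff D0_scale D0_sum \<eta> \<theta>)
      ultimately have "(\<Prod>i\<in>UNIV. X i) ^ L *s \<theta> - (\<Sum>i\<in>UNIV. X i ^ K *s \<eta> i) = 0"
        using euler_multiple_in_D0[OF S'] unfolding Q_def by blast
      then show ?thesis by simp
    qed
    define opp where "opp I = the_elem (UNIV - I)" for I :: "3 set"
    have opp: "opp (UNIV - {i}) = i" for i by (simp add: opp_def Diff_Diff_Int)
    \<comment> \<open>The sign is the one carried by the face opposite to i in the differential, so
      that the two cancel.\<close>
    define b where "b I = (if card I = 2 then fr ((- 1) ^ card {j. j < opp I} *s \<eta> (opp I)) (Xprod I ^ K) else 0)" for I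
    have "b \<in> cech_cochains (D0 Q) m 1"
    proof -
      have "b I \<in> sheaf_sections (D0 Q) m (\<Prod>i\<in>I. X i)" if "card I = 2" for I
        using sheaf_sectionsI[OF D0_scale[OF \<eta>(1)] homv_sign[OF \<eta>(2)], of m K I] k that
        by (simp add: b_def mult.commute)
      then show ?thesis by (simp add: cech_cochains_def b_def)
    qed
    moreover have "c = cech_diff b"
    proof (rule cech_cochains_eqI[OF cc])
      fix I :: "3 set" assume "card I = 2 + 1"
      then have I: "I = UNIV" using index_subsets(3)[of I] by simp
      have "b (UNIV - {i}) = fr ((- 1) ^ card {j. j < i} *s \<eta> i) (Xprod (UNIV - {i}) ^ K)" for i
        by (simp add: b_def opp card_Diff_singleton)
      from cech_diff_top[OF this]
      have "cech_diff b UNIV = fr (\<Sum>i\<in>UNIV. X i ^ K *s \<eta> i) (Xprod UNIV ^ K)"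
        by (simp add: vector_smult_assoc flip: power_add)
      also have "\<dots> = fr (Xprod UNIV ^ L *s \<theta>) (Xprod UNIV ^ L * Xprod UNIV ^ N)"
        using eq' by (simp add: Xprod_def K_def power_add mult.commute)
      also have "\<dots> = fr \<theta> (Xprod UNIV ^ N)" by (rule fr_scale) simp_all
      finally show "c I = cech_diff b I" using \<theta>(3) I by simp
    next
      fix I :: "3 set" assume "card I \<noteq> 2 + 1"
      then show "cech_diff b I = 0" using cech_diff_support[of 1 b I] by (simp add: b_def)
    qed
    ultimately show ?thesis by blast
  qed
  then show ?thesis by (simp add: cohomology_vanishes_iff Q_def)
qed

text \<open>The class in degree -2 is divided by x_0^t to reach degree -2 - t; if the quotient were
  a boundary, multiplication by x_0^t would make the original class one.\<close>

theorem second_cohomology_nonzero: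
  fixes S :: "('k::field_char_0 ^ 3) set"
  assumes S: "finite S" "independent_lines S" "2 \<le> card S" and m: "m \<le> - 2"
  shows "\<not> cohomology_vanishes (D0 (\<Prod>a\<in>S. linear_form a)) m 2"
proof
  define Q where "Q = (\<Prod>a\<in>S. linear_form a)"
  assume "cohomology_vanishes (D0 (\<Prod>a\<in>S. linear_form a)) m 2"
  then have van: "\<forall>c \<in> cech_cocycles (D0 Q) m 2. \<exists>b \<in> cech_cochains (D0 Q) m 1. c = cech_diff b"
    by (simp add: cohomology_vanishes_iff Q_def)
  have "\<not> card S \<le> Suc 0" using S(3) by simp
  then obtain r s where rs: "r \<in> S" "s \<in> S" "r \<noteq> s" using card_le_Suc0_iff_eq[OF S(1)] by blast
  obtain \<theta> n N where \<theta>: "\<theta> \<in> D0 Q" "homv n \<theta>" "n + 2 = 3 * N"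
    and no: "\<forall>L g. (\<forall>i. g i \<in> log_der S) \<longrightarrow> (\<Prod>i\<in>UNIV. X i) ^ L *s \<theta> \<noteq> (\<Sum>i\<in>UNIV. X i ^ (N + L) *s g i)"
    by (rule D0_second_nonzero[OF S(1,2) rs, folded Q_def])
  define t where "t = nat (- 2 - m)"
  have t: "int t = - 2 - m" using m by (simp add: t_def)
  \<comment> \<open>This is \<theta> / (x_0 x_1 x_2)^N divided by x_0^t, written over a power of the
    full product.\<close>
  define c where "c I = (if card I = 3 then fr ((X 1 * X 2) ^ t *s \<theta>) (Xprod I ^ (N + t)) else 0)" for I
  have "homogeneous 2 (X 1 * X 2 :: 'k poly3)"
    using homogeneous_mult[OF homogeneous_X(1)[of 1] homogeneous_X(1)[of 2]] by (simp only: one_add_one)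
  then have "homogeneous (t * 2) ((X 1 * X 2 :: 'k poly3) ^ t)" by (rule homogeneous_power)
  then have hom: "homv (t * 2 + n) ((X 1 * X 2) ^ t *s \<theta>)" using \<theta>(2) homv_scale by blast
  have c: "c \<in> cech_cochains (D0 Q) m 2"
  proof -
    have "int (t * 2 + n) = m + int ((N + t) * 3)" using \<theta>(3) t by simp
    then have "c I \<in> sheaf_sections (D0 Q) m (\<Prod>i\<in>I. X i)" if "card I = 3" for I
      using sheaf_sectionsI[OF D0_scale[OF \<theta>(1)] hom, of m "N + t" I] that by (simp add: c_def)
    then show ?thesis by (simp add: cech_cochains_def c_def)
  qed
  then have "c \<in> cech_cocycles (D0 Q) m 2" using cech_diff_zero_top[OF c] by (simp add: cech_cocycles_def)
  then obtain b where b: "b \<in> cech_cochains (D0 Q) m 1" "c = cech_diff b" using van by blast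
  obtain N0 where N0: "\<And>N. N0 \<le> N \<Longrightarrow> \<exists>g. \<forall>I. card I = 1 + 1 \<longrightarrow>
      g I \<in> D0 Q \<and> homv (nat (m + int (N * (1 + 1)))) (g I) \<and> 0 \<le> m + int (N * (1 + 1)) \<and> b I = fr (g I) (Xprod I ^ N)"
    using common_denominator[OF b(1)] by metis
  define K where "K = N0 + (N + t)"
  have "N0 \<le> K" by (simp add: K_def)
  from N0[OF this] obtain h where "\<forall>I. card I = 1 + 1 \<longrightarrow> h I \<in> D0 Q \<and>
      homv (nat (m + int (K * (1 + 1)))) (h I) \<and> 0 \<le> m + int (K * (1 + 1)) \<and> b I = fr (h I) (Xprod I ^ K)" ..
  then have h: "\<And>I. card I = 2 \<Longrightarrow> h I \<in> D0 Q" "\<And>I. card I = 2 \<Longrightarrow> b I = fr (h I) (Xprod I ^ K)"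
    by simp_all
  define g where "g i = (- 1) ^ card {j. j < i} *s h (UNIV - {i})" for i
  have card: "card (UNIV - {i}) = 2" for i :: 3 by (simp add: card_Diff_singleton)
  have g: "g i \<in> D0 Q" for i unfolding g_def by (intro D0_scale h(1) card)
  have "fr ((X 1 * X 2) ^ t *s \<theta>) (Xprod UNIV ^ (N + t)) = c UNIV" by (simp add: c_def)
  also have "\<dots> = fr (\<Sum>i\<in>UNIV. X i ^ K *s g i) (Xprod UNIV ^ K)"
    unfolding b(2) g_def by (rule cech_diff_top) (rule h(2)[OF card])
  also have "fr ((X 1 * X 2) ^ t *s \<theta>) (Xprod UNIV ^ (N + t))
      = fr (Xprod UNIV ^ N0 *s ((X 1 * X 2) ^ t *s \<theta>)) (Xprod UNIV ^ K)"
    unfolding K_def power_add[of _ N0] by (rule fr_scale[symmetric]) simp_all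
  finally have "Xprod UNIV ^ K *s (Xprod UNIV ^ N0 *s ((X 1 * X 2) ^ t *s \<theta>)) = Xprod UNIV ^ K *s (\<Sum>i\<in>UNIV. X i ^ K *s g i)"
    by (subst (asm) fr_eq_iff) simp_all
  then have "Xprod UNIV ^ N0 *s ((X 1 * X 2) ^ t *s \<theta>) = (\<Sum>i\<in>UNIV. X i ^ K *s g i)"
    by (simp add: vec_eq_iff)
  then have "X 0 ^ t *s (Xprod UNIV ^ N0 *s ((X 1 * X 2) ^ t *s \<theta>)) = X 0 ^ t *s (\<Sum>i\<in>UNIV. X i ^ K *s g i)"
    by simp
  moreover have "X 0 ^ t *s (Xprod UNIV ^ N0 *s ((X 1 * X 2) ^ t *s \<theta>)) = (\<Prod>i\<in>UNIV. X i) ^ (N0 + t) *s \<theta>"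
    by (simp add: Xprod_def prod_index vector_smult_assoc power_add power_mult_distrib ac_simps)
  moreover have "X 0 ^ t *s (\<Sum>i\<in>UNIV. X i ^ K *s g i) = (\<Sum>i\<in>UNIV. X i ^ (N + (N0 + t)) *s (X 0 ^ t *s g i))"
    by (simp add: vec_eq_iff sum_index K_def algebra_simps)
  ultimately have "(\<Prod>i\<in>UNIV. X i) ^ (N0 + t) *s \<theta> = (\<Sum>i\<in>UNIV. X i ^ (N + (N0 + t)) *s (X 0 ^ t *s g i))"
    by simp
  moreover have "X 0 ^ t *s g i \<in> log_der S" for i
    using D0_scale[OF g] D0_subset_log_der[OF S(1,2)] by (auto simp: Q_def)
  ultimately show False using spec[OF spec[OF no, of "N0 + t"], of "\<lambda>i. X 0 ^ t *s g i"] by blast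
qed

text \<open>A connecting homomorphism: the cochain a has values in the free module, and only its
  coboundary lies in \<open>D0\<close>, because all local preimages send Q to the same G.\<close>

theorem first_cohomology_nonzero:
  fixes S :: "('k::field_char_0 ^ 3) set"
  assumes S: "finite S" "independent_lines S" "generic_lines S" "m + 4 \<le> card S"
  shows "\<not> cohomology_vanishes (D0 (\<Prod>a\<in>S. linear_form a)) (int m) 1"
proof
  define Q where "Q = (\<Prod>a\<in>S. linear_form a)"
  assume "cohomology_vanishes (D0 (\<Prod>a\<in>S. linear_form a)) (int m) 1"
  then have van: "\<forall>c \<in> cech_cocycles (D0 Q) (int m) 1. \<exists>b \<in> cech_cochains (D0 Q) (int m) 0. c = cech_diff b"
    by (simp add: cohomology_vanishes_iff Q_def)
  obtain f G N where "\<forall>j. homv (m + N) (f j)" "\<forall>j. derivation (f j) Q = X j ^ N * G"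
    and no: "\<forall>h. homv m h \<longrightarrow> derivation h Q \<noteq> G"
    by (rule generic_first_nonzero[OF S, folded Q_def])
  then have f: "\<And>j. homv (m + N) (f j)" "\<And>j. derivation (f j) Q = X j ^ N * G" by blast+
  define a where "a I = (if card I = 1 then fr (f (the_elem I)) (X (the_elem I) ^ N) else 0)" for I
  have "cech_diff a \<in> cech_cochains (D0 Q) (int m) 1"
  proof -
    have "cech_diff a I \<in> sheaf_sections (D0 Q) (int m) (\<Prod>i\<in>I. X i)" if "card I = 2" for I
    proof -
      obtain j k where jk: "j < k" "I = {j, k}" using index_subsets(2)[OF \<open>card I = 2\<close>] by blast
      have "cech_diff a I = fr (f k) (X k ^ N) - fr (f j) (X j ^ N)"
        using jk by (simp add: cech_diff_pair a_def)
      also have "fr (f k) (X k ^ N) = fr (X j ^ N *s f k) (Xprod I ^ N)"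
        using jk by (simp add: fr_eq_iff Xprod_pair power_mult_distrib vector_smult_assoc ac_simps)
      also have "fr (f j) (X j ^ N) = fr (X k ^ N *s f j) (Xprod I ^ N)"
        using jk by (simp add: fr_eq_iff Xprod_pair power_mult_distrib vector_smult_assoc ac_simps)
      finally have "cech_diff a I = fr (X j ^ N *s f k - X k ^ N *s f j) (Xprod I ^ N)"
        by (simp add: fr_diff)
      moreover have "X j ^ N *s f k - X k ^ N *s f j \<in> D0 Q"
        by (simp add: D0_def derivation_minus derivation_scale f(2) mult.left_commute)
      moreover have "homv (N + (m + N)) (X j ^ N *s f k - X k ^ N *s f j)"
        by (intro homv_diff homv_scale homogeneous_X_power f)
      ultimately show ?thesis
        using sheaf_sectionsI[of _ Q "N + (m + N)" "int m" N I] that by simp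
    qed
    moreover have "cech_diff a I = 0" if "card I \<noteq> 2" for I
      using cech_diff_support[of 0 a I] that by (simp add: a_def)
    ultimately show ?thesis by (simp add: cech_cochains_def)
  qed
  moreover have "cech_diff (cech_diff a) = (\<lambda>J. 0)"
    by (rule ext, rule cech_diff_diff) (simp add: a_def)
  ultimately have "cech_diff a \<in> cech_cocycles (D0 Q) (int m) 1" by (simp add: cech_cocycles_def)
  then obtain b where b: "b \<in> cech_cochains (D0 Q) (int m) 0" "cech_diff a = cech_diff b" using van by blast
  obtain N0 where N0: "\<And>N. N0 \<le> N \<Longrightarrow> \<exists>g. \<forall>I. card I = 0 + 1 \<longrightarrow>
      g I \<in> D0 Q \<and> homv (nat (int m + int (N * (0 + 1)))) (g I) \<and> 0 \<le> int m + int (N * (0 + 1)) \<and> b I = fr (g I) (Xprod I ^ N)"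
    using common_denominator[OF b(1)] by metis
  define K where "K = N0 + N"
  have deg: "nat (int m + int (K * (0 + 1))) = m + K" by simp
  have "N0 \<le> K" by (simp add: K_def)
  from N0[OF this] obtain h where "\<forall>I. card I = 0 + 1 \<longrightarrow> h I \<in> D0 Q \<and>
      homv (m + K) (h I) \<and> 0 \<le> int m + int (K * (0 + 1)) \<and> b I = fr (h I) (Xprod I ^ K)" unfolding deg ..
  then have h: "\<And>I. card I = 1 \<Longrightarrow> h I \<in> D0 Q" "\<And>I. card I = 1 \<Longrightarrow> homv (m + K) (h I)"
    "\<And>I. card I = 1 \<Longrightarrow> b I = fr (h I) (Xprod I ^ K)" by simp_all
  \<comment> \<open>If the class were trivial, correcting a by b would make the local preimages
    agree on overlaps without changing their value on Q.\<close>
  define F where "F j = X j ^ N0 *s f j - h {j}" for j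
  have F: "homv (m + K) (F j)" "derivation (F j) Q = X j ^ K * G" for j
  proof -
    have "homv (N0 + (m + N)) (X j ^ N0 *s f j)"
      by (intro homv_scale homogeneous_X_power f)
    then have "homv (m + K) (X j ^ N0 *s f j)" by (simp add: K_def ac_simps)
    then show "homv (m + K) (F j)" unfolding F_def by (intro homv_diff h(2)) simp_all
    have "derivation (h {j}) Q = 0" using h(1)[of "{j}"] by (simp add: D0_def)
    then show "derivation (F j) Q = X j ^ K * G"
      by (simp add: F_def derivation_minus derivation_scale f(2) K_def power_add)
  qed
  have diff: "a {j} - b {j} = fr (F j) (X j ^ K)" for j
  proof -
    have "a {j} = fr (X j ^ N0 *s f j) (X j ^ K)"
      unfolding K_def power_add by (subst fr_scale) (simp_all add: a_def)
    then show ?thesis using h(3)[of "{j}"] by (simp add: fr_diff F_def)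
  qed
  have same: "X k ^ K *s F j = X j ^ K *s F k" if "j < k" for j k
  proof -
    have "a {k} - a {j} = b {k} - b {j}"
      using fun_cong[OF b(2), of "{j, k}"] that by (simp add: cech_diff_pair)
    then have "a {j} - b {j} = a {k} - b {k}" by (simp add: algebra_simps)
    then show ?thesis unfolding diff by (subst (asm) fr_eq_iff) simp_all
  qed
  \<comment> \<open>Agreement on one overlap already removes the denominator, the powers of x_0 and
    x_1 being coprime; the result is a global preimage of G.\<close>
  have "\<exists>h. F 0 $ i = X 0 ^ K * h" for i
  proof -
    have "X 1 ^ K * F 0 $ i = X 0 ^ K * F 1 $ i"
      using same[OF index_less(1)] by (simp add: vec_eq_iff)
    then show ?thesis using X_power_coprime[of 1 0 K "F 0 $ i" "F 1 $ i"] by (metis zero_neq_one)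
  qed
  then obtain p where p: "\<And>i. F 0 $ i = X 0 ^ K * p i" by metis
  define P where "P = (\<chi> i. p i)"
  have F0: "F 0 = X 0 ^ K *s P" by (simp add: P_def vec_eq_iff p)
  have "homv m P"
    unfolding homv_def
  proof
    fix i
    show "homogeneous m (P $ i)"
      using homogeneous_factor(1)[OF homogeneous_X_power[of K 0] _ p[of i], of "m + K"] F(1)[of 0]
      by (simp add: homv_def P_def)
  qed
  moreover have "derivation P Q = G"
    using F(2)[of 0] unfolding F0 derivation_scale by simp
  ultimately show False using no by blast
qed

section \<open>From arrangements to sets of equations; the least regularity\<close>

lemma proj_line_eq:
  assumes "a \<noteq> 0" "c \<noteq> 0" "cr a c = 0"
  shows "proj_line a = proj_line c"
proof -
  obtain k where k: "a = k *s c" using collinear_of_cr_zero[OF assms(2,3)] .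
  then have "k \<noteq> 0" using assms(1) by auto
  have "dot a p = k * dot c p" for p by (simp add: k dot_expand algebra_simps)
  then show ?thesis using \<open>k \<noteq> 0\<close> by (auto simp: proj_line_iff)
qed

text \<open>On the integers \<open>LEAST\<close> is attained only with a lower bound at hand;
  shifting by b reduces to natural numbers.\<close>

lemma Least_int_bounded:
  fixes P :: "int \<Rightarrow> bool"
  assumes "P a" "\<And>x. P x \<Longrightarrow> b \<le> x"
  shows "P (LEAST x. P x)" and "(LEAST x. P x) \<le> a"
proof -
  define n where "n = (LEAST n. P (b + int n))"
  have start: "P (b + int (nat (a - b)))" using assms(1) assms(2)[OF assms(1)] by simp
  have n: "P (b + int n)"
    unfolding n_def using start by (rule LeastI[of "\<lambda>n. P (b + int n)"])
  have min: "n \<le> k" if "P (b + int k)" for k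
    unfolding n_def using that by (rule Least_le[of "\<lambda>n. P (b + int n)"])
  have le: "b + int n \<le> x" if "P x" for x
    using min[of "nat (x - b)"] assms(2)[OF that] that by auto
  have "(LEAST x. P x) = b + int n" by (rule Least_equality[of P, OF n le])
  then show "P (LEAST x. P x)" "(LEAST x. P x) \<le> a" using n le assms(1) by auto
qed

theorem corollary3p5:
  fixes A :: "('k::field_char_0 ^ 3) set set" and Q :: "'k poly3" and d :: nat
  assumes "line_arrangement A" and "card A = d" and "essential A"
    and "defining_polynomial A Q"
  shows "sheaf_reg (D0 Q) \<le> int d - 2 \<and>
         (generic A \<longrightarrow> sheaf_reg (D0 Q) = int d - 2)"
proof -
  obtain \<alpha> where \<alpha>: "\<And>L. L \<in> A \<Longrightarrow> \<alpha> L \<noteq> 0 \<and> L = proj_line (\<alpha> L)" and Q: "Q = (\<Prod>L\<in>A. linear_form (\<alpha> L))"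
    using assms(4) unfolding defining_polynomial_def by blast
  define S where "S = \<alpha> ` A"
  have inj: "inj_on \<alpha> A" using \<alpha> by (metis inj_onI)
  have QS: "Q = (\<Prod>a\<in>S. linear_form a)" unfolding Q S_def by (simp add: prod.reindex[OF inj])
  have fin: "finite S" using assms(1) by (simp add: line_arrangement_def S_def)
  have card: "card S = d" using assms(2) by (simp add: S_def card_image[OF inj])
  have ind: "independent_lines S"
    unfolding independent_lines_def S_def using \<alpha> proj_line_eq by (metis (no_types, lifting) imageE)
  have ess: "\<not> (\<exists>p. p \<noteq> 0 \<and> (\<forall>a\<in>S. dot a p = 0))"
  proof
    assume "\<exists>p. p \<noteq> 0 \<and> (\<forall>a\<in>S. dot a p = 0)"
    then obtain p where p: "p \<noteq> 0" "\<And>L. L \<in> A \<Longrightarrow> dot (\<alpha> L) p = 0" by (auto simp: S_def)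
    then have "p \<in> L" if "L \<in> A" for L using \<alpha>[OF that] that proj_line_iff by metis
    then show False using p(1) assms(3) by (auto simp: essential_def concurrent_def)
  qed
  obtain a b c where abc: "a \<in> S" "b \<in> S" "c \<in> S" "dot a (cr b c) \<noteq> 0"
    using noncollinear_triple[OF ind ess] by metis
  then have "a \<noteq> b" "a \<noteq> c" "b \<noteq> c" by auto
  then have "card {a, b, c} = 3" by simp
  then have d3: "3 \<le> d" using card_mono[OF fin, of "{a, b, c}"] abc card by simp
  have reg: "sheaf_regular (int d - 2) (D0 Q)"
    unfolding sheaf_regular_def
  proof (intro allI impI)
    fix i :: nat assume "1 \<le> i"
    then consider "i = 1" | "i = 2" | "3 \<le> i" by linarith
    then show "cohomology_vanishes (D0 Q) (int d - 2 - int i) i"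
    proof cases
      case 1
      then show ?thesis
        using first_cohomology_vanishes[OF fin ind, of "int d - 3"] abc(1) card by (auto simp: QS)
    next
      case 2
      then show ?thesis
        using second_cohomology_vanishes[OF fin ind ess, of "int d - 4"] card by (simp add: QS)
    qed (rule cohomology_vanishes_high)
  qed
  \<comment> \<open>The second cohomology in degree m - 2 <= -2 excludes m <= 0; this makes the
    least regularity exist.\<close>
  have bound: "1 \<le> m" if "sheaf_regular m (D0 Q)" for m
  proof (rule ccontr)
    assume "\<not> 1 \<le> m"
    then have "\<not> cohomology_vanishes (D0 Q) (m - 2) 2"
      unfolding QS using second_cohomology_nonzero[OF fin ind] d3 card by simp
    then show False using that by (auto simp: sheaf_regular_def dest: spec[of _ 2])
  qed
  have least: "sheaf_regular (sheaf_reg (D0 Q)) (D0 Q)" "sheaf_reg (D0 Q) \<le> int d - 2"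
    unfolding sheaf_reg_def
    using Least_int_bounded[of "\<lambda>m. sheaf_regular m (D0 Q)", OF reg bound] by blast+
  have "int d - 2 \<le> sheaf_reg (D0 Q)" if gen: "generic A"
  proof (rule ccontr)
    assume less: "\<not> int d - 2 \<le> sheaf_reg (D0 Q)"
    have "generic_lines S"
      unfolding generic_lines_def
    proof (intro ballI impI notI)
      fix a b c assume abc: "a \<in> S" "b \<in> S" "c \<in> S" "a \<noteq> b" "a \<noteq> c" "b \<noteq> c" and det: "dot a (cr b c) = 0"
      then have "cr b c \<noteq> 0" using ind by (auto simp: independent_lines_def)
      moreover have "cr b c \<in> L" if "L \<in> {proj_line a, proj_line b, proj_line c}" for L
        using that det by (auto simp: proj_line_iff)
      ultimately have "concurrent {proj_line a, proj_line b, proj_line c}"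
        unfolding concurrent_def by blast
      moreover have "proj_line a \<in> A" "proj_line b \<in> A" "proj_line c \<in> A"
        "proj_line a \<noteq> proj_line b" "proj_line a \<noteq> proj_line c" "proj_line b \<noteq> proj_line c"
        using abc \<alpha> unfolding S_def by (metis imageE)+
      ultimately show False
        using gen unfolding generic_def by (elim allE[of _ "{proj_line a, proj_line b, proj_line c}"]) simp
    qed
    \<comment> \<open>The degree in which regularity tests the first cohomology. It lies between 0
      and d - 4, where that cohomology is nonzero.\<close>
    define m where "m = nat (sheaf_reg (D0 Q) - 1)"
    have m: "int m = sheaf_reg (D0 Q) - int 1" using bound[OF least(1)] by (simp add: m_def)
    then have "m + 4 \<le> card S" using less card by linarith
    then have "\<not> cohomology_vanishes (D0 Q) (int m) 1"
      unfolding QS by (rule first_cohomology_nonzero[OF fin ind \<open>generic_lines S\<close>])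
    then show False using least(1) unfolding m sheaf_regular_def by blast
  qed
  then show ?thesis using least(2) by auto
qed

end
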